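(* Let $f,g,h\in S=\mathbb{R}[x,y,z]$ be linearly independent forms of the same degree $n$ with no common zero in $\mathbb{P}^2$ (no basepoints), spanning the net $N$. Let $\Delta$ be a mesh all of whose edge forms lie in $N$, let $r\ge 0$ be an integer, let $R=\mathbb{R}[u,v,w]$, and let $\phi=\phi_N$ and $\phi^*=\phi_N^*\colon R\to S$ be the associated maps, so $\phi^*(u)=f$, $\phi^*(v)=g$, $\phi^*(w)=h$. Then, as $S$-modules, $$C^r(\Delta)\ \cong\ C^r(\phi(\Delta))\otimes_R S ,$$ and as (left) $R$-modules, $$C^r(\Delta)\ \cong\ C^r(\phi(\Delta))\otimes_{\mathbb{R}}\frac{S}{\langle f,g,h\rangle}.$$ Consequently: (1) $\displaystyle \dim C^r_d(\Delta)=\sum_{ni+j=d}\dim C^r_i(\phi(\Delta))\cdot\dim\Bigl(\frac{S}{\langle f,g,h\rangle}\Bigr)_{j}$ for every $d\geq 0$, and (2) if $HS(C^r(\phi(\Delta)),t)=\dfrac{p(t)}{(1-t)^3}$ for a polynomial $p$, then $HS(C^r(\Delta),t)=\dfrac{p(t^n)}{(1-t)^3}$.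
   Context: Meshes. A mesh $\Delta$ is a finite cell complex in $\mathbb{R}^2$ whose 1-cells are arcs of irreducible real algebraic curves; its 2-cells, 1-cells, 0-cells are called faces, edges, vertices. It is assumed that each vertex and edge lies in the boundary of some face, that $\Delta$ is connected, and that it is hereditary: for any faces $\sigma,\sigma'$ sharing a vertex $v$ there is a sequence of faces $\sigma=\sigma_0,\dots,\sigma_k=\sigma'$ all containing $v$ with consecutive faces sharing an edge. The support $|\Delta|\subset\mathbb{R}^2$ is assumed contractible, and each connected component of the intersection of two cells is a cell of $\Delta$. $\Delta_2$ is the set of faces and $\Delta_i^\circ$ is the set of $i$-cells lying in the interior of $|\Delta|$. Faces carry the orientation of $\mathbb{R}^2$, and an orientation of each interior edge is fixed. Edge forms. For an interior edge $\tau$ with underlying curve $g_\tau(x,y)=0$, the edge form $G_\tau\in S=\mathbb{R}[x,y,z]$ is the homogenization of $g_\tau$. "Form" means homogeneous polynomial. Spline module. $C^r_d(\Delta)$ is the real vector space of lists $(F_\sigma\mid\sigma\in\Delta_2)$ of forms of degree $d$ in $S$ whose dehomogenizations $F_\sigma(x,y,1)$ define a piecewise polynomial function on $|\Delta|$ that has continuous $r$th order partial derivatives; equivalently, $G_\tau^{r+1}$ divides $F_\sigma-F_{\sigma'}$ whenever the interior edge $\tau$ borders the faces $\sigma,\sigma'$. The spline module is the graded $S$-module $C^r(\Delta)=\bigoplus_d C^r_d(\Delta)$, i.e. the kernel of $S^{\Delta_2}\to\bigoplus_{\tau\in\Delta_1^\circ}S/\langle G_\tau^{r+1}\rangle$ whose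 $\tau$-component is $F_\sigma-F_{\sigma'}$, where $\tau$ is a component of $\sigma\cap\sigma'$ and its orientation agrees with that induced from $\sigma$. Nets. A net $N$ is a three-dimensional real vector space of forms of a common degree $n$, here the span of $f,g,h$. It defines the rational map $\phi_N\colon\mathbb{P}^2\dashrightarrow\mathbb{P}^2$, $\phi_N[x:y:z]=[f:g:h]$, and the pullback ring map $\phi_N^*\colon R=\mathbb{R}[u,v,w]\to S$, through which $S$ is an $R$-module. "No common zeros in $\mathbb{P}^2$" is understood over the complex numbers, so that $f,g,h$ is a regular sequence in $S$. For each interior edge $\tau$, $\ell_{\phi(\tau)}\in R$ is the linear form with $\phi^*(\ell_{\phi(\tau)})=G_\tau$, and $J(\phi(\tau))=\langle \ell_{\phi(\tau)}^{r+1}\rangle\subset R$. The map $\phi$ need not be injective on $|\Delta|$, so $C^r(\phi(\Delta))$ is defined algebraically as the graded $R$-module $$C^r(\phi(\Delta))=\ker\Bigl(\bigoplus_{\sigma\in\Delta_2}R\ \longrightarrow\ \bigoplus_{\tau\in\Delta_1^\circ}R/J(\phi(\tau))\Bigr),$$ with the map given by the same differences as for $C^r(\Delta)$ (one summand $\phi(\sigma)$ for each face $\sigma$ and one summand $\phi(\tau)$ for each interior edge $\tau$). $C^r_i(\phi(\Delta))$ is its degree-$i$ part. For a finitely generated graded module $M$ over a polynomial ring over $\mathbb{R}$, $HS(M,t)=\sum_{d\ge0}\dim_{\mathbb{R}}M_d\,t^d$. *)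

theory Defs
  imports
    "HOL-Analysis.Analysis"
    "HOL-Library.Poly_Mapping"
    "HOL-Library.Numeral_Type"
    "HOL-Computational_Algebra.Computational_Algebra"
    "HOL-Algebra.Free_Abelian_Groups"
    "HOL-Algebra.Generated_Groups"
    "HOL-Algebra.QuotRing"
    "Jordan_Normal_Form.VS_Connect"
begin

no_notation Matrix.vec_index (infixl "$" 100)

section \<open>Polynomials\<close>

type_synonym 'v mpoly = "('v \<Rightarrow>\<^sub>0 nat) \<Rightarrow>\<^sub>0 real"

text \<open>Variables are indexed by the types \<^typ>\<open>2\<close> and \<^typ>\<open>3\<close>. Indices 1, 2, 3 stand for
  $x,y,z$ when a \<open>poly3\<close> is read in $S$ and for $u,v,w$ when it is read in $R$.\<close>

type_synonym poly2 = "2 mpoly"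
type_synonym poly3 = "3 mpoly"

definition mdeg :: "('v::finite \<Rightarrow>\<^sub>0 nat) \<Rightarrow> nat" where
  "mdeg m = (\<Sum>i\<in>UNIV. Poly_Mapping.lookup m i)"

definition total_deg :: "'v::finite mpoly \<Rightarrow> nat" where
  "total_deg p = Max (insert 0 (mdeg ` Poly_Mapping.keys p))"

definition form :: "nat \<Rightarrow> 'v::finite mpoly \<Rightarrow> bool" where
  "form d p \<longleftrightarrow> (\<forall>m\<in>Poly_Mapping.keys p. mdeg m = d)"

definition Const :: "real \<Rightarrow> 'v mpoly" where
  "Const c = Poly_Mapping.single 0 c"

text \<open>Substitution \<open>X\<^sub>i \<mapsto> a i\<close>, where \<open>\<iota>\<close> embeds the coefficients into the target ring.\<close>

definition mpoly_eval :: "(real \<Rightarrow> 'b::comm_ring_1) \<Rightarrow> ('v::finite \<Rightarrow> 'b) \<Rightarrow> 'v mpoly \<Rightarrow> 'b" where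
  "mpoly_eval \<iota> a p =
     (\<Sum>m\<in>Poly_Mapping.keys p.
        \<iota> (Poly_Mapping.lookup p m) * (\<Prod>i\<in>UNIV. a i ^ Poly_Mapping.lookup m i))"

definition homogenization :: "poly2 \<Rightarrow> poly3" where
  "homogenization p =
     (\<Sum>m\<in>Poly_Mapping.keys p.
        Poly_Mapping.single
          (Poly_Mapping.single 1 (Poly_Mapping.lookup m 1) +
           Poly_Mapping.single 2 (Poly_Mapping.lookup m 2) +
           Poly_Mapping.single 3 (total_deg p - mdeg m))
          (Poly_Mapping.lookup p m))"


section \<open>Nets\<close>

definition lin_indep3 :: "poly3 \<Rightarrow> poly3 \<Rightarrow> poly3 \<Rightarrow> bool" where
  "lin_indep3 f g h \<longleftrightarrow>
     (\<forall>a b c. Const a * f + Const b * g + Const c * h = 0 \<longrightarrow> a = 0 \<and> b = 0 \<and> c = 0)"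

definition net :: "poly3 \<Rightarrow> poly3 \<Rightarrow> poly3 \<Rightarrow> poly3 set" where
  "net f g h = {Const a * f + Const b * g + Const c * h | a b c. True}"

text \<open>Base points are points of the complex projective plane, i.e. nonzero vectors up to scaling.\<close>

definition no_basepoints :: "poly3 \<Rightarrow> poly3 \<Rightarrow> poly3 \<Rightarrow> bool" where
  "no_basepoints f g h \<longleftrightarrow>
     \<not> (\<exists>p :: complex ^ 3. p \<noteq> 0 \<and>
          mpoly_eval of_real (\<lambda>i. p $ i) f = 0 \<and>
          mpoly_eval of_real (\<lambda>i. p $ i) g = 0 \<and>
          mpoly_eval of_real (\<lambda>i. p $ i) h = 0)"

definition pullback :: "poly3 \<Rightarrow> poly3 \<Rightarrow> poly3 \<Rightarrow> poly3 \<Rightarrow> poly3" where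
  "pullback f g h = mpoly_eval Const (\<lambda>i. (vector [f, g, h] :: poly3 ^ 3) $ i)"


section \<open>Meshes\<close>

text \<open>Cells are closed. \<open>Curve \<tau>\<close> is a polynomial defining the irreducible curve underlying the
  edge \<open>\<tau>\<close>; it is determined by \<open>\<tau>\<close> up to a nonzero scalar.\<close>

record mesh =
  Faces :: "(real ^ 2) set set"
  Edges :: "(real ^ 2) set set"
  Vertices :: "(real ^ 2) set"
  Curve :: "(real ^ 2) set \<Rightarrow> poly2"

definition cells :: "mesh \<Rightarrow> (real ^ 2) set set" where
  "cells \<Delta> = Faces \<Delta> \<union> Edges \<Delta> \<union> (\<lambda>v. {v}) ` Vertices \<Delta>"

definition support :: "mesh \<Rightarrow> (real ^ 2) set" where
  "support \<Delta> = \<Union>(cells \<Delta>)"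

text \<open>The open cells are \<open>interior \<sigma>\<close> for a face, \<open>\<tau> - Vertices \<Delta>\<close> for an edge, and the vertices.\<close>

definition cell_complex :: "mesh \<Rightarrow> bool" where
  "cell_complex \<Delta> \<longleftrightarrow>
     finite (cells \<Delta>) \<and>
     (\<forall>\<sigma>\<in>Faces \<Delta>. \<sigma> homeomorphic (cball 0 1 :: (real ^ 2) set)) \<and>
     (\<forall>\<tau>\<in>Edges \<Delta>. \<exists>p. arc p \<and> path_image p = \<tau> \<and>
        \<tau> \<inter> Vertices \<Delta> = {pathstart p, pathfinish p}) \<and>
     (\<forall>\<sigma>\<in>Faces \<Delta>. frontier \<sigma> = \<Union>{\<tau>\<in>Edges \<Delta>. \<tau> \<subseteq> frontier \<sigma>}) \<and>
     (\<forall>\<sigma>\<in>Faces \<Delta>. \<forall>\<sigma>'\<in>Faces \<Delta>. \<sigma> \<noteq> \<sigma>' \<longrightarrow> interior \<sigma> \<inter> interior \<sigma>' = {}) \<and>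
     (\<forall>\<sigma>\<in>Faces \<Delta>. interior \<sigma> \<inter> (\<Union>(Edges \<Delta>) \<union> Vertices \<Delta>) = {}) \<and>
     (\<forall>\<tau>\<in>Edges \<Delta>. \<forall>\<tau>'\<in>Edges \<Delta>. \<tau> \<noteq> \<tau>' \<longrightarrow> \<tau> \<inter> \<tau>' \<subseteq> Vertices \<Delta>)"

definition hereditary :: "mesh \<Rightarrow> bool" where
  "hereditary \<Delta> \<longleftrightarrow>
     (\<forall>v\<in>Vertices \<Delta>. \<forall>\<sigma>\<in>Faces \<Delta>. \<forall>\<sigma>'\<in>Faces \<Delta>. v \<in> \<sigma> \<and> v \<in> \<sigma>' \<longrightarrow>
        (\<exists>\<sigma>s. \<sigma>s \<noteq> [] \<and> hd \<sigma>s = \<sigma> \<and> last \<sigma>s = \<sigma>' \<and>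
              (\<forall>\<rho>\<in>set \<sigma>s. \<rho> \<in> Faces \<Delta> \<and> v \<in> \<rho>) \<and>
              (\<forall>i. Suc i < length \<sigma>s \<longrightarrow> (\<exists>\<tau>\<in>Edges \<Delta>. \<tau> \<subseteq> \<sigma>s ! i \<inter> \<sigma>s ! Suc i))))"

definition is_mesh :: "mesh \<Rightarrow> bool" where
  "is_mesh \<Delta> \<longleftrightarrow>
     cell_complex \<Delta> \<and>
     (\<forall>\<tau>\<in>Edges \<Delta>. Factorial_Ring.irreducible (Curve \<Delta> \<tau>) \<and>
        (\<forall>p\<in>\<tau>. mpoly_eval id (\<lambda>i. p $ i) (Curve \<Delta> \<tau>) = 0)) \<and>
     (\<forall>v\<in>Vertices \<Delta>. \<exists>\<sigma>\<in>Faces \<Delta>. v \<in> frontier \<sigma>) \<and>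
     (\<forall>\<tau>\<in>Edges \<Delta>. \<exists>\<sigma>\<in>Faces \<Delta>. \<tau> \<subseteq> frontier \<sigma>) \<and>
     connected (support \<Delta>) \<and>
     hereditary \<Delta> \<and>
     contractible (support \<Delta>) \<and>
     (\<forall>c\<in>cells \<Delta>. \<forall>c'\<in>cells \<Delta>. components (c \<inter> c') \<subseteq> cells \<Delta>)"

text \<open>An edge is interior if its open cell lies in the interior of the support; its endpoints may
  lie on the boundary.\<close>

definition interior_edges :: "mesh \<Rightarrow> (real ^ 2) set set" where
  "interior_edges \<Delta> = {\<tau>\<in>Edges \<Delta>. \<tau> - Vertices \<Delta> \<subseteq> interior (support \<Delta>)}"

definition edge_form :: "mesh \<Rightarrow> (real ^ 2) set \<Rightarrow> poly3" where
  "edge_form \<Delta> \<tau> = homogenization (Curve \<Delta> \<tau>)"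

definition image_form :: "poly3 \<Rightarrow> poly3 \<Rightarrow> poly3 \<Rightarrow> mesh \<Rightarrow> (real ^ 2) set \<Rightarrow> poly3" where
  "image_form f g h \<Delta> \<tau> = (THE l. form 1 l \<and> pullback f g h l = edge_form \<Delta> \<tau>)"


section \<open>Modules\<close>

abbreviation PR :: "poly3 ring" where
  "PR \<equiv> class_ring"

text \<open>The kernel of $A^{\Delta_2} \to \bigoplus_{\tau\in\Delta_1^\circ} A/\langle L_\tau^{r+1}\rangle$.
  Reversing the orientation of \<open>\<tau>\<close> exchanges the roles of \<open>\<sigma>\<close> and \<open>\<sigma>'\<close> and changes the sign of
  the \<open>\<tau>\<close>-component; the condition below is imposed for both orders, so no orientation is fixed.\<close>

definition difference_kernel ::
  "mesh \<Rightarrow> nat \<Rightarrow> ((real ^ 2) set \<Rightarrow> poly3) \<Rightarrow> (poly3, (real ^ 2) set \<Rightarrow> poly3) module" where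
  "difference_kernel \<Delta> r L =
     (ring.func_space PR (Faces \<Delta>))
       \<lparr>carrier := {F \<in> carrier (ring.func_space PR (Faces \<Delta>)).
          \<forall>\<tau>\<in>interior_edges \<Delta>. \<forall>\<sigma>\<in>Faces \<Delta>. \<forall>\<sigma>'\<in>Faces \<Delta>.
            \<tau> \<in> components (\<sigma> \<inter> \<sigma>') \<longrightarrow> F \<sigma> - F \<sigma>' \<in> Idl\<^bsub>PR\<^esub> {L \<tau> ^ (r + 1)}}\<rparr>"

definition spline_module :: "mesh \<Rightarrow> nat \<Rightarrow> (poly3, (real ^ 2) set \<Rightarrow> poly3) module" where
  "spline_module \<Delta> r = difference_kernel \<Delta> r (edge_form \<Delta>)"

definition image_spline_module ::
  "poly3 \<Rightarrow> poly3 \<Rightarrow> poly3 \<Rightarrow> mesh \<Rightarrow> nat \<Rightarrow> (poly3, (real ^ 2) set \<Rightarrow> poly3) module" where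
  "image_spline_module f g h \<Delta> r = difference_kernel \<Delta> r (image_form f g h \<Delta>)"

definition restrict_scalars ::
  "('r \<Rightarrow> 's) \<Rightarrow> ('s, 'm) module \<Rightarrow> ('r, 'm) module" where
  "restrict_scalars \<phi> M =
     \<lparr>carrier = carrier M, mult = mult M, one = \<one>\<^bsub>M\<^esub>, ring.zero = \<zero>\<^bsub>M\<^esub>, ring.add = ring.add M,
      smult = (\<lambda>r. smult M (\<phi> r))\<rparr>"

definition regular_module :: "'a ring \<Rightarrow> ('a, 'a) module" where
  "regular_module A =
     \<lparr>carrier = carrier A, mult = mult A, one = \<one>\<^bsub>A\<^esub>, ring.zero = \<zero>\<^bsub>A\<^esub>, ring.add = ring.add A,
      smult = mult A\<rparr>"

definition net_ideal :: "poly3 \<Rightarrow> poly3 \<Rightarrow> poly3 \<Rightarrow> poly3 set" where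
  "net_ideal f g h = Idl\<^bsub>PR\<^esub> {f, g, h}"

definition net_quotient :: "poly3 \<Rightarrow> poly3 \<Rightarrow> poly3 \<Rightarrow> (poly3, poly3 set) module" where
  "net_quotient f g h =
     restrict_scalars (\<lambda>s. net_ideal f g h +>\<^bsub>PR\<^esub> s) (regular_module (PR Quot net_ideal f g h))"

definition module_isomorphic ::
  "'a ring \<Rightarrow> ('a, 'm) module \<Rightarrow> ('a, 'n) module \<Rightarrow> bool" where
  "module_isomorphic A M N \<longleftrightarrow> (\<exists>\<theta>\<in>module_hom A M N. bij_betw \<theta> (carrier M) (carrier N))"


section \<open>Tensor products\<close>

text \<open>$M\otimes_A N$ is the free abelian group on $M\times N$ modulo the subgroup generated by the
  bilinearity relations. Free abelian groups and their quotients are monoid records with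
  multiplicative operation names.\<close>

definition tensor_relations ::
  "'a ring \<Rightarrow> ('a, 'm) module \<Rightarrow> ('a, 'n) module \<Rightarrow> ('m \<times> 'n \<Rightarrow>\<^sub>0 int) set" where
  "tensor_relations A M N =
     {frag_of (m \<oplus>\<^bsub>M\<^esub> m', n) - frag_of (m, n) - frag_of (m', n) | m m' n.
        m \<in> carrier M \<and> m' \<in> carrier M \<and> n \<in> carrier N} \<union>
     {frag_of (m, n \<oplus>\<^bsub>N\<^esub> n') - frag_of (m, n) - frag_of (m, n') | m n n'.
        m \<in> carrier M \<and> n \<in> carrier N \<and> n' \<in> carrier N} \<union>
     {frag_of (a \<odot>\<^bsub>M\<^esub> m, n) - frag_of (m, a \<odot>\<^bsub>N\<^esub> n) | a m n.
        a \<in> carrier A \<and> m \<in> carrier M \<and> n \<in> carrier N}"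

definition tensor_kernel ::
  "'a ring \<Rightarrow> ('a, 'm) module \<Rightarrow> ('a, 'n) module \<Rightarrow> ('m \<times> 'n \<Rightarrow>\<^sub>0 int) set" where
  "tensor_kernel A M N =
     generate (free_Abelian_group (carrier M \<times> carrier N)) (tensor_relations A M N)"

definition tensor_group ::
  "'a ring \<Rightarrow> ('a, 'm) module \<Rightarrow> ('a, 'n) module \<Rightarrow> ('m \<times> 'n \<Rightarrow>\<^sub>0 int) set monoid" where
  "tensor_group A M N = free_Abelian_group (carrier M \<times> carrier N) Mod tensor_kernel A M N"

text \<open>\<open>tensor_group\<close> as a module over a further ring, an element \<open>s\<close> of which sends the class of a
  generator \<open>(m, n)\<close> to the class of \<open>act s (m, n)\<close>. The multiplicative fields of the record are
  meaningless.\<close>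

definition tensor_module ::
  "'a ring \<Rightarrow> ('a, 'm) module \<Rightarrow> ('a, 'n) module \<Rightarrow> ('s \<Rightarrow> 'm \<times> 'n \<Rightarrow> 'm \<times> 'n) \<Rightarrow>
     ('s, ('m \<times> 'n \<Rightarrow>\<^sub>0 int) set) module" where
  "tensor_module A M N act =
     \<lparr>carrier = carrier (tensor_group A M N),
      mult = (\<lambda>_ _. \<one>\<^bsub>tensor_group A M N\<^esub>), one = \<one>\<^bsub>tensor_group A M N\<^esub>,
      ring.zero = \<one>\<^bsub>tensor_group A M N\<^esub>, ring.add = mult (tensor_group A M N),
      smult = (\<lambda>s C. \<Union>c\<in>C. tensor_kernel A M N
                 #>\<^bsub>free_Abelian_group (carrier M \<times> carrier N)\<^esub>
                 frag_extend (\<lambda>p. frag_of (act s p)) c)\<rparr>"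

text \<open>$M\otimes_A N$ for a $B$-module $N$ and a ring map $\phi: A\to B$, as a $B$-module through $N$.\<close>

definition tensor_right ::
  "'a ring \<Rightarrow> ('a \<Rightarrow> 'b) \<Rightarrow> ('a, 'm) module \<Rightarrow> ('b, 'n) module \<Rightarrow>
     ('b, ('m \<times> 'n \<Rightarrow>\<^sub>0 int) set) module" where
  "tensor_right A \<phi> M N =
     tensor_module A M (restrict_scalars \<phi> N) (\<lambda>b (m, n). (m, b \<odot>\<^bsub>N\<^esub> n))"

text \<open>$M\otimes_A N$ for a $B$-module $M$ and a ring map $\phi: A\to B$, as a $B$-module through $M$.\<close>

definition tensor_left ::
  "'a ring \<Rightarrow> ('a \<Rightarrow> 'b) \<Rightarrow> ('b, 'm) module \<Rightarrow> ('a, 'n) module \<Rightarrow>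
     ('b, ('m \<times> 'n \<Rightarrow>\<^sub>0 int) set) module" where
  "tensor_left A \<phi> M N =
     tensor_module A (restrict_scalars \<phi> M) N (\<lambda>b (m, n). (b \<odot>\<^bsub>M\<^esub> m, n))"


section \<open>Graded pieces and Hilbert series\<close>

definition real_dim :: "(poly3, 'm) module \<Rightarrow> 'm set \<Rightarrow> nat" where
  "real_dim M W =
     vectorspace.dim (class_ring :: real ring) ((restrict_scalars Const M)\<lparr>carrier := W\<rparr>)"

definition spline_part ::
  "mesh \<Rightarrow> (poly3, (real ^ 2) set \<Rightarrow> poly3) module \<Rightarrow> nat \<Rightarrow> ((real ^ 2) set \<Rightarrow> poly3) set" where
  "spline_part \<Delta> M d = {F \<in> carrier M. \<forall>\<sigma>\<in>Faces \<Delta>. form d (F \<sigma>)}"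

definition dim_spline :: "mesh \<Rightarrow> nat \<Rightarrow> nat \<Rightarrow> nat" where
  "dim_spline \<Delta> r d = real_dim (spline_module \<Delta> r) (spline_part \<Delta> (spline_module \<Delta> r) d)"

definition dim_image_spline ::
  "poly3 \<Rightarrow> poly3 \<Rightarrow> poly3 \<Rightarrow> mesh \<Rightarrow> nat \<Rightarrow> nat \<Rightarrow> nat" where
  "dim_image_spline f g h \<Delta> r i =
     real_dim (image_spline_module f g h \<Delta> r) (spline_part \<Delta> (image_spline_module f g h \<Delta> r) i)"

definition dim_net_quotient :: "poly3 \<Rightarrow> poly3 \<Rightarrow> poly3 \<Rightarrow> nat \<Rightarrow> nat" where
  "dim_net_quotient f g h j =
     real_dim (net_quotient f g h) {net_ideal f g h +>\<^bsub>PR\<^esub> p | p. form j p}"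

definition hilbert_series :: "(nat \<Rightarrow> nat) \<Rightarrow> real fps" where
  "hilbert_series dims = Abs_fps (\<lambda>d. of_nat (dims d))"

end

theory Submission
  imports Defs "HOL-Library.Function_Algebras"
begin

text \<open>Without base points, the ideal $\langle f,g,h\rangle$ contains a power of every variable: this
  is a projective Nullstellensatz, proved by the uncountability of $\mathbb{C}$. The Koszul homology
  of $f,g,h$ is annihilated by $\langle f,g,h\rangle$, hence by $x^N,y^N,z^N$ for large $N$, and these
  form a regular sequence; a diagram chase then shows that the first Koszul homology vanishes, and so
  $f,g,h$ is a regular sequence. Therefore $S$ is free over $R$, a basis being any finite set $B$ of
  monomials that induces a basis of $S/\langle f,g,h\rangle$. As $G_\tau$ is the pullback of
  $\ell_{\phi(\tau)}$, divisibility by $G_\tau^{r+1}$ can be tested on coordinates with respect to $B$,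
  that is, $C^r(\Delta)=\bigoplus_{b\in B}\phi^*(C^r(\phi(\Delta)))\,b$. Both tensor product descriptions
  and the dimension formula can be read off from this decomposition. The case of $S$ itself gives
  $1/(1-t)^3=HS(S/\langle f,g,h\rangle,t)/(1-t^n)^3$, from which the Hilbert series formula
  follows.\<close>

text \<open>Two fields are in play: base points are complex, while the forms, R and all dimensions
  are real. The Nullstellensatz is proved for complex polynomials, and the resulting expression of a
  power of a variable through f, g, h is brought back to the reals by taking real parts of the
  coefficients. Vanishing of the first Koszul homology yields at once that h is regular modulo f and
  g; that g is regular modulo f also takes a comparison of degrees, for which n must be positive.
  Positivity comes from linear independence, and it also drives the induction on degree showing that
  the monomials in B generate S over R. For splines the decisive point is that one basis serves all
  faces at once: the coordinates of a difference of two entries are the differences of their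
  coordinates. Both tensor products come from a single criterion: a balanced map to X out of M and N
  identifies X with the tensor product as soon as finitely many elements generate N and every
  element of X has unique coordinates in M with respect to them.\<close>

section \<open>Terms, monomials and coefficients\<close>

lemma mpoly_expand: "p = (\<Sum>m\<in>Poly_Mapping.keys p. Poly_Mapping.single m (Poly_Mapping.lookup p m))"
  by (rule poly_mapping_eqI)
    (auto simp: lookup_sum lookup_single when_def in_keys_iff sum.delta'[OF finite_keys])

lemma mpoly_induct [case_names single add]:
  fixes p :: "'a \<Rightarrow>\<^sub>0 'b::comm_monoid_add"
  assumes single: "\<And>m c. P (Poly_Mapping.single m c)"
    and add: "\<And>p q. P p \<Longrightarrow> P q \<Longrightarrow> P (p + q)"
  shows "P p"
proof -
  \<comment> \<open>The zero polynomial is the term with coefficient 0, whatever its monomial, so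
    the rule needs no separate case for it.\<close>
  have P0: "P 0" using single[of undefined 0] by simp
  have "P (\<Sum>m\<in>A. Poly_Mapping.single m (Poly_Mapping.lookup p m))" if "finite A" for A
    using that by (induction A rule: finite_induct) (auto intro: single add P0)
  then show ?thesis by (metis mpoly_expand finite_keys)
qed

text \<open>Generic in the coefficient ring, since the Nullstellensatz uses complex coefficients and
  the rest real ones.\<close>

definition mon :: "('v \<Rightarrow>\<^sub>0 nat) \<Rightarrow> ('v \<Rightarrow>\<^sub>0 nat) \<Rightarrow>\<^sub>0 'k::comm_ring_1" where
  "mon m = Poly_Mapping.single m 1"

definition var :: "'v \<Rightarrow> ('v \<Rightarrow>\<^sub>0 nat) \<Rightarrow>\<^sub>0 'k::comm_ring_1" where
  "var i = mon (Poly_Mapping.single i 1)"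

lemma mon_0 [simp]: "mon 0 = 1"
  by (simp add: mon_def)

lemma mon_add: "mon (m + m') = mon m * mon m'"
  by (simp add: mon_def mult_single)

lemma var_power: "var i ^ k = mon (Poly_Mapping.single i k)"
  by (induction k) (simp_all add: var_def mon_add[symmetric] single_add[symmetric])

lemma prod_mon: "(\<Prod>i\<in>A. mon (e i)) = mon (\<Sum>i\<in>A. e i)"
  by (induction A rule: infinite_finite_induct) (simp_all add: mon_add)

lemma mon_eq_prod: "mon m = (\<Prod>i\<in>UNIV. var i ^ Poly_Mapping.lookup m i)" for m :: "'v::finite \<Rightarrow>\<^sub>0 nat"
proof -
  have "(\<Sum>i\<in>UNIV. Poly_Mapping.single i (Poly_Mapping.lookup m i)) = m"
    by (rule poly_mapping_eqI) (simp add: lookup_sum lookup_single when_def)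
  then show ?thesis by (simp only: var_power prod_mon)
qed

lemma single_eq_mon: "Poly_Mapping.single m c = Poly_Mapping.single 0 c * mon m"
  by (simp add: mon_def mult_single)

lemma lookup_mon: "Poly_Mapping.lookup (mon m) m' = (if m = m' then 1 else 0)"
  by (simp add: mon_def lookup_single when_def)

lemma lookup_single_0_mult [simp]:
  "Poly_Mapping.lookup (Poly_Mapping.single 0 c * p) m = c * Poly_Mapping.lookup p m"
  for p :: "('v \<Rightarrow>\<^sub>0 nat) \<Rightarrow>\<^sub>0 'k::comm_ring_1"
proof (induction p rule: mpoly_induct)
  case (single m' d) then show ?case by (simp add: mult_single lookup_single when_def)
next
  case (add p q) then show ?case by (simp add: distrib_left lookup_add)
qed

lemma lookup_mon_mult:
  "Poly_Mapping.lookup (mon k * p) (k + m) = Poly_Mapping.lookup p m"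
  for p :: "('v \<Rightarrow>\<^sub>0 nat) \<Rightarrow>\<^sub>0 'k::comm_ring_1"
proof (induction p rule: mpoly_induct)
  case (single m' d) then show ?case by (simp add: mon_def mult_single lookup_single when_def)
next
  case (add p q) then show ?case by (simp add: distrib_left lookup_add)
qed

lemma comm_ring_hom_single_0: "comm_ring_hom (Poly_Mapping.single 0 :: 'k::comm_ring_1 \<Rightarrow> ('v \<Rightarrow>\<^sub>0 nat) \<Rightarrow>\<^sub>0 'k)"
  by unfold_locales (simp_all add: single_add mult_single)

lemma comm_ring_hom_Const: "comm_ring_hom Const"
proof -
  have "Const = Poly_Mapping.single 0" by (simp add: Const_def fun_eq_iff)
  then show ?thesis using comm_ring_hom_single_0 by metis
qed

interpretation Const: comm_ring_hom Const
  by (rule comm_ring_hom_Const)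

lemma lookup_Const_mult [simp]:
  "Poly_Mapping.lookup (Const c * p) m = c * Poly_Mapping.lookup p m"
  by (simp add: Const_def)

section \<open>Evaluation\<close>

text \<open>The key sets of \<open>p\<close>, \<open>q\<close> and \<open>p + q\<close> differ; over
  a common finite set of exponents the three sums can be compared term by term.\<close>

lemma mpoly_eval_superset:
  assumes "\<iota> 0 = 0" "finite A" "Poly_Mapping.keys p \<subseteq> A"
  shows "mpoly_eval \<iota> a p = (\<Sum>m\<in>A. \<iota> (Poly_Mapping.lookup p m) * (\<Prod>i\<in>UNIV. a i ^ Poly_Mapping.lookup m i))"
  unfolding mpoly_eval_def using assms
  by (intro sum.mono_neutral_left) (auto simp: in_keys_iff)

lemma mpoly_eval_add:
  assumes "comm_ring_hom \<iota>"
  shows "mpoly_eval \<iota> a (p + q) = mpoly_eval \<iota> a p + mpoly_eval \<iota> a q"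
proof -
  interpret comm_ring_hom \<iota> by fact
  let ?A = "Poly_Mapping.keys p \<union> Poly_Mapping.keys q"
  have "Poly_Mapping.keys (p + q) \<subseteq> ?A" by (rule keys_add)
  then show ?thesis
    by (simp add: mpoly_eval_superset[of _ ?A] lookup_add hom_add distrib_right sum.distrib)
qed

lemma mpoly_eval_single:
  assumes "comm_ring_hom \<iota>"
  shows "mpoly_eval \<iota> a (Poly_Mapping.single m c) = \<iota> c * (\<Prod>i\<in>UNIV. a i ^ Poly_Mapping.lookup m i)"
proof -
  interpret comm_ring_hom \<iota> by fact
  show ?thesis by (simp add: mpoly_eval_superset[of _ "{m}"])
qed

lemma mpoly_eval_mult:
  assumes "comm_ring_hom \<iota>"
  shows "mpoly_eval \<iota> a (p * q) = mpoly_eval \<iota> a p * mpoly_eval \<iota> a q"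
proof -
  interpret comm_ring_hom \<iota> by fact
  have "mpoly_eval \<iota> a (Poly_Mapping.single m c * q) = mpoly_eval \<iota> a (Poly_Mapping.single m c) * mpoly_eval \<iota> a q" for m c
    by (induction q rule: mpoly_induct)
      (simp_all add: mult_single mpoly_eval_single[OF assms] hom_mult lookup_add power_add prod.distrib
        distrib_left mpoly_eval_add[OF assms] mult.assoc mult.left_commute)
  then show ?thesis
    by (induction p rule: mpoly_induct) (simp_all add: distrib_right mpoly_eval_add[OF assms])
qed

lemma comm_ring_hom_mpoly_eval:
  assumes "comm_ring_hom \<iota>"
  shows "comm_ring_hom (mpoly_eval \<iota> a)"
proof -
  interpret comm_ring_hom \<iota> by fact
  have one: "mpoly_eval \<iota> a 1 = 1"
    using mpoly_eval_single[OF assms, of a 0 1] by simp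
  have "mpoly_eval \<iota> a 0 = 0"
    using mpoly_eval_single[OF assms, of a 0 0] by simp
  then show ?thesis
    by unfold_locales (simp_all add: mpoly_eval_add[OF assms] mpoly_eval_mult[OF assms] one)
qed

lemma mpoly_eval_Const:
  assumes "comm_ring_hom \<iota>"
  shows "mpoly_eval \<iota> a (Const c) = \<iota> c"
  by (simp add: Const_def mpoly_eval_single[OF assms])

lemma mpoly_eval_mon:
  assumes "comm_ring_hom \<iota>"
  shows "mpoly_eval \<iota> a (mon m) = (\<Prod>i\<in>UNIV. a i ^ Poly_Mapping.lookup m i)"
proof -
  interpret comm_ring_hom \<iota> by fact
  show ?thesis by (simp add: mon_def mpoly_eval_single[OF assms])
qed

section \<open>Homogeneous parts\<close>

lemma mdeg_0 [simp]: "mdeg 0 = 0"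
  by (simp add: mdeg_def)

lemma mdeg_add: "mdeg (m + m') = mdeg m + mdeg m'"
  by (simp add: mdeg_def lookup_add sum.distrib)

lemma mdeg_single [simp]: "mdeg (Poly_Mapping.single i k) = k"
  by (simp add: mdeg_def lookup_single when_def)

lemma form_0 [simp]: "form d 0"
  by (simp add: form_def)

lemma form_single: "mdeg m = d \<Longrightarrow> form d (Poly_Mapping.single m c)"
  by (simp add: form_def)

lemma form_mon: "form (mdeg m) (mon m)"
  by (simp add: mon_def form_single)

lemma form_Const: "form 0 (Const c)"
  by (simp add: Const_def form_single)

lemma form_add: "form d p \<Longrightarrow> form d q \<Longrightarrow> form d (p + q)"
  using keys_add[of p q] by (auto simp: form_def)

lemma form_sum: "(\<And>x. x \<in> A \<Longrightarrow> form d (p x)) \<Longrightarrow> form d (\<Sum>x\<in>A. p x)"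
  by (induction A rule: infinite_finite_induct) (auto intro: form_add)

lemma form_mult: "form d p \<Longrightarrow> form e q \<Longrightarrow> form (d + e) (p * q)"
  using keys_mult[of p q] by (auto simp: form_def mdeg_add)

lemma form_Const_mult: "form d p \<Longrightarrow> form d (Const c * p)"
  using form_mult[OF form_Const] by force

lemma form_uminus: "form d p \<Longrightarrow> form d (- p)"
  by (auto simp: form_def in_keys_iff)

lemma form_power: "form d p \<Longrightarrow> form (k * d) (p ^ k)"
  by (induction k) (auto intro: form_mult simp: form_def[of 0 1])

definition hpart :: "nat \<Rightarrow> 'v::finite mpoly \<Rightarrow> 'v mpoly" where
  "hpart d p = (\<Sum>m\<in>Poly_Mapping.keys p. Poly_Mapping.single m (Poly_Mapping.lookup p m when mdeg m = d))"

lemma lookup_hpart: "Poly_Mapping.lookup (hpart d p) m = (Poly_Mapping.lookup p m when mdeg m = d)"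
proof -
  have "Poly_Mapping.lookup (hpart d p) m =
      (\<Sum>k\<in>Poly_Mapping.keys p. if k = m then (Poly_Mapping.lookup p m when mdeg m = d) else 0)"
    unfolding hpart_def lookup_sum by (intro sum.cong) (auto simp: lookup_single when_def)
  then show ?thesis by (simp add: in_keys_iff when_def)
qed

lemma hpart_add: "hpart d (p + q) = hpart d p + hpart d q"
  by (rule poly_mapping_eqI) (simp add: lookup_hpart lookup_add when_def)

lemma hpart_0 [simp]: "hpart d 0 = 0"
  by (simp add: hpart_def)

lemma hpart_sum: "hpart d (\<Sum>x\<in>A. p x) = (\<Sum>x\<in>A. hpart d (p x))"
  by (induction A rule: infinite_finite_induct) (simp_all add: hpart_add)

lemma form_hpart: "form d (hpart d p)"
  by (auto simp: form_def in_keys_iff lookup_hpart when_def split: if_splits)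

lemma hpart_form: "form d p \<Longrightarrow> hpart e p = (if d = e then p else 0)"
  by (rule poly_mapping_eqI) (auto simp: lookup_hpart when_def form_def in_keys_iff)

lemma hpart_Const_mult: "hpart d (Const c * p) = Const c * hpart d p"
  by (rule poly_mapping_eqI) (simp add: lookup_hpart when_def)

text \<open>Multiplication by a form of degree \<open>n\<close> shifts the grading by
  \<open>n\<close>, which is visible on single terms. Below degree \<open>n\<close> nothing remains;
  that case is separate because subtraction on naturals is truncated.\<close>

lemma hpart_mult_form:
  assumes "form n q"
  shows "hpart d (p * q) = (if n \<le> d then hpart (d - n) p * q else 0)"
proof (induction p rule: mpoly_induct)
  case (single m c)
  have "form (mdeg m + n) (Poly_Mapping.single m c * q)"
    by (rule form_mult[OF form_single assms]) simp
  then show ?case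
    by (auto simp: hpart_form hpart_form[OF form_single[OF refl]])
next
  case (add p q) then show ?case by (simp add: hpart_add distrib_right)
qed

lemma sum_hpart: "\<exists>D. p = (\<Sum>d<D. hpart d p)"
proof
  let ?D = "Suc (total_deg p)"
  show "p = (\<Sum>d<?D. hpart d p)"
  proof (rule poly_mapping_eqI)
    fix m
    have "mdeg m < ?D" if "m \<in> Poly_Mapping.keys p"
      using that by (simp add: total_deg_def less_Suc_eq_le Max_ge)
    then show "Poly_Mapping.lookup p m = Poly_Mapping.lookup (\<Sum>d<?D. hpart d p) m"
      by (auto simp: lookup_sum lookup_hpart when_def in_keys_iff simp del: sum.lessThan_Suc)
  qed
qed

section \<open>Ideals as submodules of the ring, and congruences modulo them\<close>

text \<open>A commutative ring is a module over itself and its submodules are the ideals, so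
  \<open>ri.span S\<close> is the ideal generated by \<open>S\<close>.\<close>

interpretation ri: Modules.module "(*) :: 'a::comm_ring_1 \<Rightarrow> 'a \<Rightarrow> 'a"
  by unfold_locales (simp_all add: distrib_left distrib_right mult.assoc)

text \<open>Here \<open>scale_scale\<close> is associativity of multiplication from right to left and loops
  with \<open>mult.assoc\<close>.\<close>

declare ri.scale_scale [simp del]

text \<open>With \<open>a - b \<in> ri.span S\<close> read as a congruence of \<open>a\<close> and
  \<open>b\<close>, this and the next facts are the compatibility of congruence with the ring
  operations.\<close>

lemma span_mult_cong:
  assumes "a - b \<in> ri.span S" "a' - b' \<in> ri.span S"
  shows "a * a' - b * b' \<in> ri.span S"
proof -
  have "a' * (a - b) + b * (a' - b') \<in> ri.span S"
    using assms by (intro ri.span_add ri.span_scale)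
  then show ?thesis by (simp add: algebra_simps)
qed

lemma span_power_cong: "a - b \<in> ri.span S \<Longrightarrow> a ^ k - b ^ k \<in> ri.span S"
  by (induction k) (simp_all add: ri.span_zero span_mult_cong)

lemma span_prod_cong:
  "(\<And>i. i \<in> A \<Longrightarrow> a i - b i \<in> ri.span S) \<Longrightarrow> (\<Prod>i\<in>A. a i) - (\<Prod>i\<in>A. b i) \<in> ri.span S"
  by (induction A rule: infinite_finite_induct) (simp_all add: ri.span_zero span_mult_cong)

lemma span_sum_cong:
  "(\<And>i. i \<in> A \<Longrightarrow> a i - b i \<in> ri.span S) \<Longrightarrow> (\<Sum>i\<in>A. a i) - (\<Sum>i\<in>A. b i) \<in> ri.span S"
  by (simp add: sum_subtractf[symmetric] ri.span_sum)

lemma vector_space_mpoly: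
  "vector_space (\<lambda>c (p :: ('v \<Rightarrow>\<^sub>0 nat) \<Rightarrow>\<^sub>0 'k::field). Poly_Mapping.single 0 c * p)"
  by unfold_locales
    (simp_all add: distrib_left distrib_right single_add mult.assoc[symmetric] mult_single)

interpretation pv: vector_space "\<lambda>c (p :: ('v \<Rightarrow>\<^sub>0 nat) \<Rightarrow>\<^sub>0 'k::field). Poly_Mapping.single 0 c * p"
  by (rule vector_space_mpoly)

declare pv.scale_scale [simp del]

section \<open>Binary forms\<close>

text \<open>For \<open>degree p \<le> e\<close> this is x^e * p(y/x), the homogenization of the
  univariate \<open>p\<close> to degree \<open>e\<close>, evaluated at \<open>x\<close> and
  \<open>y\<close>. Coefficients beyond \<open>e\<close> are dropped.\<close>

definition binary_form ::
  "(('v \<Rightarrow>\<^sub>0 nat) \<Rightarrow>\<^sub>0 'k::comm_ring_1) \<Rightarrow> (('v \<Rightarrow>\<^sub>0 nat) \<Rightarrow>\<^sub>0 'k) \<Rightarrow> nat \<Rightarrow> 'k poly \<Rightarrow> (('v \<Rightarrow>\<^sub>0 nat) \<Rightarrow>\<^sub>0 'k)" where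
  "binary_form x y e p = (\<Sum>i\<le>e. Poly_Mapping.single 0 (coeff p i) * y ^ i * x ^ (e - i))"

lemma binary_form_add: "binary_form x y e (p + q) = binary_form x y e p + binary_form x y e q"
  by (simp add: binary_form_def single_add distrib_right sum.distrib)

lemma binary_form_smult:
  fixes x y :: "('v \<Rightarrow>\<^sub>0 nat) \<Rightarrow>\<^sub>0 'k::comm_ring_1"
  shows
  "binary_form x y e (Polynomial.smult c p) = Poly_Mapping.single 0 c * binary_form x y e p"
proof -
  interpret s: comm_ring_hom "Poly_Mapping.single 0 :: 'k \<Rightarrow> ('v \<Rightarrow>\<^sub>0 nat) \<Rightarrow>\<^sub>0 'k"
    by (rule comm_ring_hom_single_0)
  show ?thesis
    unfolding binary_form_def sum_distrib_left
    by (intro sum.cong refl) (simp only: coeff_smult s.hom_mult mult.assoc)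
qed

lemma binary_form_pCons_0: "binary_form x y (Suc e) (pCons 0 p) = y * binary_form x y e p"
proof -
  have "binary_form x y (Suc e) (pCons 0 p) =
      (\<Sum>i\<le>e. Poly_Mapping.single 0 (coeff p i) * y ^ Suc i * x ^ (e - i))"
    unfolding binary_form_def by (subst sum.atMost_Suc_shift) simp
  also have "\<dots> = y * binary_form x y e p"
    unfolding binary_form_def sum_distrib_left
    by (intro sum.cong refl) (simp only: power_Suc mult.assoc mult.left_commute)
  finally show ?thesis .
qed

lemma binary_form_Suc: "degree p \<le> e \<Longrightarrow> binary_form x y (Suc e) p = x * binary_form x y e p"
proof -
  assume "degree p \<le> e"
  then have "binary_form x y (Suc e) p = (\<Sum>i\<le>e. Poly_Mapping.single 0 (coeff p i) * y ^ i * x ^ Suc (e - i))"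
    by (simp add: binary_form_def coeff_eq_0 Suc_diff_le)
  also have "\<dots> = x * binary_form x y e p"
    unfolding binary_form_def sum_distrib_left
    by (intro sum.cong refl) (simp only: power_Suc mult.assoc mult.left_commute)
  finally show ?thesis .
qed

text \<open>A root of the univariate polynomial becomes a member of the pencil spanned by
  \<open>x\<close> and \<open>y\<close>. In this way roots, which exist over the complex numbers,
  translate into linear factors.\<close>

lemma binary_form_linear_factor:
  assumes "degree p \<le> e"
  shows "binary_form x y (Suc e) ([:- c, 1:] * p) = (y - Poly_Mapping.single 0 c * x) * binary_form x y e p"
proof -
  have *: "[:- c, 1:] * p = Polynomial.smult (- c) p + pCons 0 p" by simp
  show ?thesis
    unfolding * binary_form_add binary_form_smult binary_form_pCons_0 binary_form_Suc[OF assms]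
    by (simp only: single_uminus left_diff_distrib mult_minus_left mult.assoc diff_conv_add_uminus distrib_right add.commute)
qed

lemma binary_form_prod:
  fixes x y :: "('v \<Rightarrow>\<^sub>0 nat) \<Rightarrow>\<^sub>0 'k::idom"
  assumes "finite A"
  shows "binary_form x y (card A) (\<Prod>c\<in>A. [:- c, 1:]) = (\<Prod>c\<in>A. y - Poly_Mapping.single 0 c * x)"
  using assms
proof (induction A rule: finite_induct)
  case empty then show ?case by (simp add: binary_form_def)
next
  case (insert c A)
  have "degree (\<Prod>c\<in>A. [:- c, 1:]) \<le> card A"
    using degree_prod_sum_le[OF insert(1), of "\<lambda>c. [:- c, 1:]"] by simp
  from binary_form_linear_factor[OF this, of x y c] show ?case
    unfolding insert.IH card_insert_disjoint[OF insert.hyps] prod.insert[OF insert.hyps] .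
qed

section \<open>The projective Nullstellensatz\<close>

text \<open>The hypothesis says that the ideal acquires a power of \<open>x\<close> at every point of the pencil
  \<open>y = c x\<close>; peeling off one linear factor of a binary form at a time keeps only powers of \<open>x\<close>.\<close>

lemma power_in_span_of_binary_form:
  fixes x y :: "('v \<Rightarrow>\<^sub>0 nat) \<Rightarrow>\<^sub>0 complex"
  assumes pencil: "\<And>c. \<exists>k. x ^ k \<in> ri.span (insert (y - Poly_Mapping.single 0 c * x) S)"
    and "p \<noteq> 0" "degree p \<le> e" "x ^ k * binary_form x y e p \<in> ri.span S"
  shows "\<exists>k. x ^ k \<in> ri.span S"
  using assms(2-)
proof (induction "degree p" arbitrary: p e k)
  case 0
  then obtain a where p: "p = [:a:]" "a \<noteq> 0" by (metis degree_eq_zeroE pCons_0_0)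
  have "binary_form x y e p = (\<Sum>i\<le>e. if i = 0 then Poly_Mapping.single 0 a * x ^ e else 0)"
    unfolding binary_form_def p(1) by (intro sum.cong) (auto simp: coeff_pCons split: nat.splits)
  also have "\<dots> = Poly_Mapping.single 0 a * x ^ e" by simp
  finally have "x ^ k * (Poly_Mapping.single 0 a * x ^ e) \<in> ri.span S"
    using "0.prems"(3) by (simp only:)
  then have "Poly_Mapping.single 0 (inverse a) * (x ^ k * (Poly_Mapping.single 0 a * x ^ e)) \<in> ri.span S"
    by (rule ri.span_scale)
  also have "Poly_Mapping.single 0 (inverse a) * (x ^ k * (Poly_Mapping.single 0 a * x ^ e)) =
      (Poly_Mapping.single 0 (inverse a) * Poly_Mapping.single 0 a) * (x ^ k * x ^ e)"
    by (simp only: mult_ac)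
  also have "\<dots> = x ^ (k + e)" unfolding mult_single using p(2) by (simp add: power_add)
  finally show ?case by (rule exI)
next
  case (Suc d)
  obtain r where "poly p r = 0"
    using Suc.hyps(2) fundamental_theorem_of_algebra[of p] by (auto simp: constant_degree)
  then obtain q where q: "p = [:- r, 1:] * q" by (auto simp: poly_eq_0_iff_dvd)
  have q0: "q \<noteq> 0" using Suc.prems(1) q by (auto simp del: mult_pCons_left)
  have dq: "degree q = d" using Suc.hyps(2) q0 by (simp add: q degree_mult_eq del: mult_pCons_left)
  obtain e' where e': "e = Suc e'" using Suc.prems(2) Suc.hyps(2) by (cases e) auto
  define L where "L = y - Poly_Mapping.single 0 r * x"
  define H where "H = binary_form x y e' q"
  obtain l where "x ^ l \<in> ri.span (insert L S)" using pencil L_def by blast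
  then obtain Y where Y: "x ^ l - Y * L \<in> ri.span S" unfolding ri.span_insert by blast
  have "x ^ k * (L * H) \<in> ri.span S"
    using Suc.prems(3) binary_form_linear_factor[of q e' x y r] Suc.prems(2)
    unfolding q e' L_def H_def
    using dq Suc.hyps(2) q e' by (simp del: mult_pCons_left)
  \<comment> \<open>Modulo the ideal x^l is Y * L. Hence x^(k+l) * H is congruent to Y * (x^k * L *
    H), which is in the ideal: the factor \<open>L\<close> has been traded for a power of
    \<open>x\<close>.\<close>
  then have "x ^ k * H * (x ^ l - Y * L) + Y * (x ^ k * (L * H)) \<in> ri.span S"
    by (intro ri.span_add ri.span_scale[OF Y] ri.span_scale[where c = Y])
  also have "x ^ k * H * (x ^ l - Y * L) + Y * (x ^ k * (L * H)) = x ^ (k + l) * H"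
    by (simp only: right_diff_distrib power_add mult_ac diff_add_cancel)
  finally have "x ^ (k + l) * binary_form x y e' q \<in> ri.span S" unfolding H_def .
  moreover have "degree q \<le> e'" using dq Suc.hyps(2) Suc.prems(2) e' by simp
  ultimately show ?case using Suc.hyps(1) dq q0 by blast
qed

text \<open>Finite fibres over countably many values cover only countably many points.\<close>

lemma uncountable_infinite_fibre:
  fixes F :: "'a \<Rightarrow> 'b"
  assumes "uncountable (UNIV :: 'a set)" "countable (range F)"
  shows "\<exists>z. infinite {c. F c = z}"
proof (rule ccontr)
  assume "\<not> ?thesis"
  then have "countable (\<Union>z\<in>range F. {c. F c = z})"
    using assms(2) by (intro countable_UN) (auto intro: countable_finite)
  moreover have "(\<Union>z\<in>range F. {c. F c = z}) = UNIV" by auto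
  ultimately show False using assms(1) by simp
qed

lemma countable_finite_monomials: "countable {M :: ('v::finite \<Rightarrow>\<^sub>0 nat) set. finite M}"
proof -
  have "inj (Poly_Mapping.lookup :: ('v \<Rightarrow>\<^sub>0 nat) \<Rightarrow> 'v \<Rightarrow> nat)"
    by (rule injI) simp
  then have "inj (to_nat \<circ> (Poly_Mapping.lookup :: ('v \<Rightarrow>\<^sub>0 nat) \<Rightarrow> 'v \<Rightarrow> nat))"
    by (intro inj_compose inj_to_nat)
  then have "countable (UNIV :: ('v \<Rightarrow>\<^sub>0 nat) set)"
    by (rule countableI')
  then show ?thesis
    using countable_Collect_finite_subset[of "UNIV :: ('v \<Rightarrow>\<^sub>0 nat) set"] by (simp del: finite_Collect_subsets)
qed

lemma multiplier_difference: "(p - q * (y - b * x)) - (p - q * (y - a * x)) = q * ((b - a) * x)"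
  for p :: "'a::comm_ring_1"
  by (simp add: algebra_simps)

text \<open>If every pencil member acquired a power of \<open>x\<close>, then uncountably many of the multipliers
  would lie in one finite-dimensional space; a linear relation between them is a nonzero binary form
  in \<open>x, y\<close> times a power of \<open>x\<close> in the ideal.\<close>

lemma exists_coordinate:
  fixes x y :: "('v::finite \<Rightarrow>\<^sub>0 nat) \<Rightarrow>\<^sub>0 complex"
  assumes no_power: "\<And>k. x ^ k \<notin> ri.span S"
  shows "\<exists>c. \<forall>k. x ^ k \<notin> ri.span (insert (y - Poly_Mapping.single 0 c * x) S)"
proof (rule ccontr)
  define L where "L c = y - Poly_Mapping.single 0 c * x" for c
  assume "\<not> ?thesis"
  then have pencil: "\<exists>k. x ^ k \<in> ri.span (insert (L c) S)" for c
    by (auto simp: L_def)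
  then have "\<forall>c. \<exists>k Y. x ^ k - Y * L c \<in> ri.span S" unfolding ri.span_insert by blast
  then obtain k Y where kY: "x ^ k c - Y c * L c \<in> ri.span S" for c by metis
  have "uncountable (UNIV :: complex set)" by (rule uncountable_UNIV_complex)
  \<comment> \<open>An exponent together with a finite set of monomials: uncountably many
    \<open>c\<close> share countably many possible values.\<close>
  moreover have "countable (range (\<lambda>c. (k c, Poly_Mapping.keys (Y c))))"
    by (rule countable_subset[of _ "UNIV \<times> {M. finite M}"]) (auto simp: countable_finite_monomials)
  ultimately obtain z where "infinite {c. (k c, Poly_Mapping.keys (Y c)) = z}"
    using uncountable_infinite_fibre[of "\<lambda>c. (k c, Poly_Mapping.keys (Y c))"] by blast
  then obtain l M where inf: "infinite {c. k c = l \<and> Poly_Mapping.keys (Y c) = M}"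
    by (cases z) auto
  define E where "E = {c. k c = l \<and> Poly_Mapping.keys (Y c) = M}"
  obtain c where "Poly_Mapping.keys (Y c) = M" using infinite_imp_nonempty[OF inf] by blast
  then have finM: "finite M" by auto
  \<comment> \<open>One element more than the dimension of the space spanned by the monomials in
    \<open>M\<close>, which forces a linear relation between the multipliers.\<close>
  obtain D where D: "D \<subseteq> E" "finite D" "card D = Suc (card M)"
    using infinite_arbitrarily_large[OF inf, of "Suc (card M)"] unfolding E_def by blast
  have kD: "k c = l" if "c \<in> D" for c using that D by (auto simp: E_def)
  have "inj_on Y D"
  proof (rule inj_onI, rule ccontr)
    fix c d assume cd: "c \<in> D" "d \<in> D" "Y c = Y d" "c \<noteq> d"

    have "x ^ l - Y c * L c \<in> ri.span S" "x ^ l - Y c * L d \<in> ri.span S"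
      using kY[of c] kY[of d] kD cd by auto
    then have "(x ^ l - Y c * L d) - (x ^ l - Y c * L c) \<in> ri.span S"
      by (rule ri.span_diff[rotated])
    also have "(x ^ l - Y c * L d) - (x ^ l - Y c * L c) = Y c * (Poly_Mapping.single 0 (d - c) * x)"
      unfolding L_def single_diff by (rule multiplier_difference)
    finally have "Poly_Mapping.single 0 (inverse (d - c)) * (Y c * (Poly_Mapping.single 0 (d - c) * x)) \<in> ri.span S"
      by (rule ri.span_scale)
    also have "Poly_Mapping.single 0 (inverse (d - c)) * (Y c * (Poly_Mapping.single 0 (d - c) * x)) =
      (Poly_Mapping.single 0 (inverse (d - c)) * Poly_Mapping.single 0 (d - c)) * (Y c * x)"
      by (simp only: mult_ac)
    also have "\<dots> = Y c * x" unfolding mult_single using cd(4) by simp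
    finally have "Y c * x \<in> ri.span S" .
    then have "x * (x ^ l - Y c * L c) + L c * (Y c * x) \<in> ri.span S"
      using kY[of c] kD[OF cd(1)] by (intro ri.span_add ri.span_scale[where c = x] ri.span_scale[where c = "L c"]) simp_all
    also have "x * (x ^ l - Y c * L c) + L c * (Y c * x) = x ^ Suc l"
      by (simp only: right_diff_distrib power_Suc mult_ac diff_add_cancel)
    finally show False using no_power by blast
  qed
  then have card: "card (Y ` D) = Suc (card M)" using D by (simp add: card_image)
  have "Y ` D \<subseteq> pv.span (mon ` M)"
  proof
    fix p assume "p \<in> Y ` D"
    then have "Poly_Mapping.keys p = M" using D by (auto simp: E_def)
    moreover have "p = (\<Sum>m\<in>Poly_Mapping.keys p. Poly_Mapping.single 0 (Poly_Mapping.lookup p m) * mon m)"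
      unfolding single_eq_mon[symmetric] by (rule mpoly_expand)
    ultimately have "p = (\<Sum>m\<in>M. Poly_Mapping.single 0 (Poly_Mapping.lookup p m) * mon m)"
      by (simp only:)
    also have "\<dots> \<in> pv.span (mon ` M)"
      by (intro pv.span_sum pv.span_scale pv.span_base) auto
    finally show "p \<in> pv.span (mon ` M)" .
  qed
  moreover have "card (mon ` M :: (('v \<Rightarrow>\<^sub>0 nat) \<Rightarrow>\<^sub>0 complex) set) < card (Y ` D)"
    using card_image_le[OF finM, of "mon :: _ \<Rightarrow> ('v \<Rightarrow>\<^sub>0 nat) \<Rightarrow>\<^sub>0 complex"] unfolding card by linarith
  ultimately have "pv.dependent (Y ` D)"
    using pv.independent_span_bound[of "mon ` M" "Y ` D"] finM by (meson finite_imageI leD)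
  then obtain u p0 where u: "p0 \<in> Y ` D" "u p0 \<noteq> 0"
      "(\<Sum>p\<in>Y ` D. Poly_Mapping.single 0 (u p) * p) = 0"
    using pv.dependent_finite[of "Y ` D"] D by auto
  define w where "w c = u (Y c)" for c
  have w: "(\<Sum>c\<in>D. Poly_Mapping.single 0 (w c) * Y c) = 0"
    using u(3) \<open>inj_on Y D\<close> by (simp add: sum.reindex w_def)
  obtain c0 where c0: "c0 \<in> D" "w c0 \<noteq> 0" using u w_def by auto
  \<comment> \<open>A combination of Lagrange type: at \<open>c0\<close> every summand except that
    of \<open>c0\<close> vanishes, so \<open>p\<close> is nonzero. Each product omits one of
    \<open>card M + 1\<close> factors, which gives the degree bound.\<close>
  define p where "p = (\<Sum>c\<in>D. Polynomial.smult (w c) (\<Prod>j\<in>D - {c}. [:- j, 1:]))"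
  have "poly p c0 = (\<Sum>c\<in>D. if c = c0 then w c0 * (\<Prod>j\<in>D - {c0}. c0 - j) else 0)"
    unfolding p_def poly_sum poly_smult poly_prod using c0 D
    by (intro sum.cong) (auto simp: prod_zero_iff)
  then have "poly p c0 \<noteq> 0" using c0 D by (auto simp: prod_zero_iff)
  then have p0: "p \<noteq> 0" by auto
  have deg: "degree p \<le> card M"
    unfolding p_def
  proof (rule degree_sum_le[OF D(2)])
    fix c assume "c \<in> D"
    then show "degree (Polynomial.smult (w c) (\<Prod>j\<in>D - {c}. [:- j, 1:])) \<le> card M"
      using degree_prod_sum_le[of "D - {c}" "\<lambda>j. [:- j, 1:]"] D
      by (intro order.trans[OF degree_smult_le]) simp
  qed
  have "binary_form x y (card M) p =
      (\<Sum>c\<in>D. Poly_Mapping.single 0 (w c) * (\<Prod>j\<in>D - {c}. L j))"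
  proof -
    have "binary_form x y e (\<Sum>c\<in>A. q c) = (\<Sum>c\<in>A. binary_form x y e (q c))" for e q and A :: "complex set"
      by (induction A rule: infinite_finite_induct) (simp_all add: binary_form_add binary_form_def[of _ _ _ 0])
    moreover have "binary_form x y (card M) (\<Prod>j\<in>D - {c}. [:- j, 1:]) = (\<Prod>j\<in>D - {c}. L j)" if "c \<in> D" for c
      using binary_form_prod[of "D - {c}" x y] D that by (simp add: L_def)
    ultimately show ?thesis by (simp add: p_def binary_form_smult)
  qed
  \<comment> \<open>Modulo the ideal x^l is Y c * L c, so the missing factor \<open>L c\<close> is
    restored and all summands acquire the same full product. What is left in front of it is the
    linear relation between the multipliers, which is zero.\<close>
  moreover have "x ^ l * (Poly_Mapping.single 0 (w c) * (\<Prod>j\<in>D - {c}. L j)) -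
      Poly_Mapping.single 0 (w c) * Y c * (\<Prod>j\<in>D. L j) \<in> ri.span S" if "c \<in> D" for c
  proof -
    have "(\<Prod>j\<in>D. L j) = L c * (\<Prod>j\<in>D - {c}. L j)" using that D by (simp add: prod.remove)
    moreover have "Poly_Mapping.single 0 (w c) * (\<Prod>j\<in>D - {c}. L j) * (x ^ l - Y c * L c) \<in> ri.span S"
      using kY[of c] kD[OF that] by (intro ri.span_scale) simp
    ultimately show ?thesis by (simp only: right_diff_distrib mult_ac)
  qed
  then have "(\<Sum>c\<in>D. x ^ l * (Poly_Mapping.single 0 (w c) * (\<Prod>j\<in>D - {c}. L j))) -
      (\<Sum>c\<in>D. Poly_Mapping.single 0 (w c) * Y c * (\<Prod>j\<in>D. L j)) \<in> ri.span S"
    by (rule span_sum_cong)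
  ultimately have "x ^ l * binary_form x y (card M) p \<in> ri.span S"
    unfolding sum_distrib_right[symmetric] w by (simp only: sum_distrib_left mult_zero_left diff_zero)
  then have "\<exists>k. x ^ k \<in> ri.span S"
    using power_in_span_of_binary_form[OF _ p0 deg] pencil unfolding L_def by blast
  then show False using no_power by blast
qed

text \<open>The coordinates of a point in the chart \<open>x = 1\<close> are fixed one at a time,
  each chosen so that the enlarged ideal still contains no power of \<open>x\<close>.\<close>

lemma exists_point:
  fixes x :: "('v::finite \<Rightarrow>\<^sub>0 nat) \<Rightarrow>\<^sub>0 complex"
  assumes "\<And>k. x ^ k \<notin> ri.span S" "finite V"
  shows "\<exists>c. \<forall>k. x ^ k \<notin> ri.span (S \<union> (\<lambda>i. y i - Poly_Mapping.single 0 (c i) * x) ` V)"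
  using assms(2)
proof (induction V rule: finite_induct)
  case empty then show ?case using assms(1) by simp
next
  case (insert i V)
  then obtain c where c: "x ^ k \<notin> ri.span (S \<union> (\<lambda>i. y i - Poly_Mapping.single 0 (c i) * x) ` V)" for k
    by blast
  obtain d where d: "\<forall>k. x ^ k \<notin> ri.span (insert (y i - Poly_Mapping.single 0 d * x)
      (S \<union> (\<lambda>i. y i - Poly_Mapping.single 0 (c i) * x) ` V))"
    using exists_coordinate[OF c] by blast
  have "S \<union> (\<lambda>j. y j - Poly_Mapping.single 0 ((c(i := d)) j) * x) ` insert i V =
      insert (y i - Poly_Mapping.single 0 d * x) (S \<union> (\<lambda>i. y i - Poly_Mapping.single 0 (c i) * x) ` V)"
    unfolding image_insert fun_upd_same Un_insert_right
    by (intro arg_cong2[where f = insert] arg_cong2[where f = "(\<union>)"] refl image_cong)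
      (use insert.hyps(2) in \<open>metis fun_upd_other\<close>)
  from d[folded this] show ?case by blast
qed

section \<open>Passing between real and complex coefficients\<close>

text \<open>Written as an evaluation at the variables themselves, so that it is a ring homomorphism
  by the general facts on \<open>mpoly_eval\<close>.\<close>

definition complexify :: "'v::finite mpoly \<Rightarrow> ('v \<Rightarrow>\<^sub>0 nat) \<Rightarrow>\<^sub>0 complex" where
  "complexify = mpoly_eval (\<lambda>c. Poly_Mapping.single 0 (complex_of_real c)) var"

lemma comm_ring_hom_complex_const:
  "comm_ring_hom (\<lambda>c. Poly_Mapping.single 0 (complex_of_real c) :: ('v \<Rightarrow>\<^sub>0 nat) \<Rightarrow>\<^sub>0 complex)"
  by unfold_locales (simp_all add: single_add mult_single)

interpretation complexify: comm_ring_hom complexify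
  unfolding complexify_def by (rule comm_ring_hom_mpoly_eval[OF comm_ring_hom_complex_const])

lemma complexify_single: "complexify (Poly_Mapping.single m c) = Poly_Mapping.single m (complex_of_real c)"
  by (simp add: complexify_def mpoly_eval_single[OF comm_ring_hom_complex_const]
      mon_eq_prod[symmetric] single_eq_mon[symmetric])

lemma lookup_complexify: "Poly_Mapping.lookup (complexify p) m = complex_of_real (Poly_Mapping.lookup p m)"
  by (induction p rule: mpoly_induct)
    (simp_all add: complexify_single complexify.hom_add lookup_add lookup_single when_def)

lemma complexify_re_im: "\<exists>a b. p = complexify a + Poly_Mapping.single 0 \<i> * complexify b"
proof (induction p rule: mpoly_induct)
  case (single m c)
  have "Poly_Mapping.single m c = complexify (Poly_Mapping.single m (Re c)) +
      Poly_Mapping.single 0 \<i> * complexify (Poly_Mapping.single m (Im c))"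
    by (simp add: complexify_single mult_single single_add[symmetric] complex_eq[symmetric])
  then show ?case by blast
next
  case (add p q)
  then obtain a b a' b' where "p = complexify a + Poly_Mapping.single 0 \<i> * complexify b"
    "q = complexify a' + Poly_Mapping.single 0 \<i> * complexify b'" by blast
  then have "p + q = complexify (a + a') + Poly_Mapping.single 0 \<i> * complexify (b + b')"
    by (simp add: complexify.hom_add algebra_simps)
  then show ?case by blast
qed

text \<open>Compare real parts coefficient by coefficient. This is the descent: an identity with
  complex multipliers implies the one in which the multipliers are replaced by their real
  parts.\<close>

lemma complexify_eq_iff:
  assumes "complexify p = complexify a + Poly_Mapping.single 0 \<i> * complexify b"
  shows "p = a"
proof (rule poly_mapping_eqI)
  fix m
  have "complex_of_real (Poly_Mapping.lookup p m) =
      complex_of_real (Poly_Mapping.lookup a m) + \<i> * complex_of_real (Poly_Mapping.lookup b m)"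
    using arg_cong[OF assms, of "\<lambda>q. Poly_Mapping.lookup q m"] by (simp add: lookup_complexify lookup_add)
  then show "Poly_Mapping.lookup p m = Poly_Mapping.lookup a m" by (simp add: complex_eq_iff)
qed

lemma in_span_triple_iff: "p \<in> ri.span {f, g, h} \<longleftrightarrow> (\<exists>a b c. p = a * f + b * g + c * h)"
proof
  assume "p \<in> ri.span {f, g, h}"
  then obtain a b c where "p - a * f - b * g = c * h"
    by (auto simp: ri.span_insert ri.span_singleton)
  then have "p = a * f + b * g + c * h" by (simp add: algebra_simps)
  then show "\<exists>a b c. p = a * f + b * g + c * h" by blast
next
  assume "\<exists>a b c. p = a * f + b * g + c * h"
  then show "p \<in> ri.span {f, g, h}"
    by (elim exE, simp only:) (intro ri.span_add ri.span_scale ri.span_base; simp)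
qed

text \<open>Under the relations \<open>var i = c i * x\<close> a monomial turns into its value at
  \<open>c\<close> times a power of \<open>x\<close>, and homogeneity makes this power the same for
  all terms.\<close>

lemma complexify_form_cong:
  assumes "form n f"
    and "\<And>i. var i - Poly_Mapping.single 0 (c i) * x \<in> ri.span K"
  shows "complexify f - Poly_Mapping.single 0 (mpoly_eval of_real c f) * x ^ n \<in> ri.span K"
proof -
  have monomial: "Poly_Mapping.single 0 (complex_of_real a) * (\<Prod>i\<in>UNIV. var i ^ Poly_Mapping.lookup m i) -
      Poly_Mapping.single 0 (of_real a * (\<Prod>i\<in>UNIV. c i ^ Poly_Mapping.lookup m i)) * x ^ mdeg m \<in> ri.span K" for a m
  proof -
    interpret s: comm_ring_hom "Poly_Mapping.single 0 :: complex \<Rightarrow> ('a \<Rightarrow>\<^sub>0 nat) \<Rightarrow>\<^sub>0 complex"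
      by (rule comm_ring_hom_single_0)
    have "Poly_Mapping.single 0 (complex_of_real a) * (\<Prod>i\<in>UNIV. var i ^ Poly_Mapping.lookup m i) -
      Poly_Mapping.single 0 (complex_of_real a) * (\<Prod>i\<in>UNIV. (Poly_Mapping.single 0 (c i) * x) ^ Poly_Mapping.lookup m i) \<in> ri.span K"
      by (intro span_mult_cong span_prod_cong span_power_cong assms) (simp add: ri.span_zero)
    moreover have "(\<Prod>i\<in>UNIV. (Poly_Mapping.single 0 (c i) * x) ^ Poly_Mapping.lookup m i) =
        Poly_Mapping.single 0 (\<Prod>i\<in>UNIV. c i ^ Poly_Mapping.lookup m i) * x ^ mdeg m"
      by (simp add: power_mult_distrib prod.distrib power_sum mdeg_def s.hom_prod s.hom_power)
    ultimately show ?thesis by (simp add: s.hom_mult mult.assoc)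
  qed
  have "complexify f - (\<Sum>m\<in>Poly_Mapping.keys f. Poly_Mapping.single 0 (of_real (Poly_Mapping.lookup f m) * (\<Prod>i\<in>UNIV. c i ^ Poly_Mapping.lookup m i)) * x ^ mdeg m) \<in> ri.span K"
    unfolding complexify_def mpoly_eval_def by (intro span_sum_cong monomial)
  also have "(\<Sum>m\<in>Poly_Mapping.keys f. Poly_Mapping.single 0 (of_real (Poly_Mapping.lookup f m) * (\<Prod>i\<in>UNIV. c i ^ Poly_Mapping.lookup m i)) * x ^ mdeg m)
    = Poly_Mapping.single 0 (mpoly_eval of_real c f) * x ^ n"
  proof -
    interpret s: comm_ring_hom "Poly_Mapping.single 0 :: complex \<Rightarrow> ('a \<Rightarrow>\<^sub>0 nat) \<Rightarrow>\<^sub>0 complex"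
      by (rule comm_ring_hom_single_0)
    show ?thesis using assms(1)
      by (simp add: mpoly_eval_def form_def s.hom_sum sum_distrib_right)
  qed
  finally show ?thesis .
qed

text \<open>Otherwise there is a point \<open>c\<close> whose ideal \<open>K\<close>, generated by
  f, g, h and the relations \<open>var j = c j * var i\<close>, contains no power of
  \<open>var i\<close>. But \<open>K\<close> contains f(c) times such a power, so f(c) = 0. The same
  holds for g and h, and \<open>c\<close> is a base point.\<close>

lemma var_power_in_net_ideal:
  assumes forms: "form n f" "form n g" "form n h" and "no_basepoints f g h"
  shows "\<exists>k. var i ^ k \<in> ri.span {f, g, h}"
proof -
  have "\<exists>k. var i ^ k \<in> ri.span {complexify f, complexify g, complexify h}"
  proof (rule ccontr)
    assume "\<not> ?thesis"
    then obtain c where c: "\<forall>k. var i ^ k \<notin> ri.span ({complexify f, complexify g, complexify h} \<union>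
        range (\<lambda>j. var j - Poly_Mapping.single 0 (c j) * var i))"
      using exists_point[of "var i" "{complexify f, complexify g, complexify h}" UNIV var] by auto
    define K where "K = {complexify f, complexify g, complexify h} \<union>
        range (\<lambda>j. var j - Poly_Mapping.single 0 (c j) * var i)"
    have K: "var i ^ k \<notin> ri.span K" for k using c by (auto simp: K_def)
    have scaled: "a = 0" if "Poly_Mapping.single 0 a * var i ^ k \<in> ri.span K" for a k
    proof (rule ccontr)
      assume "a \<noteq> 0"
      have "Poly_Mapping.single 0 (inverse a) * (Poly_Mapping.single 0 a * var i ^ k) \<in> ri.span K"
        by (rule ri.span_scale[OF that])
      also have "Poly_Mapping.single 0 (inverse a) * (Poly_Mapping.single 0 a * var i ^ k) = var i ^ k"
        unfolding mult.assoc[symmetric] mult_single using \<open>a \<noteq> 0\<close> by simp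
      finally show False using K by blast
    qed
    have lin: "var j - Poly_Mapping.single 0 (c j) * var i \<in> ri.span K" for j
      by (rule ri.span_base) (auto simp: K_def)
    \<comment> \<open>The relation with \<open>j = i\<close> reads (1 - c i) * var i. It forces
      \<open>c i = 1\<close>, so \<open>c\<close> is a nonzero vector and represents a projective
      point.\<close>
    have "Poly_Mapping.single 0 (1 - c i) * var i ^ 1 \<in> ri.span K"
      using lin[of i] by (simp add: single_diff algebra_simps)
    then have ci: "c i = 1" using scaled by fastforce
    have zero: "mpoly_eval of_real c q = 0" if "form n q" "complexify q \<in> K" for q
    proof (rule scaled)
      have "complexify q - (complexify q - Poly_Mapping.single 0 (mpoly_eval of_real c q) * var i ^ n) \<in> ri.span K"
        by (intro ri.span_diff ri.span_base that complexify_form_cong lin)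
      then show "Poly_Mapping.single 0 (mpoly_eval of_real c q) * var i ^ n \<in> ri.span K" by simp
    qed
    have "mpoly_eval of_real c f = 0" "mpoly_eval of_real c g = 0" "mpoly_eval of_real c h = 0"
      by (auto intro!: zero forms simp: K_def)
    moreover have "(\<chi> j. c j) \<noteq> 0" using ci by (metis vec_lambda_beta zero_index zero_neq_one)
    moreover have "(\<lambda>j. (\<chi> j. c j) $ j) = c" by (simp add: fun_eq_iff)
    ultimately show False using assms(4) unfolding no_basepoints_def by metis
  qed
  then obtain k A B C where eq: "var i ^ k = A * complexify f + B * complexify g + C * complexify h"
    unfolding in_span_triple_iff by blast
  \<comment> \<open>The complex multipliers are split into real and imaginary parts; the real parts
    alone already represent the power, which is real.\<close>
  obtain a a' where a: "A = complexify a + Poly_Mapping.single 0 \<i> * complexify a'" using complexify_re_im by blast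
  obtain b b' where b: "B = complexify b + Poly_Mapping.single 0 \<i> * complexify b'" using complexify_re_im by blast
  obtain c c' where c: "C = complexify c + Poly_Mapping.single 0 \<i> * complexify c'" using complexify_re_im by blast
  have "complexify (var i ^ k) = var i ^ k"
    by (simp add: var_power mon_def complexify_single)
  then have "complexify (var i ^ k) = complexify (a * f + b * g + c * h) + Poly_Mapping.single 0 \<i> * complexify (a' * f + b' * g + c' * h)"
    unfolding eq a b c by (simp add: complexify.hom_add complexify.hom_mult algebra_simps)
  then have "var i ^ k = a * f + b * g + c * h" by (rule complexify_eq_iff)
  then show ?thesis unfolding in_span_triple_iff by blast
qed

section \<open>Ideals generated by powers of variables\<close>

text \<open>The ideal is generated by monomials, so membership is decided separately for each
  term.\<close>

lemma in_span_var_powers_iff: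
  "p \<in> ri.span ((\<lambda>i. var i ^ N) ` V) \<longleftrightarrow> (\<forall>m\<in>Poly_Mapping.keys p. \<exists>i\<in>V. N \<le> Poly_Mapping.lookup m i)"
  for p :: "('v \<Rightarrow>\<^sub>0 nat) \<Rightarrow>\<^sub>0 'k::comm_ring_1"
proof
  let ?K = "{p :: ('v \<Rightarrow>\<^sub>0 nat) \<Rightarrow>\<^sub>0 'k. \<forall>m\<in>Poly_Mapping.keys p. \<exists>i\<in>V. N \<le> Poly_Mapping.lookup m i}"
  have "ri.subspace ?K"
  proof (rule ri.subspaceI)
    fix p q assume "p \<in> ?K" "q \<in> ?K" then show "p + q \<in> ?K" using keys_add[of p q] by auto
  next
    fix a p assume p: "p \<in> ?K"
    show "a * p \<in> ?K"
    proof (rule CollectI, rule ballI)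
      fix m assume "m \<in> Poly_Mapping.keys (a * p)"
      then obtain k l where "m = k + l" "l \<in> Poly_Mapping.keys p" using keys_mult[of a p] by auto
      with p show "\<exists>i\<in>V. N \<le> Poly_Mapping.lookup m i" by (force simp: lookup_add)
    qed
  qed simp
  moreover have "(\<lambda>i. var i ^ N) ` V \<subseteq> ?K" by (auto simp: var_power mon_def intro!: bexI)
  moreover assume "p \<in> ri.span ((\<lambda>i. var i ^ N) ` V)"
  ultimately show "\<forall>m\<in>Poly_Mapping.keys p. \<exists>i\<in>V. N \<le> Poly_Mapping.lookup m i"
    using ri.span_minimal by blast
next
  assume *: "\<forall>m\<in>Poly_Mapping.keys p. \<exists>i\<in>V. N \<le> Poly_Mapping.lookup m i"
  have "Poly_Mapping.single m c \<in> ri.span ((\<lambda>i. var i ^ N) ` V)" if "i \<in> V" "N \<le> Poly_Mapping.lookup m i" for i m c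
  proof -
    have "m = (m - Poly_Mapping.single i N) + Poly_Mapping.single i N"
      using that by (intro poly_mapping_eqI) (auto simp: lookup_add lookup_minus lookup_single when_def)
    then have "Poly_Mapping.single m c = Poly_Mapping.single (m - Poly_Mapping.single i N) c * var i ^ N"
      by (metis mon_def mult.right_neutral mult_single var_power)
    then show ?thesis using that by (simp add: ri.span_scale ri.span_base)
  qed
  then have "(\<Sum>m\<in>Poly_Mapping.keys p. Poly_Mapping.single m (Poly_Mapping.lookup p m)) \<in> ri.span ((\<lambda>i. var i ^ N) ` V)"
    using * by (intro ri.span_sum) blast
  then show "p \<in> ri.span ((\<lambda>i. var i ^ N) ` V)" by (simp flip: mpoly_expand)
qed

text \<open>Multiplication by a power of \<open>var k\<close> changes only the exponent at
  \<open>k\<close>, which is outside \<open>V\<close>, so each exponent keeps its witness. In other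
  words, powers of distinct variables form a regular sequence.\<close>

lemma span_var_powers_cancel:
  fixes p :: "('v \<Rightarrow>\<^sub>0 nat) \<Rightarrow>\<^sub>0 'k::comm_ring_1"
  assumes "k \<notin> V" "var k ^ N * p \<in> ri.span ((\<lambda>i. var i ^ N) ` V)"
  shows "p \<in> ri.span ((\<lambda>i. var i ^ N) ` V)"
  unfolding in_span_var_powers_iff
proof
  fix m assume "m \<in> Poly_Mapping.keys p"
  then have "Poly_Mapping.single k N + m \<in> Poly_Mapping.keys (var k ^ N * p)"
    by (simp add: in_keys_iff var_power lookup_mon_mult)
  then obtain i where "i \<in> V" "N \<le> Poly_Mapping.lookup (Poly_Mapping.single k N + m) i"
    using assms(2) unfolding in_span_var_powers_iff by blast
  then show "\<exists>i\<in>V. N \<le> Poly_Mapping.lookup m i"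
    using assms(1) by (auto simp: lookup_add lookup_single when_def split: if_splits)
qed

section \<open>Exactness of the Koszul complex\<close>

text \<open>The assumptions \<open>D\<close> say that the cross product of (D1, D2, D3) and (f, g,
  h) vanishes. The coefficients of \<open>x\<close> and \<open>y\<close> then give x * D = s * (f,
  g, h) and y * D = t * (f, g, h), so x * t = y * s. Thus \<open>y\<close> divides \<open>t\<close>,
  and the quotient is the multiplier sought. This is exactness of the Koszul complex one place
  before syzygies.\<close>

lemma parallel_vector_is_multiple:
  fixes f g h x y :: "'a::idom"
  assumes xy: "\<And>a b. x * a = y * b \<Longrightarrow> y dvd a" "f \<noteq> 0" "y \<noteq> 0"
    and x: "x = A * f + B * g + C * h" and y: "y = A' * f + B' * g + C' * h"
    and D: "g * D3 = h * D2" "h * D1 = f * D3" "f * D2 = g * D1"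
  shows "\<exists>s. D1 = s * f \<and> D2 = s * g \<and> D3 = s * h"
proof -
  define s t where "s = A * D1 + B * D2 + C * D3" and "t = A' * D1 + B' * D2 + C' * D3"
  have s: "x * D1 = s * f" and t: "y * D1 = t * f" "y * D2 = t * g" "y * D3 = t * h"
    unfolding s_def t_def x y using D by Groebner_Basis.algebra+
  have "(x * t) * f = y * (x * D1)" using t(1) by (simp add: mult_ac)
  also have "\<dots> = (y * s) * f" using s by (simp add: mult_ac)
  finally have "(x * t) * f = (y * s) * f" .
  then have "x * t = y * s" using \<open>f \<noteq> 0\<close> by simp
  then have "y dvd t" by (rule xy(1))
  then obtain u where u: "t = y * u" by (rule dvdE)
  have "y * D1 = y * (u * f)" "y * D2 = y * (u * g)" "y * D3 = y * (u * h)"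
    using t u by (simp_all add: mult.assoc)
  then show ?thesis using \<open>y \<noteq> 0\<close> by auto
qed

text \<open>Eliminates \<open>a\<close> from two of its multiples. Read for all three entries, two
  cross product representations of a syzygy, multiplied by \<open>x\<close> and \<open>y\<close>,
  differ by a vector parallel to (f, g, h).\<close>

lemma cross_combine:
  fixes x :: "'a::comm_ring_1"
  assumes "x * a = g * P - h * P'" "y * a = g * Q - h * Q'"
  shows "g * (y * P - x * Q) = h * (y * P' - x * Q')"
proof -
  have "g * (y * P - x * Q) - h * (y * P' - x * Q') = y * (g * P - h * P') - x * (g * Q - h * Q')"
    by (simp add: algebra_simps)
  also have "\<dots> = 0" unfolding assms[symmetric] by (simp add: mult_ac)
  finally show ?thesis by simp
qed

text \<open>Let v = (a, b, c). As \<open>x\<close>, \<open>y\<close>, \<open>z\<close> lie in the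
  ideal, x * v, y * v and z * v are cross products of (f, g, h) with vectors P, Q, T. Comparing
  these in pairs shows that P becomes divisible by \<open>x\<close> after subtraction of a multiple
  of (f, g, h). The subtraction does not affect the cross product, and \<open>x\<close> can be
  cancelled. The hypotheses \<open>xy\<close> and \<open>xyz\<close> express the part of regularity
  of \<open>x\<close>, \<open>y\<close>, \<open>z\<close> that this chase consumes.\<close>

lemma syzygy_is_cross_product:
  fixes f g h x y z :: "'a::idom"
  assumes xy: "\<And>a b. x * a = y * b \<Longrightarrow> y dvd a" "\<And>a b. y * a = x * b \<Longrightarrow> x dvd a"
    and xyz: "\<And>a b c. z * a + x * b + y * c = 0 \<Longrightarrow> \<exists>p q. a = x * p + y * q"
    and nz: "f \<noteq> 0" "x \<noteq> 0" "y \<noteq> 0"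
    and x: "x \<in> ri.span {f, g, h}" and y: "y \<in> ri.span {f, g, h}" and z: "z \<in> ri.span {f, g, h}"
    and syz: "a * f + b * g + c * h = 0"
  shows "\<exists>P1 P2 P3. a = g * P3 - h * P2 \<and> b = h * P1 - f * P3 \<and> c = f * P2 - g * P1"
proof -
  have cross: "\<exists>P1 P2 P3. e * a = g * P3 - h * P2 \<and> e * b = h * P1 - f * P3 \<and> e * c = f * P2 - g * P1"
    if e: "e \<in> ri.span {f, g, h}" for e
  proof -
    obtain A B C where e: "e = A * f + B * g + C * h" using e unfolding in_span_triple_iff by blast
    \<comment> \<open>The witness is the cross product of (a, b, c) with (A, B, C). In the expansion
      of the double cross product one term contains the inner product of (f, g, h) and (a, b, c),
      which is zero; the other is e * (a, b, c).\<close>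
    show ?thesis unfolding e
      by (rule exI[of _ "C * b - B * c"], rule exI[of _ "A * c - C * a"], rule exI[of _ "B * a - A * b"], intro conjI)
        (use syz in Groebner_Basis.algebra)+
  qed
  obtain P1 P2 P3 where P: "x * a = g * P3 - h * P2" "x * b = h * P1 - f * P3" "x * c = f * P2 - g * P1"
    using cross[OF x] by blast
  obtain Q1 Q2 Q3 where Q: "y * a = g * Q3 - h * Q2" "y * b = h * Q1 - f * Q3" "y * c = f * Q2 - g * Q1"
    using cross[OF y] by blast
  obtain T1 T2 T3 where T: "z * a = g * T3 - h * T2" "z * b = h * T1 - f * T3" "z * c = f * T2 - g * T1"
    using cross[OF z] by blast
  obtain A B C where xe: "x = A * f + B * g + C * h" using x unfolding in_span_triple_iff by blast
  obtain A' B' C' where ye: "y = A' * f + B' * g + C' * h" using y unfolding in_span_triple_iff by blast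
  have multiple: "\<exists>s. D1 = s * f \<and> D2 = s * g \<and> D3 = s * h"
    if "g * D3 = h * D2" "h * D1 = f * D3" "f * D2 = g * D1" for D1 D2 D3
    by (rule parallel_vector_is_multiple[OF _ nz(1) nz(3) xe ye that]) (rule xy(1))
  have "\<exists>s. y * P1 - x * Q1 = s * f \<and> y * P2 - x * Q2 = s * g \<and> y * P3 - x * Q3 = s * h"
    by (rule multiple; rule cross_combine[OF P(1) Q(1)] cross_combine[OF P(2) Q(2)] cross_combine[OF P(3) Q(3)])
  then obtain \<alpha> where \<alpha>: "y * P1 - x * Q1 = \<alpha> * f" "y * P2 - x * Q2 = \<alpha> * g" "y * P3 - x * Q3 = \<alpha> * h"
    by blast
  have "\<exists>s. z * Q1 - y * T1 = s * f \<and> z * Q2 - y * T2 = s * g \<and> z * Q3 - y * T3 = s * h"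
    by (rule multiple; rule cross_combine[OF Q(1) T(1)] cross_combine[OF Q(2) T(2)] cross_combine[OF Q(3) T(3)])
  then obtain \<beta> where \<beta>: "z * Q1 - y * T1 = \<beta> * f" by blast
  have "\<exists>s. x * T1 - z * P1 = s * f \<and> x * T2 - z * P2 = s * g \<and> x * T3 - z * P3 = s * h"
    by (rule multiple; rule cross_combine[OF T(1) P(1)] cross_combine[OF T(2) P(2)] cross_combine[OF T(3) P(3)])
  then obtain \<gamma> where \<gamma>: "x * T1 - z * P1 = \<gamma> * f" by blast
  \<comment> \<open>The three comparisons are cyclic in \<open>x\<close>, \<open>y\<close>,
    \<open>z\<close>, so their combination cancels. The result is a relation between
    \<open>x\<close>, \<open>y\<close>, \<open>z\<close>, which puts \<alpha> into the ideal of
    \<open>x\<close> and \<open>y\<close>.\<close>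
  have "(z * \<alpha> + x * \<beta> + y * \<gamma>) * f = z * (\<alpha> * f) + x * (\<beta> * f) + y * (\<gamma> * f)"
    by (simp add: algebra_simps)
  also have "\<dots> = 0" unfolding \<alpha>(1)[symmetric] \<beta>[symmetric] \<gamma>[symmetric] by (simp add: algebra_simps)
  finally have "(z * \<alpha> + x * \<beta> + y * \<gamma>) * f = 0" .
  then have "z * \<alpha> + x * \<beta> + y * \<gamma> = 0" using nz by simp
  then obtain p q where pq: "\<alpha> = x * p + y * q" using xyz by blast
  \<comment> \<open>With \<alpha> = x * p + y * q the part y * q is moved into P and the part x * p
    into Q. Then \<open>x\<close> divides the corrected P.\<close>
  have "y * (P - q * u) = x * (Q + p * u)" if "y * P - x * Q = \<alpha> * u" for P Q u
    using that by (simp add: pq algebra_simps)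
  from this[OF \<alpha>(1)] this[OF \<alpha>(2)] this[OF \<alpha>(3)]
  have "y * (P1 - q * f) = x * (Q1 + p * f)" "y * (P2 - q * g) = x * (Q2 + p * g)"
    "y * (P3 - q * h) = x * (Q3 + p * h)" .
  then have "x dvd P1 - q * f" "x dvd P2 - q * g" "x dvd P3 - q * h" using xy(2) by blast+
  then obtain R1 R2 R3 where R: "P1 - q * f = x * R1" "P2 - q * g = x * R2" "P3 - q * h = x * R3"
    by (elim dvdE)
  \<comment> \<open>Adding q times (f, g, h) to P leaves the 2 by 2 minors unchanged, so they may be
    computed from the corrected vector x * R.\<close>
  have "u * P - v * P' = x * (u * R - v * R')" if "P - q * v = x * R" "P' - q * u = x * R'" for u v P P' R R'
  proof -
    have "u * P - v * P' = u * (P - q * v) - v * (P' - q * u)" by (simp add: algebra_simps)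
    also have "\<dots> = x * (u * R - v * R')" unfolding that by (simp add: algebra_simps)
    finally show ?thesis .
  qed
  from this[OF R(3) R(2)] this[OF R(1) R(3)] this[OF R(2) R(1)]
  have "x * a = x * (g * R3 - h * R2)" "x * b = x * (h * R1 - f * R3)" "x * c = x * (f * R2 - g * R1)"
    unfolding P .
  then show ?thesis using nz by auto
qed

section \<open>Nets without base points\<close>

locale basepoint_free_net =
  fixes f g h :: poly3 and n :: nat
  assumes forms: "form n f" "form n g" "form n h"
    and indep: "lin_indep3 f g h"
    and basepoint_free: "no_basepoints f g h"
begin

lemma f_nonzero: "f \<noteq> 0"
proof
  assume "f = 0"
  then have "Const 1 * f + Const 0 * g + Const 0 * h = 0" by simp
  then show False using indep unfolding lin_indep3_def by (metis zero_neq_one)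
qed

text \<open>Forms of degree 0 are constants, and two constants are linearly dependent.\<close>

lemma n_pos: "0 < n"
proof (rule ccontr)
  assume "\<not> 0 < n"
  then have "form 0 f" "form 0 g" using forms by auto
  moreover have "p = Const (Poly_Mapping.lookup p 0)" if "form 0 p" for p :: poly3
  proof (rule poly_mapping_eqI)
    fix m :: "3 \<Rightarrow>\<^sub>0 nat"
    have "m = 0" if "mdeg m = 0" for m :: "3 \<Rightarrow>\<^sub>0 nat"
      using that by (intro poly_mapping_eqI) (simp add: mdeg_def)
    then have "Poly_Mapping.lookup p m = 0" if "m \<noteq> 0"
      using that \<open>form 0 p\<close> unfolding form_def by (meson not_in_keys_iff_lookup_eq_zero)
    then show "Poly_Mapping.lookup p m = Poly_Mapping.lookup (Const (Poly_Mapping.lookup p 0)) m"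
      by (simp add: Const_def lookup_single when_def)
  qed
  ultimately obtain a b where ab: "f = Const a" "g = Const b" by metis
  have "Const b * f + Const (- a) * g + Const 0 * h = 0"
    by (simp add: ab Const.hom_uminus mult.commute)
  then have "a = 0" using indep unfolding lin_indep3_def by (metis neg_equal_0_iff_equal)
  then show False using f_nonzero ab by simp
qed

lemma var_powers_in_net_ideal: "\<exists>N. \<forall>i. var i ^ N \<in> ri.span {f, g, h}"
proof -
  obtain k where k: "var i ^ k i \<in> ri.span {f, g, h}" for i
    using choice[of "\<lambda>i k. var i ^ k \<in> ri.span {f, g, h}"] var_power_in_net_ideal[OF forms basepoint_free] by blast
  \<comment> \<open>The sum of the individual exponents serves all variables at once.\<close>
  have "var i ^ (\<Sum>j\<in>UNIV. k j) \<in> ri.span {f, g, h}" for i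
  proof -
    have "(\<Sum>j\<in>UNIV. k j) = (\<Sum>j\<in>UNIV - {i}. k j) + k i" by (simp add: sum.remove[of UNIV i])
    then show ?thesis using ri.span_scale[OF k] by (simp add: power_add)
  qed
  then show ?thesis by blast
qed

lemma var_power_dvd:
  fixes a b :: poly3
  assumes "var i ^ N * a = var j ^ N * b" "i \<noteq> j"
  shows "var j ^ N dvd a"
proof -
  have "a \<in> ri.span ((\<lambda>i. var i ^ N) ` {j})"
    by (rule span_var_powers_cancel[of i]) (use assms in \<open>auto simp: ri.span_singleton mult.commute\<close>)
  then show ?thesis by (auto simp: ri.span_singleton)
qed

lemma var_power_nonzero: "var i ^ N \<noteq> (0 :: poly3)"
  by (metis lookup_mon lookup_zero var_power zero_neq_one)

lemma syzygy:
  assumes "a * f + b * g + c * h = 0"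
  shows "\<exists>P1 P2 P3. a = g * P3 - h * P2 \<and> b = h * P1 - f * P3 \<and> c = f * P2 - g * P1"
proof -
  obtain N where N: "var i ^ N \<in> ri.span {f, g, h}" for i using var_powers_in_net_ideal by blast
  show ?thesis
  proof (rule syzygy_is_cross_product[of "var 1 ^ N" "var 2 ^ N" "var 3 ^ N"])
    fix a b c :: poly3
    assume 0: "var 3 ^ N * a + var 1 ^ N * b + var 2 ^ N * c = 0"
    have "a \<in> ri.span ((\<lambda>i. var i ^ N) ` {1, 2})"
    proof (rule span_var_powers_cancel[of 3])
      have "var 3 ^ N * a = (- b) * var 1 ^ N + (- c) * var 2 ^ N"
        using 0 by (simp add: algebra_simps eq_neg_iff_add_eq_0)
      also have "\<dots> \<in> ri.span ((\<lambda>i. var i ^ N) ` {1, 2})"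
        by (intro ri.span_add ri.span_scale ri.span_base) auto
      finally show "var 3 ^ N * a \<in> ri.span ((\<lambda>i. var i ^ N) ` {1, 2})" .
    qed auto
    then obtain k l where "a - k * var 1 ^ N = l * var 2 ^ N"
      by (auto simp: ri.span_insert ri.span_singleton)
    then have "a = var 1 ^ N * k + var 2 ^ N * l" by (simp add: algebra_simps)
    then show "\<exists>p q. a = var 1 ^ N * p + var 2 ^ N * q" by blast
  qed (use f_nonzero assms N var_power_nonzero var_power_dvd in auto)
qed

text \<open>The coefficient of \<open>h\<close> in a syzygy is the third entry of a cross product
  with (f, g, h), a combination of \<open>f\<close> and \<open>g\<close> alone.\<close>

lemma h_regular_mod_f_g:
  assumes "h * c \<in> ri.span {f, g}" shows "c \<in> ri.span {f, g}"
proof -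
  obtain a b where "h * c - a * f = b * g"
    using assms by (auto simp: ri.span_insert[of f] ri.span_singleton)
  then have "(- a) * f + (- b) * g + c * h = 0" by (simp add: algebra_simps)
  then obtain P1 P2 where "c = f * P2 - g * P1" using syzygy by blast
  then have "c = P2 * f - P1 * g" by (simp add: mult.commute)
  also have "\<dots> \<in> ri.span {f, g}" by (intro ri.span_diff ri.span_scale ri.span_base) auto
  finally show ?thesis .
qed

text \<open>A relation between \<open>f\<close> and \<open>g\<close> is a syzygy with third entry 0.
  Being a cross product, it gives b = h * P1 - f * P3 and f * P2 = g * P1. The second equation is
  the hypothesis again, now for \<open>P1\<close>, so one factor \<open>h\<close> is gained at each
  round.\<close>

lemma g_multiple_mod_powers:
  assumes "f dvd g * b" shows "\<exists>u v. b = u * f + v * h ^ k"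
  using assms
proof (induction k arbitrary: b)
  case 0
  show ?case by (rule exI[of _ 0], rule exI[of _ b]) simp
next
  case (Suc k)
  then obtain a where "g * b = f * a" by (auto elim: dvdE)
  then have "(- a) * f + b * g + 0 * h = 0" by (simp add: algebra_simps)
  then obtain P1 P2 P3 where P: "b = h * P1 - f * P3" "0 = f * P2 - g * P1" using syzygy by blast
  then have "f dvd g * P1" by (simp add: dvdI[of _ _ P2])
  then obtain u v where "P1 = u * f + v * h ^ k" using Suc.IH by blast
  then have "b = (h * u - P3) * f + v * h ^ Suc k" using P(1) by (simp add: algebra_simps)
  then show ?case by blast
qed

text \<open>Up to multiples of \<open>f\<close>, \<open>b\<close> is divisible by all powers of \<open>h\<close>; comparing degrees, it
  vanishes.\<close>

lemma g_regular_mod_f: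
  assumes "f dvd g * b" shows "f dvd b"
proof -
  obtain D where D: "b = (\<Sum>d<D. hpart d b)" using sum_hpart by blast
  have "f dvd hpart d b" for d
  proof -
    \<comment> \<open>The exponent \<open>Suc d\<close> makes the degree of the power of
      \<open>h\<close> exceed \<open>d\<close>, so only the multiple of \<open>f\<close> contributes
      in degree \<open>d\<close>.\<close>
    obtain u v where b: "b = u * f + v * h ^ Suc d" using g_multiple_mod_powers[OF assms] by blast
    have "Suc d * 1 \<le> Suc d * n" using n_pos by (intro mult_le_mono2) simp
    then have "d < Suc d * n" by simp
    then have "hpart d b = (if n \<le> d then hpart (d - n) u * f else 0)"
      unfolding b hpart_add by (subst hpart_mult_form[OF form_power[OF forms(3)]]) (simp add: hpart_mult_form[OF forms(1)])
    then show ?thesis by simp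
  qed
  then show ?thesis by (subst D) (intro dvd_sum)
qed

end

section \<open>Freeness over the pulled back ring\<close>

text \<open>Real linear independence of the classes modulo the ideal generated by \<open>S\<close>.
  It concerns an indexed family, so a repeated value counts as a dependence, and it tests finite
  partial sums, so \<open>A\<close> may be infinite.\<close>

definition indep_mod :: "poly3 set \<Rightarrow> 'i set \<Rightarrow> ('i \<Rightarrow> poly3) \<Rightarrow> bool" where
  "indep_mod S A e \<longleftrightarrow>
     (\<forall>c F. finite F \<and> F \<subseteq> A \<and> (\<Sum>i\<in>F. Const (c i) * e i) \<in> ri.span S \<longrightarrow> (\<forall>i\<in>F. c i = 0))"

lemma indep_modD:
  "indep_mod S A e \<Longrightarrow> finite F \<Longrightarrow> F \<subseteq> A \<Longrightarrow> (\<Sum>i\<in>F. Const (c i) * e i) \<in> ri.span S \<Longrightarrow> i \<in> F \<Longrightarrow> c i = 0"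
  unfolding indep_mod_def by blast

text \<open>Modulo \<open>t\<close> only the summands with exponent 0 survive, so their coefficients
  vanish. The rest is \<open>t * q\<close>; regularity removes the factor \<open>t\<close>, and the
  argument repeats. Each use removes one generator from the ideal and makes it an independent
  variable over the reals.\<close>

lemma indep_mod_powers:
  assumes indep: "indep_mod (insert t S) A e"
    and regular: "\<And>p. t * p \<in> ri.span S \<Longrightarrow> p \<in> ri.span S"
  shows "indep_mod S (UNIV \<times> A) (\<lambda>(k, i). t ^ k * e i)"
proof -
  \<comment> \<open>Coefficients supported on a rectangle permit induction on the number of powers
    of \<open>t\<close>.\<close>
  have rect: "c k i = 0"
    if "finite F" "F \<subseteq> A" "(\<Sum>k<K. \<Sum>i\<in>F. Const (c k i) * (t ^ k * e i)) \<in> ri.span S" "k < K" "i \<in> F" for c K F k i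
    using that(3,4)
  proof (induction K arbitrary: c k)
    case 0 then show ?case by blast
  next
    case (Suc K)
    define q where "q = (\<Sum>k<K. \<Sum>i\<in>F. Const (c (Suc k) i) * (t ^ k * e i))"
    have "(\<Sum>k<Suc K. \<Sum>i\<in>F. Const (c k i) * (t ^ k * e i)) = (\<Sum>i\<in>F. Const (c 0 i) * e i) + t * q"
      unfolding sum.lessThan_Suc_shift q_def sum_distrib_left by (simp add: mult_ac)
    then have eq: "(\<Sum>i\<in>F. Const (c 0 i) * e i) + t * q \<in> ri.span S" using Suc.prems by simp
    \<comment> \<open>The remainder \<open>t * q\<close> belongs to the ideal enlarged by
      \<open>t\<close> and is subtracted there.\<close>
    then have "(\<Sum>i\<in>F. Const (c 0 i) * e i) + t * q - q * t \<in> ri.span (insert t S)"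
      by (intro ri.span_diff ri.span_scale[OF ri.span_base]) (auto intro: ri.span_mono[THEN subsetD, rotated])
    then have "(\<Sum>i\<in>F. Const (c 0 i) * e i) \<in> ri.span (insert t S)" by (simp add: mult.commute)
    from indep_modD[OF indep that(1,2) this] have c0: "c 0 i = 0" if "i \<in> F" for i using that .
    then have "t * q \<in> ri.span S" using eq by simp
    then have "q \<in> ri.span S" by (rule regular)
    then have "\<And>k. k < K \<Longrightarrow> c (Suc k) i = 0" unfolding q_def by (rule Suc.IH)
    then show ?case using c0 \<open>i \<in> F\<close> Suc.prems(2) by (cases k) auto
  qed
  show ?thesis
    unfolding indep_mod_def
  proof (intro allI impI ballI, elim conjE)
    fix c F x
    assume F: "finite F" "F \<subseteq> UNIV \<times> A" "(\<Sum>x\<in>F. Const (c x) * (case x of (k, i) \<Rightarrow> t ^ k * e i)) \<in> ri.span S"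
      and x: "x \<in> F"
    define F' where "F' = snd ` F"
    define K where "K = Suc (Max (fst ` F))"
    have sub: "F \<subseteq> {..<K} \<times> F'"
    proof
      fix y assume "y \<in> F"
      moreover from this have "fst y \<le> Max (fst ` F)" using F(1) by (intro Max_ge) auto
      ultimately show "y \<in> {..<K} \<times> F'" by (cases y) (force simp: F'_def K_def)
    qed
    \<comment> \<open>An arbitrary finite support is padded with zeros to a rectangle.\<close>
    define c' where "c' k i = (if (k, i) \<in> F then c (k, i) else 0)" for k i
    have "(\<Sum>x\<in>F. Const (c x) * (case x of (k, i) \<Rightarrow> t ^ k * e i)) =
        (\<Sum>x\<in>{..<K} \<times> F'. case x of (k, i) \<Rightarrow> Const (c' k i) * (t ^ k * e i))"
      using F(1) sub by (intro sum.mono_neutral_cong_left) (auto simp: c'_def F'_def)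
    also have "\<dots> = (\<Sum>k<K. \<Sum>i\<in>F'. Const (c' k i) * (t ^ k * e i))"
      by (simp add: sum.cartesian_product)
    finally have "(\<Sum>k<K. \<Sum>i\<in>F'. Const (c' k i) * (t ^ k * e i)) \<in> ri.span S" using F(3) by simp
    moreover have "finite F'" "F' \<subseteq> A" using F by (auto simp: F'_def)
    moreover have "fst x < K" "snd x \<in> F'" using sub x by auto
    ultimately have "c' (fst x) (snd x) = 0" using rect by blast
    then show "c x = 0" using x by (simp add: c'_def)
  qed
qed

section \<open>A finite monomial basis of the quotient by the net ideal\<close>

lemma hpart_span_triple:
  assumes "form n f" "form n g" "form n h"
  shows "hpart d (a * f + b * g + c * h) =
    (if n \<le> d then hpart (d - n) a * f + hpart (d - n) b * g + hpart (d - n) c * h else 0)"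
  by (simp add: hpart_add hpart_mult_form[OF assms(1)] hpart_mult_form[OF assms(2)] hpart_mult_form[OF assms(3)])

context basepoint_free_net begin

text \<open>Monomials with an exponent of at least \<open>N\<close> vanish in the quotient. Among
  the finitely many others, an independent set of largest size also spans, since no further monomial
  can be added to it.\<close>

lemma exists_monomial_basis:
  "\<exists>B. finite B \<and> indep_mod {f, g, h} B mon \<and>
     (\<forall>p. \<exists>c. p - (\<Sum>b\<in>B. Const (c b) * mon b) \<in> ri.span {f, g, h})"
proof -
  let ?I = "ri.span {f, g, h}"
  obtain N where N: "var i ^ N \<in> ?I" for i using var_powers_in_net_ideal by blast
  define M where "M = {m :: 3 \<Rightarrow>\<^sub>0 nat. \<forall>i. Poly_Mapping.lookup m i < N}"
  have "finite M"
  proof (rule finite_imageD)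
    have "Poly_Mapping.lookup ` M \<subseteq> Pi\<^sub>E UNIV (\<lambda>_. {..<N})" by (auto simp: M_def)
    moreover have "finite (Pi\<^sub>E (UNIV :: 3 set) (\<lambda>_. {..<N}))" by (intro finite_PiE) auto
    ultimately show "finite (Poly_Mapping.lookup ` M)" by (rule finite_subset)
    show "inj_on Poly_Mapping.lookup M" by (rule inj_onI) simp
  qed
  have outside: "mon m \<in> ?I" if "m \<notin> M" for m
  proof -
    obtain i where "N \<le> Poly_Mapping.lookup m i" using \<open>m \<notin> M\<close> by (auto simp: M_def not_less)
    then have "mon m \<in> ri.span ((\<lambda>i. var i ^ N) ` UNIV)"
      unfolding in_span_var_powers_iff by (auto simp: mon_def)
    also have "\<dots> \<subseteq> ?I" using N by (intro ri.span_minimal ri.subspace_span) auto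
    finally show ?thesis .
  qed
  define P where "P B \<longleftrightarrow> B \<subseteq> M \<and> indep_mod {f, g, h} B mon" for B
  have "P {}" by (simp add: P_def indep_mod_def)
  moreover have "card B \<le> card M" if "P B" for B
    using that \<open>finite M\<close> by (auto simp: P_def intro: card_mono)
  ultimately obtain B where B: "P B" "\<And>C. P C \<Longrightarrow> card C \<le> card B"
    using ex_has_greatest_nat[of P "{}" card "Suc (card M)"] by (auto simp: less_Suc_eq_le)
  have finB: "finite B" using B(1) \<open>finite M\<close> by (auto simp: P_def intro: finite_subset)
  have mon_span: "\<exists>c. mon m - (\<Sum>b\<in>B. Const (c b) * mon b) \<in> ?I" for m
  proof -
    consider "m \<notin> M" | "m \<in> B" | "m \<in> M" "m \<notin> B" by blast
    then show ?thesis
    proof cases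
      case 1
      then show ?thesis using outside by (intro exI[of _ "\<lambda>_. 0"]) simp
    next
      case 2
      have "(\<Sum>b\<in>B. Const (if b = m then 1 else 0) * mon b) = (\<Sum>b\<in>B. if b = m then mon b else 0)"
        by (intro sum.cong) auto
      also have "\<dots> = mon m" using 2 finB by simp
      finally show ?thesis by (intro exI[of _ "\<lambda>b. if b = m then 1 else 0"]) (simp add: ri.span_zero)
    next
      case 3
      have "\<not> P (insert m B)"
        using B(2)[of "insert m B"] 3 finB by auto
      then have "\<not> indep_mod {f, g, h} (insert m B) mon" using 3 B(1) by (simp add: P_def)
      then obtain c F i where F: "finite F" "F \<subseteq> insert m B" "(\<Sum>b\<in>F. Const (c b) * mon b) \<in> ?I" "i \<in> F" "c i \<noteq> 0"
        unfolding indep_mod_def by blast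
      define c' where "c' b = (if b \<in> F then c b else 0)" for b
      have "(\<Sum>b\<in>F. Const (c b) * mon b) = (\<Sum>b\<in>insert m B. Const (c' b) * mon b)"
        using F finB by (intro sum.mono_neutral_cong_left) (auto simp: c'_def)
      then have s: "Const (c' m) * mon m + (\<Sum>b\<in>B. Const (c' b) * mon b) \<in> ?I"
        using F(3) 3 finB by simp
      \<comment> \<open>A relation without \<open>mon m\<close> would be one among the members of
        \<open>B\<close>. Hence the relation can be solved for \<open>mon m\<close>.\<close>
      have "c' m \<noteq> 0"
      proof
        assume "c' m = 0"
        then have "(\<Sum>b\<in>B. Const (c' b) * mon b) \<in> ?I" using s by simp
        from indep_modD[OF _ finB order.refl this] have "c' b = 0" if "b \<in> B" for b
          using that B(1) by (simp add: P_def)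
        then have "c' i = 0" using F(2,4) \<open>c' m = 0\<close> by blast
        then show False using F(4,5) by (simp add: c'_def)
      qed
      have "Const (1 / c' m) * (Const (c' m) * mon m + (\<Sum>b\<in>B. Const (c' b) * mon b)) \<in> ?I"
        by (rule ri.span_scale[OF s])
      also have "Const (1 / c' m) * (Const (c' m) * mon m + (\<Sum>b\<in>B. Const (c' b) * mon b)) =
          mon m - (\<Sum>b\<in>B. Const (- c' b / c' m) * mon b)"
        using \<open>c' m \<noteq> 0\<close>
        by (simp add: distrib_left sum_distrib_left mult.assoc[symmetric] Const.hom_mult[symmetric]
            Const.hom_uminus sum_negf[symmetric])
      finally show ?thesis by (rule exI[where x = "\<lambda>b. - c' b / c' m"])
    qed
  qed
  have "\<exists>c. p - (\<Sum>b\<in>B. Const (c b) * mon b) \<in> ?I" for p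
  proof (induction p rule: mpoly_induct)
    case (single m a)
    obtain c where "mon m - (\<Sum>b\<in>B. Const (c b) * mon b) \<in> ?I" using mon_span by blast
    then have "Const a * (mon m - (\<Sum>b\<in>B. Const (c b) * mon b)) \<in> ?I" by (rule ri.span_scale)
    also have "Const a * (mon m - (\<Sum>b\<in>B. Const (c b) * mon b)) =
        Poly_Mapping.single m a - (\<Sum>b\<in>B. Const (a * c b) * mon b)"
      by (simp add: right_diff_distrib sum_distrib_left Const.hom_mult mult.assoc single_eq_mon[of m] Const_def[of a])
    finally show ?case by (rule exI[where x = "\<lambda>b. a * c b"])
  next
    case (add p q)
    then obtain c d where "p - (\<Sum>b\<in>B. Const (c b) * mon b) \<in> ?I" "q - (\<Sum>b\<in>B. Const (d b) * mon b) \<in> ?I"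
      by blast
    then have "(p - (\<Sum>b\<in>B. Const (c b) * mon b)) + (q - (\<Sum>b\<in>B. Const (d b) * mon b)) \<in> ?I"
      by (rule ri.span_add)
    also have "(p - (\<Sum>b\<in>B. Const (c b) * mon b)) + (q - (\<Sum>b\<in>B. Const (d b) * mon b)) =
      (p + q) - (\<Sum>b\<in>B. Const (c b + d b) * mon b)"
      by (simp add: Const.hom_add distrib_right sum.distrib)
    finally show ?case by (rule exI[where x = "\<lambda>b. c b + d b"])
  qed
  then show ?thesis using B(1) finB by (auto simp: P_def)
qed

end

section \<open>Coordinates in S over R\<close>

locale net_with_basis = basepoint_free_net +
  fixes B :: "(3 \<Rightarrow>\<^sub>0 nat) set"
  assumes finite_B: "finite B"
    and B_indep: "indep_mod {f, g, h} B mon"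
    and B_span: "\<And>p. \<exists>c. p - (\<Sum>b\<in>B. Const (c b) * mon b) \<in> ri.span {f, g, h}"
begin

abbreviation \<phi> :: "poly3 \<Rightarrow> poly3" where
  "\<phi> \<equiv> pullback f g h"

sublocale \<phi>: comm_ring_hom \<phi>
  unfolding pullback_def by (rule comm_ring_hom_mpoly_eval[OF comm_ring_hom_Const])

lemma phi_Const [simp]: "\<phi> (Const c) = Const c"
  by (simp add: pullback_def mpoly_eval_Const[OF comm_ring_hom_Const])

lemma phi_mon: "\<phi> (mon m) = f ^ Poly_Mapping.lookup m 1 * (g ^ Poly_Mapping.lookup m 2 * h ^ Poly_Mapping.lookup m 3)"
  unfolding pullback_def mpoly_eval_mon[OF comm_ring_hom_Const] UNIV_3 by (simp add: vector_3)

lemma phi_var: "\<phi> (var 1) = f" "\<phi> (var 2) = g" "\<phi> (var 3) = h"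
  by (simp_all add: var_def phi_mon lookup_single when_def)

lemma form_phi_mon: "form (n * mdeg m) (\<phi> (mon m))"
proof -
  have m: "mdeg m = Poly_Mapping.lookup m 1 + (Poly_Mapping.lookup m 2 + Poly_Mapping.lookup m 3)"
    by (simp add: mdeg_def sum_3)
  have "form (Poly_Mapping.lookup m 1 * n + (Poly_Mapping.lookup m 2 * n + Poly_Mapping.lookup m 3 * n)) (\<phi> (mon m))"
    unfolding phi_mon by (intro form_mult form_power forms)
  then show ?thesis by (simp add: m algebra_simps)
qed

lemma phi_single: "\<phi> (Poly_Mapping.single m c) = Const c * \<phi> (mon m)"
  by (simp add: single_eq_mon[of m c] \<phi>.hom_mult Const_def[symmetric])

lemma form_phi:
  assumes "form i p" shows "form (n * i) (\<phi> p)"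
proof -
  have "\<phi> p = (\<Sum>m\<in>Poly_Mapping.keys p. Const (Poly_Mapping.lookup p m) * \<phi> (mon m))"
    by (subst mpoly_expand[of p]) (simp add: \<phi>.hom_sum phi_single)
  also have "form (n * i) \<dots>"
    using assms form_phi_mon by (intro form_sum form_Const_mult) (auto simp: form_def[of i])
  finally show ?thesis .
qed

lemma hpart_phi: "hpart e (\<phi> p) = (if n dvd e then \<phi> (hpart (e div n) p) else 0)"
proof (induction p rule: mpoly_induct)
  case (single m c)
  have "form (n * mdeg m) (\<phi> (Poly_Mapping.single m c))"
    by (intro form_phi form_single refl)
  then have "hpart e (\<phi> (Poly_Mapping.single m c)) = (if n * mdeg m = e then \<phi> (Poly_Mapping.single m c) else 0)"
    by (rule hpart_form)
  moreover have "hpart i (Poly_Mapping.single m c) = (if mdeg m = i then Poly_Mapping.single m c else 0)" for i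
    by (rule hpart_form[OF form_single[OF refl]])
  moreover have "n * mdeg m = e \<longleftrightarrow> n dvd e \<and> mdeg m = e div n"
    using n_pos by auto
  ultimately show ?case by simp
next
  case (add p q) then show ?case by (simp add: \<phi>.hom_add hpart_add)
qed

text \<open>The R-linear map to S that sends coordinates \<open>r b\<close> in R to the
  corresponding combination of monomials. That it is injective and surjective, with coordinates read
  on \<open>B\<close> only, is the freeness of S over R.\<close>

definition comb :: "((3 \<Rightarrow>\<^sub>0 nat) \<Rightarrow> poly3) \<Rightarrow> poly3" where
  "comb r = (\<Sum>b\<in>B. \<phi> (r b) * mon b)"

lemma comb_add: "comb (\<lambda>b. r b + s b) = comb r + comb s"
  by (simp add: comb_def \<phi>.hom_add distrib_right sum.distrib)

lemma comb_minus: "comb (\<lambda>b. r b - s b) = comb r - comb s"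
  by (simp add: comb_def \<phi>.hom_minus left_diff_distrib sum_subtractf)

lemma comb_mult: "comb (\<lambda>b. a * r b) = \<phi> a * comb r"
  by (simp add: comb_def \<phi>.hom_mult sum_distrib_left mult.assoc)

text \<open>Removing h, then g, then f from the ideal turns independence of \<open>B\<close> modulo
  f, g, h into real independence of all products of powers of f, g, h with members of
  \<open>B\<close>. A vanishing combination, expanded into terms, is a relation between these
  products.\<close>

lemma comb_eq_0:
  assumes "comb r = 0" "b \<in> B" shows "r b = 0"
proof -
  have "{h, f, g} = {f, g, h}" by blast
  then have "indep_mod {f, g} (UNIV \<times> B) (\<lambda>(k, i). h ^ k * mon i)"
    using B_indep by (intro indep_mod_powers[OF _ h_regular_mod_f_g]) simp_all
  then have indep3: "indep_mod {g, f} (UNIV \<times> B) (\<lambda>(k, i). h ^ k * mon i)" by (simp only: insert_commute)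
  have regular_g: "p \<in> ri.span {f}" if "g * p \<in> ri.span {f}" for p
  proof -
    have "f dvd g * p" using that by (auto simp: ri.span_singleton)
    from g_regular_mod_f[OF this] show ?thesis by (auto simp: ri.span_singleton mult.commute elim!: dvdE)
  qed
  have indep2: "indep_mod {f} (UNIV \<times> (UNIV \<times> B)) (\<lambda>(k, i). g ^ k * (case i of (k, i) \<Rightarrow> h ^ k * mon i))"
    using indep_mod_powers[OF indep3 regular_g] .
  have regular_f: "p \<in> ri.span {}" if "f * p \<in> ri.span {}" for p
    using that f_nonzero by simp
  have indep: "indep_mod {} (UNIV \<times> (UNIV \<times> (UNIV \<times> B)))
      (\<lambda>(k, i). f ^ k * (case i of (k, i) \<Rightarrow> g ^ k * (case i of (k, i) \<Rightarrow> h ^ k * mon i)))"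
    using indep_mod_powers[OF indep2 regular_f] .
  define mk :: "nat \<Rightarrow> nat \<Rightarrow> nat \<Rightarrow> (3 \<Rightarrow>\<^sub>0 nat)" where
    "mk i j k = Poly_Mapping.single 1 i + Poly_Mapping.single 2 j + Poly_Mapping.single 3 k" for i j k
  have mk: "mk (Poly_Mapping.lookup m 1) (Poly_Mapping.lookup m 2) (Poly_Mapping.lookup m 3) = m" for m
  proof (rule poly_mapping_eqI)
    fix k :: 3
    show "Poly_Mapping.lookup (mk (Poly_Mapping.lookup m 1) (Poly_Mapping.lookup m 2) (Poly_Mapping.lookup m 3)) k = Poly_Mapping.lookup m k"
      using exhaust_3[of k] by (auto simp: mk_def lookup_add lookup_single when_def)
  qed
  \<comment> \<open>\<open>D\<close> lists the terms occurring in the coordinates, and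
    \<open>j\<close> renames a term by its three exponents and its basis element, the nested index
    shape produced by the three removals.\<close>
  define D where "D = (SIGMA b:B. Poly_Mapping.keys (r b))"
  define j where "j = (\<lambda>(b :: 3 \<Rightarrow>\<^sub>0 nat, m :: 3 \<Rightarrow>\<^sub>0 nat).
      (Poly_Mapping.lookup m 1, Poly_Mapping.lookup m 2, Poly_Mapping.lookup m 3, b))"
  define c where "c = (\<lambda>(i, k, l, b). Poly_Mapping.lookup (r b) (mk i k l))"
  have inj: "inj_on j D"
    by (rule inj_onI) (auto simp: j_def, metis mk)
  have finD: "finite D" unfolding D_def using finite_B by auto
  have "comb r = (\<Sum>b\<in>B. \<Sum>m\<in>Poly_Mapping.keys (r b). Const (Poly_Mapping.lookup (r b) m) * \<phi> (mon m) * mon b)"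
    unfolding comb_def
  proof (rule sum.cong[OF refl])
    fix b
    have "\<phi> (r b) = (\<Sum>m\<in>Poly_Mapping.keys (r b). Const (Poly_Mapping.lookup (r b) m) * \<phi> (mon m))"
      by (subst mpoly_expand[of "r b"]) (simp add: \<phi>.hom_sum phi_single)
    then show "\<phi> (r b) * mon b = (\<Sum>m\<in>Poly_Mapping.keys (r b). Const (Poly_Mapping.lookup (r b) m) * \<phi> (mon m) * mon b)"
      by (simp add: sum_distrib_right)
  qed
  also have "\<dots> = (\<Sum>x\<in>D. case x of (b, m) \<Rightarrow> Const (Poly_Mapping.lookup (r b) m) * \<phi> (mon m) * mon b)"
    unfolding D_def using finite_B by (simp add: sum.Sigma)
  also have "\<dots> = (\<Sum>x\<in>j ` D. Const (c x) * (case x of (k, i) \<Rightarrow> f ^ k * (case i of (k, i) \<Rightarrow> g ^ k * (case i of (k, i) \<Rightarrow> h ^ k * mon i))))"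
    unfolding sum.reindex[OF inj] by (intro sum.cong) (auto simp: j_def c_def mk phi_mon mult.assoc)
  finally have "(\<Sum>x\<in>j ` D. Const (c x) * (case x of (k, i) \<Rightarrow> f ^ k * (case i of (k, i) \<Rightarrow> g ^ k * (case i of (k, i) \<Rightarrow> h ^ k * mon i)))) \<in> ri.span {}"
    using assms(1) by simp
  then have zero: "c x = 0" if "x \<in> j ` D" for x
    by (rule indep_modD[OF indep _ _ _ that, rotated 2]) (use finD in \<open>auto simp: j_def D_def\<close>)
  have "Poly_Mapping.keys (r b) = {}"
  proof (rule ccontr)
    assume "Poly_Mapping.keys (r b) \<noteq> {}"
    then obtain m where m: "m \<in> Poly_Mapping.keys (r b)" by blast
    then have "c (j (b, m)) = 0" using assms(2) by (intro zero) (auto simp: D_def)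
    then show False using m by (simp add: c_def j_def mk in_keys_iff)
  qed
  then show ?thesis by simp
qed

lemma comb_eq_iff: "comb r = comb s \<longleftrightarrow> (\<forall>b\<in>B. r b = s b)"
proof
  assume "comb r = comb s"
  then have "comb (\<lambda>b. r b - s b) = 0" by (simp add: comb_minus)
  from comb_eq_0[OF this] show "\<forall>b\<in>B. r b = s b" by simp
qed (simp add: comb_def)

text \<open>Graded Nakayama: modulo the ideal a form is a real combination of \<open>B\<close>, and
  the multipliers of f, g, h in the remainder can be taken in degree d - n, where the induction
  hypothesis applies because n is positive.\<close>

lemma comb_surj: "\<exists>r. s = comb r"
proof -
  have form: "\<exists>r. s = comb r" if "form d s" for d s
    using that
  proof (induction d arbitrary: s rule: less_induct)
    case (less d)
    obtain c where "s - (\<Sum>b\<in>B. Const (c b) * mon b) \<in> ri.span {f, g, h}" using B_span by blast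
    then obtain \<alpha> \<beta> \<gamma> where "s - (\<Sum>b\<in>B. Const (c b) * mon b) = \<alpha> * f + \<beta> * g + \<gamma> * h"
      unfolding in_span_triple_iff by blast
    then have "s = (\<Sum>b\<in>B. Const (c b) * mon b) + (\<alpha> * f + \<beta> * g + \<gamma> * h)" by (simp add: diff_eq_eq add.commute)
    then have "hpart d s = (\<Sum>b\<in>B. Const (c b) * hpart d (mon b)) + hpart d (\<alpha> * f + \<beta> * g + \<gamma> * h)"
      by (simp only: hpart_add hpart_sum hpart_Const_mult)
    moreover have "(\<Sum>b\<in>B. Const (c b) * hpart d (mon b)) = comb (\<lambda>b. Const (if mdeg b = d then c b else 0))"
      unfolding comb_def by (intro sum.cong) (auto simp: hpart_form[OF form_mon])
    moreover have "\<exists>r. hpart d (\<alpha> * f + \<beta> * g + \<gamma> * h) = comb r"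
    proof (cases "n \<le> d")
      case True
      then have "d - n < d" using n_pos by simp
      then have "\<exists>r. hpart (d - n) p = comb r" for p using less.IH form_hpart by blast
      then obtain r1 r2 r3 where "hpart (d - n) \<alpha> = comb r1" "hpart (d - n) \<beta> = comb r2" "hpart (d - n) \<gamma> = comb r3"
        by metis
      then have "hpart d (\<alpha> * f + \<beta> * g + \<gamma> * h) = comb r1 * f + comb r2 * g + comb r3 * h"
        using True by (simp only: hpart_span_triple[OF forms] if_True)
      \<comment> \<open>Multiplication by f, g, h acts on coordinates as multiplication by the
        variables of R.\<close>
      also have "\<dots> = comb (\<lambda>b. var 1 * r1 b + var 2 * r2 b + var 3 * r3 b)"
        unfolding comb_add comb_mult phi_var by (simp only: mult.commute)
      finally show ?thesis by blast
    next
      case False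
      then have "hpart d (\<alpha> * f + \<beta> * g + \<gamma> * h) = comb (\<lambda>_. 0)"
        by (simp add: hpart_span_triple[OF forms] comb_def)
      then show ?thesis by blast
    qed
    ultimately obtain r where "hpart d s = comb (\<lambda>b. Const (if mdeg b = d then c b else 0)) + comb r" by auto
    then have "s = comb (\<lambda>b. Const (if mdeg b = d then c b else 0) + r b)"
      unfolding comb_add using hpart_form[OF less.prems, of d] by simp
    then show ?case by blast
  qed
  obtain D where D: "s = (\<Sum>d<D. hpart d s)" using sum_hpart by blast
  have "\<forall>d. \<exists>r. hpart d s = comb r" using form[OF form_hpart] by blast
  then obtain r where r: "hpart d s = comb (r d)" for d by metis
  have "(\<Sum>d<D. comb (r d)) = comb (\<lambda>b. \<Sum>d<D. r d b)"
    by (induction D) (simp_all add: comb_add, simp add: comb_def)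
  then have "s = comb (\<lambda>b. \<Sum>d<D. r d b)" using D unfolding r by simp
  then show ?thesis by blast
qed

text \<open>The constant coordinate vector \<open>p\<close> would combine to zero, and there is at
  least one coordinate.\<close>

lemma phi_inj: "\<phi> p = 0 \<Longrightarrow> p = 0"
proof -
  assume p: "\<phi> p = 0"
  have "B \<noteq> {}"
  proof
    assume "B = {}"
    then have "comb r = 0" for r unfolding comb_def by simp
    then show False using comb_surj[of 1] by simp
  qed
  moreover have "comb (\<lambda>_. p) = 0" using p by (simp add: comb_def)
  ultimately show "p = 0" using comb_eq_0 by blast
qed

text \<open>The quotient has coordinates too, and multiplication by \<open>\<phi> l\<close>
  multiplies each coordinate by \<open>l\<close>; uniqueness of coordinates allows
  comparison.\<close>

lemma dvd_comb_iff: "\<phi> l dvd comb r \<longleftrightarrow> (\<forall>b\<in>B. l dvd r b)"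
proof
  assume "\<phi> l dvd comb r"
  then obtain s where "comb r = \<phi> l * s" by (rule dvdE)
  moreover obtain q where "s = comb q" using comb_surj by blast
  ultimately have "comb r = comb (\<lambda>b. l * q b)" by (simp add: comb_mult)
  then show "\<forall>b\<in>B. l dvd r b" unfolding comb_eq_iff by simp
next
  assume "\<forall>b\<in>B. l dvd r b"
  then show "\<phi> l dvd comb r" unfolding comb_def
    by (intro dvd_sum dvd_mult2) (auto elim!: dvdE simp: \<phi>.hom_mult)
qed

text \<open>The degree \<open>d\<close> part of the expansion is again an expansion, since pullback
  multiplies degrees by n and the basis consists of monomials; uniqueness identifies its coordinates
  with the given ones. At most one \<open>i\<close> qualifies, as n is positive.\<close>

lemma form_combD:
  assumes "form d (comb r)" "b \<in> B"
  shows "if \<exists>i. n * i + mdeg b = d then (\<forall>i. n * i + mdeg b = d \<longrightarrow> form i (r b)) else r b = 0"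
proof -
  define s where "s b = (if mdeg b \<le> d \<and> n dvd (d - mdeg b) then hpart ((d - mdeg b) div n) (r b) else 0)" for b
  have "comb r = hpart d (comb r)" using hpart_form[OF assms(1)] by simp
  also have "\<dots> = comb s"
    unfolding comb_def hpart_sum
    by (intro sum.cong) (auto simp: hpart_mult_form[OF form_mon] hpart_phi s_def)
  finally have "r b = s b" using assms(2) by (simp add: comb_eq_iff)
  moreover have "mdeg b \<le> d \<and> n dvd (d - mdeg b) \<and> i = (d - mdeg b) div n" if "n * i + mdeg b = d" for i
    using that n_pos by auto
  moreover have "\<exists>i. n * i + mdeg b = d" if "mdeg b \<le> d" "n dvd (d - mdeg b)"
    using that by (metis dvd_mult_div_cancel le_add_diff_inverse2)
  ultimately show ?thesis using form_hpart unfolding s_def by (smt (verit))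
qed

lemma form_combI:
  assumes "\<And>b. b \<in> B \<Longrightarrow> r b = 0 \<or> (\<exists>i. n * i + mdeg b = d \<and> form i (r b))"
  shows "form d (comb r)"
  unfolding comb_def using assms form_mult[OF form_phi form_mon] by (intro form_sum) fastforce

end

section \<open>Tensor products with a free module\<close>

text \<open>The common setting of both tensor product descriptions. \<beta> is a balanced biadditive
  map into \<open>X\<close>, and \<open>act\<close> is the action of \<open>C\<close> on generators
  that \<beta> carries to the action on \<open>X\<close>. Generation of \<open>N\<close> by the
  \<open>e b\<close> is given as an induction principle, ready for use on generators of the tensor
  product. \<open>X_span\<close> and \<open>X_indep\<close> make \<open>X\<close> a direct sum of
  copies of \<open>M\<close> indexed by \<open>J\<close>.\<close>

locale tensor_with_basis =
  fixes A :: "'a ring" and M :: "('a, 'm) module" and N :: "('a, 'n) module"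
    and C :: "'s ring" and X :: "('s, 'x) module"
    and \<beta> :: "'m \<Rightarrow> 'n \<Rightarrow> 'x" and act :: "'s \<Rightarrow> 'm \<times> 'n \<Rightarrow> 'm \<times> 'n"
    and J :: "'i set" and e :: "'i \<Rightarrow> 'n"
  assumes M: "abelian_group M"
    and M_smult: "\<And>a m. a \<in> carrier A \<Longrightarrow> m \<in> carrier M \<Longrightarrow> a \<odot>\<^bsub>M\<^esub> m \<in> carrier M"
    and N_add: "\<And>n n'. n \<in> carrier N \<Longrightarrow> n' \<in> carrier N \<Longrightarrow> n \<oplus>\<^bsub>N\<^esub> n' \<in> carrier N"
    and N_smult: "\<And>a n. a \<in> carrier A \<Longrightarrow> n \<in> carrier N \<Longrightarrow> a \<odot>\<^bsub>N\<^esub> n \<in> carrier N"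
    and X: "abelian_group X"
    and X_smult: "\<And>s x. s \<in> carrier C \<Longrightarrow> x \<in> carrier X \<Longrightarrow> s \<odot>\<^bsub>X\<^esub> x \<in> carrier X"
    and X_smult_add: "\<And>s x y. s \<in> carrier C \<Longrightarrow> x \<in> carrier X \<Longrightarrow> y \<in> carrier X \<Longrightarrow>
          s \<odot>\<^bsub>X\<^esub> (x \<oplus>\<^bsub>X\<^esub> y) = s \<odot>\<^bsub>X\<^esub> x \<oplus>\<^bsub>X\<^esub> s \<odot>\<^bsub>X\<^esub> y"
    and \<beta>: "\<And>m n. m \<in> carrier M \<Longrightarrow> n \<in> carrier N \<Longrightarrow> \<beta> m n \<in> carrier X"
    and \<beta>_add_left: "\<And>m m' n. m \<in> carrier M \<Longrightarrow> m' \<in> carrier M \<Longrightarrow> n \<in> carrier N \<Longrightarrow>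
          \<beta> (m \<oplus>\<^bsub>M\<^esub> m') n = \<beta> m n \<oplus>\<^bsub>X\<^esub> \<beta> m' n"
    and \<beta>_add_right: "\<And>m n n'. m \<in> carrier M \<Longrightarrow> n \<in> carrier N \<Longrightarrow> n' \<in> carrier N \<Longrightarrow>
          \<beta> m (n \<oplus>\<^bsub>N\<^esub> n') = \<beta> m n \<oplus>\<^bsub>X\<^esub> \<beta> m n'"
    and \<beta>_balanced: "\<And>a m n. a \<in> carrier A \<Longrightarrow> m \<in> carrier M \<Longrightarrow> n \<in> carrier N \<Longrightarrow>
          \<beta> (a \<odot>\<^bsub>M\<^esub> m) n = \<beta> m (a \<odot>\<^bsub>N\<^esub> n)"
    and act: "\<And>s m n. s \<in> carrier C \<Longrightarrow> m \<in> carrier M \<Longrightarrow> n \<in> carrier N \<Longrightarrow>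
          act s (m, n) \<in> carrier M \<times> carrier N"
    and \<beta>_act: "\<And>s m n. s \<in> carrier C \<Longrightarrow> m \<in> carrier M \<Longrightarrow> n \<in> carrier N \<Longrightarrow>
          case_prod \<beta> (act s (m, n)) = s \<odot>\<^bsub>X\<^esub> \<beta> m n"
    and finite_J: "finite J"
    and e: "\<And>b. b \<in> J \<Longrightarrow> e b \<in> carrier N"
    and N_gen: "\<And>T. (\<And>b. b \<in> J \<Longrightarrow> e b \<in> T) \<Longrightarrow>
          (\<And>n n'. n \<in> carrier N \<Longrightarrow> n' \<in> carrier N \<Longrightarrow> n \<in> T \<Longrightarrow> n' \<in> T \<Longrightarrow> n \<oplus>\<^bsub>N\<^esub> n' \<in> T) \<Longrightarrow>
          (\<And>a n. a \<in> carrier A \<Longrightarrow> n \<in> carrier N \<Longrightarrow> n \<in> T \<Longrightarrow> a \<odot>\<^bsub>N\<^esub> n \<in> T) \<Longrightarrow> carrier N \<subseteq> T"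
    and X_span: "\<And>x. x \<in> carrier X \<Longrightarrow> \<exists>r\<in>J \<rightarrow> carrier M. x = finsum X (\<lambda>b. \<beta> (r b) (e b)) J"
    and X_indep: "\<And>r. r \<in> J \<rightarrow> carrier M \<Longrightarrow> finsum X (\<lambda>b. \<beta> (r b) (e b)) J = \<zero>\<^bsub>X\<^esub> \<Longrightarrow> \<forall>b\<in>J. r b = \<zero>\<^bsub>M\<^esub>"
begin

interpretation M: abelian_group M by (rule M)
interpretation X: abelian_group X by (rule X)

abbreviation (input) F where "F \<equiv> free_Abelian_group (carrier M \<times> carrier N)"
abbreviation (input) K where "K \<equiv> tensor_kernel A M N"

interpretation F: comm_group F by (rule abelian_free_Abelian_group)

lemma N_induct:
  assumes "n \<in> carrier N" "\<And>b. b \<in> J \<Longrightarrow> P (e b)"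
    "\<And>n n'. n \<in> carrier N \<Longrightarrow> n' \<in> carrier N \<Longrightarrow> P n \<Longrightarrow> P n' \<Longrightarrow> P (n \<oplus>\<^bsub>N\<^esub> n')"
    "\<And>a n. a \<in> carrier A \<Longrightarrow> n \<in> carrier N \<Longrightarrow> P n \<Longrightarrow> P (a \<odot>\<^bsub>N\<^esub> n)"
  shows "P n"
  using N_gen[of "Collect P"] assms by auto

lemma carrier_F_diff: "c \<in> carrier F \<Longrightarrow> d \<in> carrier F \<Longrightarrow> c - d \<in> carrier F"
  using keys_diff[of c d] unfolding carrier_free_Abelian_group_iff by blast

lemma relations_subset: "tensor_relations A M N \<subseteq> carrier F"
proof
  fix c assume "c \<in> tensor_relations A M N"
  then show "c \<in> carrier F"
    unfolding tensor_relations_def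
    by (elim UnE CollectE exE conjE; simp only:)
      (intro carrier_F_diff; simp add: frag_of_in_free_Abelian_group M_smult N_add N_smult)+
qed

lemma subgroup_K: "subgroup K F"
  unfolding tensor_kernel_def by (rule F.generate_is_subgroup[OF relations_subset])

lemma K_subset: "K \<subseteq> carrier F"
  by (rule subgroup.subset[OF subgroup_K])

lemma K_0: "0 \<in> K"
  using subgroup.one_closed[OF subgroup_K] by simp

lemma K_add: "c \<in> K \<Longrightarrow> d \<in> K \<Longrightarrow> c + d \<in> K"
  using subgroup.m_closed[OF subgroup_K] by simp

lemma K_uminus: "c \<in> K \<Longrightarrow> - c \<in> K"
  using subgroup.m_inv_closed[OF subgroup_K, of c] K_subset by auto

lemma K_diff: "c \<in> K \<Longrightarrow> d \<in> K \<Longrightarrow> c - d \<in> K"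
  using K_add[OF _ K_uminus] by fastforce

lemma K_sum: "(\<And>b. b \<in> I \<Longrightarrow> c b \<in> K) \<Longrightarrow> (\<Sum>b\<in>I. c b) \<in> K"
  by (induction I rule: infinite_finite_induct) (auto intro: K_0 K_add)

lemma relation_in_K: "c \<in> tensor_relations A M N \<Longrightarrow> c \<in> K"
  unfolding tensor_kernel_def by (rule generate.incl)

lemma K_add_left:
  assumes "m \<in> carrier M" "m' \<in> carrier M" "n \<in> carrier N"
  shows "frag_of (m \<oplus>\<^bsub>M\<^esub> m', n) - frag_of (m, n) - frag_of (m', n) \<in> K"
  by (rule relation_in_K) (use assms in \<open>unfold tensor_relations_def, blast\<close>)

lemma K_add_right:
  assumes "m \<in> carrier M" "n \<in> carrier N" "n' \<in> carrier N"
  shows "frag_of (m, n \<oplus>\<^bsub>N\<^esub> n') - frag_of (m, n) - frag_of (m, n') \<in> K"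
  by (rule relation_in_K) (use assms in \<open>unfold tensor_relations_def, blast\<close>)

lemma K_balanced:
  assumes "a \<in> carrier A" "m \<in> carrier M" "n \<in> carrier N"
  shows "frag_of (a \<odot>\<^bsub>M\<^esub> m, n) - frag_of (m, a \<odot>\<^bsub>N\<^esub> n) \<in> K"
  by (rule relation_in_K) (use assms in \<open>unfold tensor_relations_def, blast\<close>)

text \<open>For two zero summands the additivity relation collapses to minus this generator.\<close>

lemma K_zero_left: "n \<in> carrier N \<Longrightarrow> frag_of (\<zero>\<^bsub>M\<^esub>, n) \<in> K"
  using K_uminus[OF K_add_left[of "\<zero>\<^bsub>M\<^esub>" "\<zero>\<^bsub>M\<^esub>" n]] by simp

lemma K_uminus_left:
  assumes "m \<in> carrier M" "n \<in> carrier N"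
  shows "frag_of (\<ominus>\<^bsub>M\<^esub> m, n) + frag_of (m, n) \<in> K"
proof -
  have "frag_of (\<zero>\<^bsub>M\<^esub>, n) - frag_of (m, n) - frag_of (\<ominus>\<^bsub>M\<^esub> m, n) \<in> K"
    using K_add_left[of m "\<ominus>\<^bsub>M\<^esub> m" n] assms by (simp add: M.r_neg)
  from K_diff[OF K_zero_left[OF assms(2)] this] show ?thesis by (simp add: add.commute)
qed

text \<open>The class of \<open>c\<close> in the tensor product has a normal form, the sum of the
  tensors of \<open>r b\<close> with \<open>e b\<close>.\<close>

definition reducible :: "('m \<times> 'n \<Rightarrow>\<^sub>0 int) \<Rightarrow> bool" where
  "reducible c \<longleftrightarrow> (\<exists>r\<in>J \<rightarrow> carrier M. c - (\<Sum>b\<in>J. frag_of (r b, e b)) \<in> K)"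

lemma reducible_cong: "reducible c \<Longrightarrow> d - c \<in> K \<Longrightarrow> reducible d"
  unfolding reducible_def using K_add by force

lemma reducible_0: "reducible 0"
  unfolding reducible_def
  by (intro bexI[of _ "\<lambda>_. \<zero>\<^bsub>M\<^esub>"]) (use K_uminus[OF K_sum[OF K_zero_left[OF e]]] in auto)

lemma reducible_diff:
  assumes "reducible c" "reducible d"
  shows "reducible (c - d)"
proof -
  obtain r where r: "r \<in> J \<rightarrow> carrier M" "c - (\<Sum>b\<in>J. frag_of (r b, e b)) \<in> K"
    using assms(1) unfolding reducible_def by blast
  obtain s where s: "s \<in> J \<rightarrow> carrier M" "d - (\<Sum>b\<in>J. frag_of (s b, e b)) \<in> K"
    using assms(2) unfolding reducible_def by blast
  have "(\<Sum>b\<in>J. frag_of (r b \<oplus>\<^bsub>M\<^esub> \<ominus>\<^bsub>M\<^esub> s b, e b) - frag_of (r b, e b) - frag_of (\<ominus>\<^bsub>M\<^esub> s b, e b)) \<in> K"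
    using r s e by (intro K_sum K_add_left) auto
  moreover have "(\<Sum>b\<in>J. frag_of (\<ominus>\<^bsub>M\<^esub> s b, e b) + frag_of (s b, e b)) \<in> K"
    using s e by (intro K_sum K_uminus_left) auto
  ultimately have "(c - (\<Sum>b\<in>J. frag_of (r b, e b))) - (d - (\<Sum>b\<in>J. frag_of (s b, e b)))
    - (\<Sum>b\<in>J. frag_of (r b \<oplus>\<^bsub>M\<^esub> \<ominus>\<^bsub>M\<^esub> s b, e b) - frag_of (r b, e b) - frag_of (\<ominus>\<^bsub>M\<^esub> s b, e b))
    - (\<Sum>b\<in>J. frag_of (\<ominus>\<^bsub>M\<^esub> s b, e b) + frag_of (s b, e b)) \<in> K"
    by (intro K_diff r s)
  then have "(c - d) - (\<Sum>b\<in>J. frag_of (r b \<oplus>\<^bsub>M\<^esub> \<ominus>\<^bsub>M\<^esub> s b, e b)) \<in> K"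
    by (simp add: sum_subtractf sum.distrib algebra_simps)
  then show ?thesis
    unfolding reducible_def using r s by (intro bexI[of _ "\<lambda>b. r b \<oplus>\<^bsub>M\<^esub> \<ominus>\<^bsub>M\<^esub> s b"]) auto
qed

lemma reducible_add: "reducible c \<Longrightarrow> reducible d \<Longrightarrow> reducible (c + d)"
  using reducible_diff[OF _ reducible_diff[OF reducible_0]] by fastforce

text \<open>Induction along the generation of \<open>N\<close>. The entry \<open>m\<close> stays
  universally quantified because balancing moves a scalar from \<open>n\<close> to
  \<open>m\<close>.\<close>

lemma reducible_generator:
  assumes "n \<in> carrier N" "m \<in> carrier M" shows "reducible (frag_of (m, n))"
proof -
  have "\<forall>m\<in>carrier M. reducible (frag_of (m, n))"
    using assms(1)
  proof (rule N_induct[where P = "\<lambda>n. \<forall>m\<in>carrier M. reducible (frag_of (m, n))"])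
    fix b assume b: "b \<in> J"
    show "\<forall>m\<in>carrier M. reducible (frag_of (m, e b))"
    proof
      fix m assume m: "m \<in> carrier M"
      \<comment> \<open>All coordinates except that at \<open>b\<close> are zero; the corresponding
        generators do not vanish in the free group, but they lie in \<open>K\<close>.\<close>
      have "(\<Sum>b'\<in>J. frag_of (if b' = b then m else \<zero>\<^bsub>M\<^esub>, e b')) =
          frag_of (m, e b) + (\<Sum>b'\<in>J - {b}. frag_of (\<zero>\<^bsub>M\<^esub>, e b'))"
        using b finite_J by (simp add: sum.remove[of J b])
      moreover have "(\<Sum>b'\<in>J - {b}. frag_of (\<zero>\<^bsub>M\<^esub>, e b')) \<in> K"
        by (intro K_sum K_zero_left e) simp
      ultimately show "reducible (frag_of (m, e b))"
        unfolding reducible_def using m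
        by (intro bexI[of _ "\<lambda>b'. if b' = b then m else \<zero>\<^bsub>M\<^esub>"]) (auto intro: K_uminus)
    qed
  next
    fix n n' assume n: "n \<in> carrier N" "n' \<in> carrier N"
      and red: "\<forall>m\<in>carrier M. reducible (frag_of (m, n))" "\<forall>m\<in>carrier M. reducible (frag_of (m, n'))"
    show "\<forall>m\<in>carrier M. reducible (frag_of (m, n \<oplus>\<^bsub>N\<^esub> n'))"
    proof
      fix m assume m: "m \<in> carrier M"
      show "reducible (frag_of (m, n \<oplus>\<^bsub>N\<^esub> n'))"
        by (rule reducible_cong[OF reducible_add[OF red(1)[rule_format, OF m] red(2)[rule_format, OF m]]])
          (use K_add_right[OF m n] in \<open>simp add: diff_diff_eq\<close>)
    qed
  next
    fix a n assume a: "a \<in> carrier A" and n: "n \<in> carrier N" and red: "\<forall>m\<in>carrier M. reducible (frag_of (m, n))"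
    show "\<forall>m\<in>carrier M. reducible (frag_of (m, a \<odot>\<^bsub>N\<^esub> n))"
    proof
      fix m assume m: "m \<in> carrier M"
      show "reducible (frag_of (m, a \<odot>\<^bsub>N\<^esub> n))"
        by (rule reducible_cong[OF red[rule_format, OF M_smult[OF a m]]])
          (use K_uminus[OF K_balanced[OF a m n]] in simp)
    qed
  qed
  then show ?thesis using assms(2) by blast
qed

lemma reducible: "c \<in> carrier F \<Longrightarrow> reducible c"
  unfolding carrier_free_Abelian_group_iff
  by (induction c rule: frag_induction) (auto intro: reducible_0 reducible_diff reducible_generator)

text \<open>By the universal property \<beta> extends to \<Psi> on the free abelian group. \<Psi>
  kills the relations, and \<open>X_indep\<close> applied to normal forms shows that it kills
  nothing else.\<close>

theorem tensor_iso: "module_isomorphic C X (tensor_module A M N act)"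
proof -
  have "case_prod \<beta> ` (carrier M \<times> carrier N) \<subseteq> carrier X" using \<beta> by auto
  from X.add.free_Abelian_group_universal[OF this]
  obtain \<Psi> where \<Psi>: "\<Psi> \<in> hom F (add_monoid X)"
    and \<Psi>_of: "\<And>p. p \<in> carrier M \<times> carrier N \<Longrightarrow> \<Psi> (frag_of p) = case_prod \<beta> p" by blast
  interpret \<Psi>: group_hom F "add_monoid X" \<Psi>
    by (simp add: group_hom_def group_hom_axioms_def \<Psi>)
  have closed: "\<Psi> c \<in> carrier X" if "c \<in> carrier F" for c using \<Psi>.hom_closed[OF that] by simp
  have add: "\<Psi> (c + d) = \<Psi> c \<oplus>\<^bsub>X\<^esub> \<Psi> d" if "c \<in> carrier F" "d \<in> carrier F" for c d
    using \<Psi>.hom_mult[OF that] by simp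
  have \<Psi>_0: "\<Psi> 0 = \<zero>\<^bsub>X\<^esub>" using \<Psi>.hom_one by simp
  have minus: "\<Psi> (- c) = \<ominus>\<^bsub>X\<^esub> \<Psi> c" if "c \<in> carrier F" for c
    using \<Psi>.hom_inv[OF that] that by (simp add: a_inv_def)
  have carrier_add: "c + d \<in> carrier F" if "c \<in> carrier F" "d \<in> carrier F" for c d
    using F.m_closed[OF that] by simp
  have carrier_uminus: "- c \<in> carrier F" if "c \<in> carrier F" for c
    using that by simp
  have carrier_diff: "c - d \<in> carrier F" if "c \<in> carrier F" "d \<in> carrier F" for c d
    using carrier_add[OF that(1) carrier_uminus[OF that(2)]] by simp
  have \<Psi>_diff: "\<Psi> (c - d) = \<Psi> c \<ominus>\<^bsub>X\<^esub> \<Psi> d" if "c \<in> carrier F" "d \<in> carrier F" for c d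
    using add[OF that(1) carrier_uminus[OF that(2)]] minus[OF that(2)] by (simp add: a_minus_def)
  have \<Psi>_sum: "(\<Sum>b\<in>I. frag_of (r b, e b)) \<in> carrier F \<and>
      \<Psi> (\<Sum>b\<in>I. frag_of (r b, e b)) = finsum X (\<lambda>b. \<beta> (r b) (e b)) I"
    if "finite I" "I \<subseteq> J" "r \<in> J \<rightarrow> carrier M" for I r
    using that(1,2)
  proof (induction I rule: finite_induct)
    case empty then show ?case by (simp add: \<Psi>_0)
  next
    case (insert b I)
    have b: "(r b, e b) \<in> carrier M \<times> carrier N" using insert.prems that(3) e by auto
    have "(\<lambda>b. \<beta> (r b) (e b)) \<in> I \<rightarrow> carrier X"
      using insert.prems by (intro Pi_I \<beta> e funcset_mem[OF that(3)]) auto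
    then show ?case
      using insert b by (simp add: add carrier_add \<Psi>_of \<beta> del: carrier_free_Abelian_group_iff)
  qed
  have p: "\<Psi> (frag_of (m, n)) = \<beta> m n" "frag_of (m, n) \<in> carrier F" if "m \<in> carrier M" "n \<in> carrier N" for m n
    using that by (simp_all add: \<Psi>_of)
  have cancel: "x \<oplus>\<^bsub>X\<^esub> y \<ominus>\<^bsub>X\<^esub> x \<ominus>\<^bsub>X\<^esub> y = \<zero>\<^bsub>X\<^esub>" "x \<ominus>\<^bsub>X\<^esub> x = \<zero>\<^bsub>X\<^esub>" if "x \<in> carrier X" "y \<in> carrier X" for x y
  proof -
    have "x \<oplus>\<^bsub>X\<^esub> y \<ominus>\<^bsub>X\<^esub> x = y"
      using that by (simp add: X.minus_eq X.a_comm[of x y] X.a_assoc X.r_neg)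
    then show "x \<oplus>\<^bsub>X\<^esub> y \<ominus>\<^bsub>X\<^esub> x \<ominus>\<^bsub>X\<^esub> y = \<zero>\<^bsub>X\<^esub>" "x \<ominus>\<^bsub>X\<^esub> x = \<zero>\<^bsub>X\<^esub>"
      using that by (simp_all add: X.minus_eq X.r_neg)
  qed
  have "tensor_relations A M N \<subseteq> kernel F (add_monoid X) \<Psi>"
  proof
    fix c assume c: "c \<in> tensor_relations A M N"
    from c have "\<Psi> c = \<zero>\<^bsub>X\<^esub>"
      unfolding tensor_relations_def
    proof (elim UnE CollectE exE conjE)
      fix m m' n assume c: "c = frag_of (m \<oplus>\<^bsub>M\<^esub> m', n) - frag_of (m, n) - frag_of (m', n)"
        and mn: "m \<in> carrier M" "m' \<in> carrier M" "n \<in> carrier N"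
      have "\<Psi> c = \<beta> (m \<oplus>\<^bsub>M\<^esub> m') n \<ominus>\<^bsub>X\<^esub> \<beta> m n \<ominus>\<^bsub>X\<^esub> \<beta> m' n"
        unfolding c using mn by (simp only: \<Psi>_diff carrier_diff p M.a_closed)
      then show ?thesis using mn by (simp add: \<beta>_add_left cancel \<beta>)
    next
      fix m n n' assume c: "c = frag_of (m, n \<oplus>\<^bsub>N\<^esub> n') - frag_of (m, n) - frag_of (m, n')"
        and mn: "m \<in> carrier M" "n \<in> carrier N" "n' \<in> carrier N"
      have "\<Psi> c = \<beta> m (n \<oplus>\<^bsub>N\<^esub> n') \<ominus>\<^bsub>X\<^esub> \<beta> m n \<ominus>\<^bsub>X\<^esub> \<beta> m n'"
        unfolding c using mn by (simp only: \<Psi>_diff carrier_diff p N_add)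
      then show ?thesis using mn by (simp add: \<beta>_add_right cancel \<beta>)
    next
      fix a m n assume c: "c = frag_of (a \<odot>\<^bsub>M\<^esub> m, n) - frag_of (m, a \<odot>\<^bsub>N\<^esub> n)"
        and mn: "a \<in> carrier A" "m \<in> carrier M" "n \<in> carrier N"
      have "\<Psi> c = \<beta> (a \<odot>\<^bsub>M\<^esub> m) n \<ominus>\<^bsub>X\<^esub> \<beta> m (a \<odot>\<^bsub>N\<^esub> n)"
        unfolding c using mn by (simp only: \<Psi>_diff p M_smult N_smult)
      then show ?thesis using mn by (simp add: \<beta>_balanced cancel \<beta> N_smult)
    qed
    then show "c \<in> kernel F (add_monoid X) \<Psi>"
      using c relations_subset by (auto simp: kernel_def simp del: carrier_free_Abelian_group_iff)
  qed
  then have "K \<subseteq> kernel F (add_monoid X) \<Psi>"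
    unfolding tensor_kernel_def by (intro F.generate_subgroup_incl \<Psi>.subgroup_kernel)
  then have K_zero: "\<Psi> c = \<zero>\<^bsub>X\<^esub>" "c \<in> carrier F" if "c \<in> K" for c
    using that by (auto simp: kernel_def)
  \<comment> \<open>In normal form an element of the kernel has coordinates satisfying
    \<open>X_indep\<close>, so all of them are zero and the normal form itself lies in
    \<open>K\<close>.\<close>
  have zero_K: "c \<in> K" if c: "c \<in> carrier F" "\<Psi> c = \<zero>\<^bsub>X\<^esub>" for c
  proof -
    obtain r where r: "r \<in> J \<rightarrow> carrier M" "c - (\<Sum>b\<in>J. frag_of (r b, e b)) \<in> K"
      using reducible[OF c(1)] unfolding reducible_def by blast
    define d where "d = (\<Sum>b\<in>J. frag_of (r b, e b))"
    have d: "d \<in> carrier F" "\<Psi> d = finsum X (\<lambda>b. \<beta> (r b) (e b)) J"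
      using \<Psi>_sum[OF finite_J order.refl r(1)] by (simp_all add: d_def)
    have cd: "c - d \<in> K" using r(2) by (simp add: d_def)
    have "\<Psi> (c - (c - d)) = \<zero>\<^bsub>X\<^esub>"
      unfolding \<Psi>_diff[OF c(1) K_zero(2)[OF cd]] K_zero(1)[OF cd] c(2)
      by (rule cancel(2)[OF X.zero_closed X.zero_closed])
    also have "c - (c - d) = d" by simp
    finally have "\<forall>b\<in>J. r b = \<zero>\<^bsub>M\<^esub>" unfolding d(2) by (rule X_indep[OF r(1)])
    then have "d = (\<Sum>b\<in>J. frag_of (\<zero>\<^bsub>M\<^esub>, e b))" by (simp add: d_def)
    also have "\<dots> \<in> K" by (intro K_sum K_zero_left e)
    finally have "(c - d) + d \<in> K" by (rule K_add[OF cd])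
    then show ?thesis by simp
  qed
  \<comment> \<open>Fibres of \<open>\<Psi>\<close> are cosets of its kernel, so \<open>\<theta>\<close> inverts the induced map on the tensor product.\<close>
  define \<theta> where "\<theta> x = {c \<in> carrier F. \<Psi> c = x}" for x
  have coset: "K #>\<^bsub>F\<^esub> c = \<theta> (\<Psi> c)" if c: "c \<in> carrier F" for c
  proof
    show "K #>\<^bsub>F\<^esub> c \<subseteq> \<theta> (\<Psi> c)"
    proof
      fix d assume "d \<in> K #>\<^bsub>F\<^esub> c"
      then obtain k where k: "k \<in> K" "d = k + c" unfolding r_coset_def by auto
      then show "d \<in> \<theta> (\<Psi> c)"
        unfolding \<theta>_def using add[OF K_zero(2)[OF k(1)] c] carrier_add[OF K_zero(2)[OF k(1)] c]
          K_zero(1)[OF k(1)] closed[OF c] by (simp del: carrier_free_Abelian_group_iff)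
    qed
    show "\<theta> (\<Psi> c) \<subseteq> K #>\<^bsub>F\<^esub> c"
    proof
      fix d assume "d \<in> \<theta> (\<Psi> c)"
      then have d: "d \<in> carrier F" "\<Psi> d = \<Psi> c" unfolding \<theta>_def by blast+
      have "\<Psi> (d - c) = \<zero>\<^bsub>X\<^esub>"
        unfolding \<Psi>_diff[OF d(1) c] d(2) by (rule cancel(2)[OF closed[OF c] closed[OF c]])
      then have "d - c \<in> K" by (rule zero_K[OF carrier_diff[OF d(1) c]])
      then show "d \<in> K #>\<^bsub>F\<^esub> c" unfolding r_coset_def by (force intro: bexI[of _ "d - c"])
    qed
  qed
  have surj: "\<exists>c\<in>carrier F. \<Psi> c = x" if x: "x \<in> carrier X" for x
  proof -
    obtain r where r: "r \<in> J \<rightarrow> carrier M" "x = finsum X (\<lambda>b. \<beta> (r b) (e b)) J"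
      using X_span[OF x] by blast
    show ?thesis using \<Psi>_sum[OF finite_J order.refl r(1)] unfolding r(2)[symmetric] by blast
  qed
  have \<theta>_carrier: "\<theta> x \<in> rcosets\<^bsub>F\<^esub> K" if x: "x \<in> carrier X" for x
    using surj[OF x] coset unfolding RCOSETS_def by blast
  have \<theta>_add: "\<theta> (x \<oplus>\<^bsub>X\<^esub> y) = \<theta> x <#>\<^bsub>F\<^esub> \<theta> y" if x: "x \<in> carrier X" and y: "y \<in> carrier X" for x y
  proof
    show "\<theta> x <#>\<^bsub>F\<^esub> \<theta> y \<subseteq> \<theta> (x \<oplus>\<^bsub>X\<^esub> y)"
    proof
      fix c assume "c \<in> \<theta> x <#>\<^bsub>F\<^esub> \<theta> y"
      then obtain a b where "a \<in> \<theta> x" "b \<in> \<theta> y" "c = a + b" unfolding set_mult_def by auto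
      then show "c \<in> \<theta> (x \<oplus>\<^bsub>X\<^esub> y)"
        unfolding \<theta>_def using add[of a b] carrier_add[of a b]
        by (simp del: carrier_free_Abelian_group_iff)
    qed
    show "\<theta> (x \<oplus>\<^bsub>X\<^esub> y) \<subseteq> \<theta> x <#>\<^bsub>F\<^esub> \<theta> y"
    proof
      fix c assume "c \<in> \<theta> (x \<oplus>\<^bsub>X\<^esub> y)"
      then have c: "c \<in> carrier F" "\<Psi> c = x \<oplus>\<^bsub>X\<^esub> y" unfolding \<theta>_def by blast+
      \<comment> \<open>Any preimage \<open>d\<close> of \<open>y\<close> splits \<open>c\<close> as
        (c - d) + d, with one summand in each fibre.\<close>
      obtain d where d: "d \<in> carrier F" "\<Psi> d = y" using surj[OF y] by blast
      have "\<Psi> (c - d) = x"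
        unfolding \<Psi>_diff[OF c(1) d(1)] c d using x y by (simp add: X.minus_eq X.a_assoc X.r_neg)
      then have "c - d \<in> \<theta> x" "d \<in> \<theta> y" using carrier_diff[OF c(1) d(1)] d unfolding \<theta>_def by blast+
      then show "c \<in> \<theta> x <#>\<^bsub>F\<^esub> \<theta> y" unfolding set_mult_def by force
    qed
  qed
  have \<Psi>_act: "frag_extend (\<lambda>p. frag_of (act s p)) c \<in> carrier F \<and>
      \<Psi> (frag_extend (\<lambda>p. frag_of (act s p)) c) = s \<odot>\<^bsub>X\<^esub> \<Psi> c"
    if s: "s \<in> carrier C" and c: "c \<in> carrier F" for s c
  proof -
    have s0: "s \<odot>\<^bsub>X\<^esub> \<zero>\<^bsub>X\<^esub> = \<zero>\<^bsub>X\<^esub>"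
      using X_smult_add[OF s, of "\<zero>\<^bsub>X\<^esub>" "\<zero>\<^bsub>X\<^esub>"] X_smult[OF s, of "\<zero>\<^bsub>X\<^esub>"] by (simp add: X.add.r_cancel_one')
    have s_minus: "s \<odot>\<^bsub>X\<^esub> (x \<ominus>\<^bsub>X\<^esub> y) = s \<odot>\<^bsub>X\<^esub> x \<ominus>\<^bsub>X\<^esub> s \<odot>\<^bsub>X\<^esub> y" if "x \<in> carrier X" "y \<in> carrier X" for x y
    proof -
      have "s \<odot>\<^bsub>X\<^esub> (\<ominus>\<^bsub>X\<^esub> y) \<oplus>\<^bsub>X\<^esub> s \<odot>\<^bsub>X\<^esub> y = \<zero>\<^bsub>X\<^esub>"
        using X_smult_add[OF s, of "\<ominus>\<^bsub>X\<^esub> y" y] that by (simp add: X.l_neg s0)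
      then have "s \<odot>\<^bsub>X\<^esub> (\<ominus>\<^bsub>X\<^esub> y) = \<ominus>\<^bsub>X\<^esub> (s \<odot>\<^bsub>X\<^esub> y)"
        using that X_smult[OF s] by (simp add: X.minus_equality)
      then show ?thesis using that by (simp add: X.minus_eq X_smult_add[OF s])
    qed
    have "Poly_Mapping.keys c \<subseteq> carrier M \<times> carrier N" using c by simp
    then have "frag_extend (\<lambda>p. frag_of (act s p)) c \<in> carrier F \<and> c \<in> carrier F \<and>
      \<Psi> (frag_extend (\<lambda>p. frag_of (act s p)) c) = s \<odot>\<^bsub>X\<^esub> \<Psi> c"
    proof (induction c rule: frag_induction)
      case zero then show ?case by (simp add: \<Psi>_0 s0 del: carrier_free_Abelian_group_iff) (simp add: carrier_free_Abelian_group_iff)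
    next
      case (one p)
      then obtain m n where mn: "p = (m, n)" "m \<in> carrier M" "n \<in> carrier N" by auto
      then show ?case using act[OF s mn(2,3)] \<beta>_act[OF s mn(2,3)] by (simp add: \<Psi>_of)
    next
      case (diff c d)
      then show ?case
        by (simp add: frag_extend_diff carrier_diff \<Psi>_diff[of c d] \<Psi>_diff[of "frag_extend (\<lambda>p. frag_of (act s p)) c"] s_minus closed del: carrier_free_Abelian_group_iff)
    qed
    then show ?thesis by blast
  qed
  have \<theta>_smult: "\<theta> (s \<odot>\<^bsub>X\<^esub> x) = (\<Union>c\<in>\<theta> x. K #>\<^bsub>F\<^esub> frag_extend (\<lambda>p. frag_of (act s p)) c)"
    if s: "s \<in> carrier C" and x: "x \<in> carrier X" for s x
  proof -
    \<comment> \<open>All cosets in the union coincide, and the fibre indexing it is nonempty, so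
      the union is that coset.\<close>
    have "K #>\<^bsub>F\<^esub> frag_extend (\<lambda>p. frag_of (act s p)) c = \<theta> (s \<odot>\<^bsub>X\<^esub> x)" if "c \<in> \<theta> x" for c
      using that \<Psi>_act[OF s, of c] coset unfolding \<theta>_def by auto
    moreover have "\<theta> x \<noteq> {}" using surj[OF x] unfolding \<theta>_def by blast
    ultimately show ?thesis by auto
  qed
  have "\<theta> \<in> module_hom C X (tensor_module A M N act)"
    unfolding module_hom_def tensor_module_def tensor_group_def FactGroup_def
    by (auto simp: \<theta>_carrier \<theta>_add \<theta>_smult)
  moreover have "bij_betw \<theta> (carrier X) (carrier (tensor_module A M N act))"
    unfolding bij_betw_def
  proof
    show "inj_on \<theta> (carrier X)"
    proof (rule inj_onI)
      fix x y assume "x \<in> carrier X" "\<theta> x = \<theta> y"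
      then show "x = y" using surj[of x] unfolding \<theta>_def by blast
    qed
    have "rcosets\<^bsub>F\<^esub> K \<subseteq> \<theta> ` carrier X"
      unfolding RCOSETS_def using coset closed by auto
    then show "\<theta> ` carrier X = carrier (tensor_module A M N act)"
      using \<theta>_carrier by (auto simp: tensor_module_def tensor_group_def FactGroup_def)
  qed
  ultimately show ?thesis unfolding module_isomorphic_def by blast
qed

end

section \<open>Dimensions\<close>

text \<open>Bases are constructed in vector spaces on types, whereas \<open>real_dim\<close> refers
  to a module record. A bijection linear on \<open>U\<close> transports both the module axioms and
  the basis to the record.\<close>

lemma vectorspace_dim_transport:
  fixes V :: "('a::field, 'v) module" and scale :: "'a \<Rightarrow> 'b::ab_group_add \<Rightarrow> 'b"
  assumes scale: "vector_space scale"
    and U: "Modules.module.subspace scale U"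
    and E: "finite E" "E \<subseteq> U" "\<not> Modules.module.dependent scale E" "U \<subseteq> Modules.module.span scale E"
    and T: "bij_betw T U (carrier V)"
    and T_0: "T 0 = \<zero>\<^bsub>V\<^esub>"
    and T_add: "\<And>x y. x \<in> U \<Longrightarrow> y \<in> U \<Longrightarrow> T (x + y) = T x \<oplus>\<^bsub>V\<^esub> T y"
    and T_scale: "\<And>a x. x \<in> U \<Longrightarrow> T (scale a x) = a \<odot>\<^bsub>V\<^esub> T x"
  shows "vectorspace.dim (class_ring :: 'a ring) V = card E"
proof -
  interpret vs: vector_space scale by (rule scale)
  have V: "carrier V = T ` U" using T by (simp add: bij_betw_def)
  have inj: "inj_on T U" using T by (simp add: bij_betw_def)
  note U_closed = vs.subspace_0[OF U] vs.subspace_add[OF U] vs.subspace_scale[OF U] vs.subspace_neg[OF U]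
  have "module (class_ring :: 'a ring) V"
  proof (rule module_criteria)
    show "cring (class_ring :: 'a ring)" by unfold_locales
    show "\<forall>v\<in>carrier V. \<exists>w\<in>carrier V. v \<oplus>\<^bsub>V\<^esub> w = \<zero>\<^bsub>V\<^esub>"
    proof
      fix v assume "v \<in> carrier V"
      then obtain u where "u \<in> U" "v = T u" using V by auto
      then show "\<exists>w\<in>carrier V. v \<oplus>\<^bsub>V\<^esub> w = \<zero>\<^bsub>V\<^esub>"
        using U_closed by (intro bexI[of _ "T (- u)"]) (auto simp: V T_add[symmetric] T_0[symmetric])
    qed
  qed (auto simp: V T_add[symmetric] T_scale[symmetric] T_0[symmetric] U_closed
      vs.scale_left_distrib vs.scale_right_distrib add_ac)
  then interpret V: vectorspace "class_ring :: 'a ring" V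
    by (simp add: vectorspace_def class_field)
  have comb: "(\<Sum>x\<in>E'. scale (a (T x)) x) \<in> U \<and>
      V.lincomb a (T ` E') = T (\<Sum>x\<in>E'. scale (a (T x)) x)" if "E' \<subseteq> E" for a E'
  proof -
    have "finite E'" using that E(1) by (rule finite_subset)
    then show ?thesis using that
    proof (induction E' rule: finite_induct)
      case empty then show ?case by (simp add: V.lincomb_def U_closed T_0)
    next
      case (insert x E')
      have x: "x \<in> U" using insert.prems E(2) by auto
      have E'U: "E' \<subseteq> U" using insert.prems E(2) by auto
      have "T x \<notin> T ` E'" using inj_on_image_mem_iff[OF inj x E'U] insert.hyps(2) by simp
      moreover have "(\<lambda>v. a v \<odot>\<^bsub>V\<^esub> v) \<in> T ` E' \<rightarrow> carrier V" "a (T x) \<odot>\<^bsub>V\<^esub> T x \<in> carrier V"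
        using E'U x by (auto simp: V T_scale[symmetric] U_closed)
      ultimately have "V.lincomb a (T ` insert x E') = a (T x) \<odot>\<^bsub>V\<^esub> T x \<oplus>\<^bsub>V\<^esub> V.lincomb a (T ` E')"
        unfolding V.lincomb_def using insert.hyps(1) by simp
      then show ?case using insert x by (simp add: T_add T_scale U_closed)
    qed
  qed
  have "V.basis (T ` E)"
    unfolding V.basis_def
  proof (intro conjI)
    show TE: "T ` E \<subseteq> carrier V" using E(2) V by auto
    show "V.lin_indpt (T ` E)"
      unfolding V.lin_dep_def
    proof clarify
      fix A a v assume A: "A \<subseteq> T ` E" "V.lincomb a A = \<zero>\<^bsub>V\<^esub>" "v \<in> A" "a v \<noteq> \<zero>\<^bsub>class_ring\<^esub>"
      define E' where "E' = {x \<in> E. T x \<in> A}"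
      have AE': "A = T ` E'" "E' \<subseteq> E" using A(1) by (auto simp: E'_def)
      have "T (\<Sum>x\<in>E'. scale (a (T x)) x) = T 0" using comb[OF AE'(2), of a] A(2) AE'(1) T_0 by simp
      then have "(\<Sum>x\<in>E'. scale (a (T x)) x) = 0"
        using comb[OF AE'(2), of a] inj_onD[OF inj] U_closed(1) by blast
      moreover obtain x where x: "x \<in> E'" "v = T x" using A(3) AE' by auto
      ultimately have "a (T x) = 0"
        using vs.independentD[OF E(3) finite_subset[OF AE'(2) E(1)] AE'(2), of "\<lambda>x. a (T x)"] by blast
      then show False using A(4) x by simp
    qed
    show "V.gen_set (T ` E)"
    proof
      show "V.span (T ` E) \<subseteq> carrier V" by (rule V.span_is_subset2[OF TE])
      show "carrier V \<subseteq> V.span (T ` E)"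
      proof
        fix y assume "y \<in> carrier V"
        then obtain u where u: "u \<in> U" "y = T u" using V by auto
        then obtain c where c: "u = (\<Sum>x\<in>E. scale (c x) x)"
          using E(4) vs.span_finite[OF E(1)] by auto
        define a where "a v = c (the_inv_into U T v)" for v
        have "(\<Sum>x\<in>E. scale (a (T x)) x) = u"
          unfolding c using E(2) by (intro sum.cong) (auto simp: a_def the_inv_into_f_f[OF inj])
        then have "y = V.lincomb a (T ` E)" using comb[of E a] u by simp
        then show "y \<in> V.span (T ` E)" unfolding V.span_def
          using E(1) by auto
      qed
    qed
  qed
  then have "V.dim = card (T ` E)" using E(1) by (intro V.dim_basis) auto
  also have "\<dots> = card E" by (rule card_image) (rule inj_on_subset[OF inj E(2)])
  finally show ?thesis .
qed

lemma (in vector_space) family_independent: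
  assumes "finite I" and indep: "\<And>c. (\<Sum>i\<in>I. scale (c i) (e i)) = 0 \<Longrightarrow> \<forall>i\<in>I. c i = 0"
  shows "inj_on e I" "independent (e ` I)"
proof -
  show inj: "inj_on e I"
  proof (rule inj_onI, rule ccontr)
    fix i j assume ij: "i \<in> I" "j \<in> I" "e i = e j" "i \<noteq> j"
    \<comment> \<open>A repeated member would be cancelled against itself by the coefficients 1 and
      -1.\<close>
    define c where "c k = (if k = i then 1 else if k = j then -1 else 0 :: 'a)" for k
    have "(\<Sum>k\<in>I. scale (c k) (e k)) = (\<Sum>k\<in>{i, j}. scale (c k) (e k))"
      using \<open>finite I\<close> ij by (intro sum.mono_neutral_right) (auto simp: c_def)
    also have "\<dots> = 0" using ij by (simp add: c_def)
    finally have "c i = 0" using indep ij by blast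
    then show False by (simp add: c_def)
  qed
  show "independent (e ` I)"
  proof
    assume "dependent (e ` I)"
    then obtain u where u: "\<exists>v\<in>e ` I. u v \<noteq> 0" "(\<Sum>v\<in>e ` I. scale (u v) v) = 0"
      using dependent_finite[of "e ` I"] \<open>finite I\<close> by auto
    then have "(\<Sum>i\<in>I. scale (u (e i)) (e i)) = 0" by (simp add: sum.reindex[OF inj])
    then have "\<forall>i\<in>I. u (e i) = 0" using indep[of "\<lambda>i. u (e i)"] by blast
    then show False using u(1) by blast
  qed
qed

definition fscale :: "real \<Rightarrow> ('a \<Rightarrow> poly3) \<Rightarrow> 'a \<Rightarrow> poly3" where
  "fscale c F = (\<lambda>x. Const c * F x)"

interpretation fv: vector_space fscale
  by unfold_locales (auto simp: fscale_def fun_eq_iff distrib_left distrib_right Const.hom_add Const.hom_mult mult.assoc)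

declare fv.scale_scale [simp del]

lemma sum_fun_apply: "(\<Sum>i\<in>I. F i) x = (\<Sum>i\<in>I. F i x)"
  by (induction I rule: infinite_finite_induct) auto

lemma finite_monomials: "finite {m :: 'v::finite \<Rightarrow>\<^sub>0 nat. mdeg m = d}"
proof (rule finite_imageD)
  have "Poly_Mapping.lookup m i \<le> mdeg m" for m :: "'v \<Rightarrow>\<^sub>0 nat" and i
    unfolding mdeg_def by (rule member_le_sum) auto
  then have "Poly_Mapping.lookup ` {m :: 'v \<Rightarrow>\<^sub>0 nat. mdeg m = d} \<subseteq> Pi\<^sub>E UNIV (\<lambda>_. {..d})" by auto
  moreover have "finite (Pi\<^sub>E (UNIV :: 'v set) (\<lambda>_. {..d}))" by (intro finite_PiE) auto
  ultimately show "finite (Poly_Mapping.lookup ` {m :: 'v \<Rightarrow>\<^sub>0 nat. mdeg m = d})" by (rule finite_subset)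
  show "inj_on Poly_Mapping.lookup {m :: 'v \<Rightarrow>\<^sub>0 nat. mdeg m = d}" by (rule inj_onI) simp
qed

text \<open>Tuples are total functions that vanish off \<open>D\<close>, so they form a subspace of
  a function type. The tuples in the spline modules are extensional instead and take the value
  \<open>undefined\<close> there.\<close>

definition forms_on :: "'a set \<Rightarrow> nat \<Rightarrow> ('a \<Rightarrow> poly3) set" where
  "forms_on D d = {F. (\<forall>x. x \<notin> D \<longrightarrow> F x = 0) \<and> (\<forall>x. form d (F x))}"

lemma forms_on_span:
  assumes "finite D"
  shows "forms_on D d \<subseteq> fv.span ((\<lambda>(x, m) y. if y = x then mon m else 0) ` (D \<times> {m. mdeg m = d}))"
proof
  fix F :: "'a \<Rightarrow> poly3" assume F: "F \<in> forms_on D d"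
  let ?e = "\<lambda>(x :: 'a, m) y. if y = x then mon m else (0 :: poly3)"
  have "F = (\<Sum>x\<in>D. \<Sum>m\<in>Poly_Mapping.keys (F x). fscale (Poly_Mapping.lookup (F x) m) (?e (x, m)))"
  proof
    fix y
    have "(\<Sum>x\<in>D. \<Sum>m\<in>Poly_Mapping.keys (F x). fscale (Poly_Mapping.lookup (F x) m) (?e (x, m))) y =
      (\<Sum>x\<in>D. if x = y then F y else 0)"
      unfolding sum_fun_apply
    proof (rule sum.cong[OF refl])
      fix x
      have "F y = (\<Sum>m\<in>Poly_Mapping.keys (F y). Const (Poly_Mapping.lookup (F y) m) * mon m)"
        unfolding Const_def single_eq_mon[symmetric] by (rule mpoly_expand)
      from this[symmetric]
      show "(\<Sum>m\<in>Poly_Mapping.keys (F x). fscale (Poly_Mapping.lookup (F x) m) (?e (x, m)) y) = (if x = y then F y else 0)"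
        by (cases "x = y") (simp_all add: fscale_def)
    qed
    also have "\<dots> = F y" using F assms by (auto simp: forms_on_def)
    finally show "F y = (\<Sum>x\<in>D. \<Sum>m\<in>Poly_Mapping.keys (F x). fscale (Poly_Mapping.lookup (F x) m) (?e (x, m))) y" by simp
  qed
  also have "\<dots> \<in> fv.span (?e ` (D \<times> {m. mdeg m = d}))"
    using F by (intro fv.span_sum fv.span_scale fv.span_base) (auto simp: forms_on_def form_def intro!: rev_image_eqI)
  finally show "F \<in> fv.span (?e ` (D \<times> {m. mdeg m = d}))" .
qed

lemma forms_on_basis:
  assumes "finite D" "W \<subseteq> forms_on D d"
  obtains E where "finite E" "E \<subseteq> W" "fv.independent E" "W \<subseteq> fv.span E" "card E = fv.dim W"
proof -
  obtain E where E: "E \<subseteq> W" "fv.independent E" "W \<subseteq> fv.span E" "card E = fv.dim W"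
    by (rule fv.basis_exists)
  have "E \<subseteq> fv.span ((\<lambda>(x, m) y. if y = x then mon m else 0) ` (D \<times> {m. mdeg m = d}))"
    using forms_on_span[OF assms(1)] E(1) assms(2) by blast
  then have "finite E"
    using assms(1) finite_monomials by (intro conjunct1[OF fv.independent_span_bound[OF _ E(2)]]) auto
  from that[OF this E] show ?thesis .
qed

lemma finite_weighted_pairs:
  fixes n d :: nat
  assumes "0 < n" shows "finite {(i, j). n * i + j = d}"
proof (rule finite_subset)
  show "{(i, j). n * i + j = d} \<subseteq> {..d} \<times> {..d}"
  proof clarify
    fix i j
    have "1 * i \<le> n * i" using assms by (intro mult_le_mono1) simp
    then have "i \<le> n * i + j" by linarith
    then show "i \<in> {..n * i + j} \<and> j \<in> {..n * i + j}" by simp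
  qed
qed auto

text \<open>\<open>V\<close> is the direct sum over \<open>b\<close> of the pullbacks of
  \<open>W i\<close> times \<open>b\<close>, with n * i + mdeg b = d, so the products of pulled back
  basis elements of \<open>W i\<close> with \<open>b\<close> form a basis. Grouping the
  \<open>b\<close> by degree gives the convolution. \<open>W\<close> is kept general so that the
  count applies to splines and to S itself.\<close>

lemma (in net_with_basis) dim_comb:
  fixes W :: "nat \<Rightarrow> ('a \<Rightarrow> poly3) set" and d :: nat
  assumes "finite D" and sub: "\<And>i. fv.subspace (W i)" and bound: "\<And>i. W i \<subseteq> forms_on D i"
  defines "V \<equiv> {\<lambda>x. comb (\<lambda>b. r b x) | r. \<forall>b\<in>B. (\<exists>i. n * i + mdeg b = d \<and> r b \<in> W i) \<or>
      ((\<forall>i. n * i + mdeg b \<noteq> d) \<and> r b = 0)}"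
  shows "fv.dim V = (\<Sum>(i, j)\<in>{(i, j). n * i + j = d}. fv.dim (W i) * card {b \<in> B. mdeg b = j})"
proof -
  have "\<forall>i. \<exists>E. finite E \<and> E \<subseteq> W i \<and> fv.independent E \<and> W i \<subseteq> fv.span E \<and> card E = fv.dim (W i)"
    by (rule allI, rule forms_on_basis[OF \<open>finite D\<close> bound]) (intro exI conjI)
  from choice[OF this] obtain A where A': "\<forall>i. finite (A i) \<and> A i \<subseteq> W i \<and> fv.independent (A i) \<and>
      W i \<subseteq> fv.span (A i) \<and> card (A i) = fv.dim (W i)" ..
  have A: "finite (A i)" "A i \<subseteq> W i" "fv.independent (A i)" "W i \<subseteq> fv.span (A i)"
    "card (A i) = fv.dim (W i)" for i
    using A' by iprover+
  define idx where "idx b = (d - mdeg b) div n" for b :: "3 \<Rightarrow>\<^sub>0 nat"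
  have idx: "i = idx b" if "n * i + mdeg b = d" for i b
    using that n_pos by (auto simp: idx_def)
  \<comment> \<open>The basis elements that contribute in degree \<open>d\<close>. Only for these
    does the truncated quotient \<open>idx b\<close> have the intended meaning.\<close>
  define Bd where "Bd = {b \<in> B. n * idx b + mdeg b = d}"
  have finBd: "finite Bd" using finite_B by (simp add: Bd_def)
  define I where "I = (SIGMA b:Bd. A (idx b))"
  have finI: "finite I" unfolding I_def using finBd A(1) by auto
  define e where "e = (\<lambda>(b, a :: 'a \<Rightarrow> poly3). \<lambda>x. \<phi> (a x) * mon b)"
  \<comment> \<open>Coordinates of the combination with coefficients \<open>c\<close>; the value 0
    outside \<open>Bd\<close> matches the second alternative in \<open>V\<close>.\<close>
  define R where "R c b = (if b \<in> Bd then (\<Sum>a\<in>A (idx b). fscale (c (b, a)) a) else 0)" for c b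
  have R_W: "R c b \<in> W (idx b)" if "b \<in> Bd" for c b
    using that A(2) by (auto simp: R_def intro!: fv.subspace_sum[OF sub] fv.subspace_scale[OF sub])
  have sum_e: "(\<Sum>i\<in>I. fscale (c i) (e i)) = (\<lambda>x. comb (\<lambda>b. R c b x))" for c
  proof
    fix x
    have "(\<Sum>i\<in>I. fscale (c i) (e i)) x = (\<Sum>b\<in>Bd. \<Sum>a\<in>A (idx b). Const (c (b, a)) * (\<phi> (a x) * mon b))"
      unfolding I_def sum_fun_apply by (subst sum.Sigma[OF finBd]) (auto simp: A(1) e_def fscale_def intro!: sum.cong)
    also have "\<dots> = (\<Sum>b\<in>Bd. \<phi> (R c b x) * mon b)"
      by (intro sum.cong refl)
        (simp add: R_def sum_fun_apply fscale_def \<phi>.hom_sum \<phi>.hom_mult sum_distrib_right mult.assoc)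
    also have "\<dots> = comb (\<lambda>b. R c b x)"
      unfolding comb_def using finite_B by (intro sum.mono_neutral_left) (auto simp: Bd_def R_def)
    finally show "(\<Sum>i\<in>I. fscale (c i) (e i)) x = comb (\<lambda>b. R c b x)" .
  qed
  have indep: "\<forall>i\<in>I. c i = 0" if "(\<Sum>i\<in>I. fscale (c i) (e i)) = 0" for c
  proof (clarsimp simp: I_def)
    fix b a assume ba: "b \<in> Bd" "a \<in> A (idx b)"
    have "comb (\<lambda>b. R c b x) = 0" for x using fun_cong[OF that, of x] unfolding sum_e by simp
    then have "R c b x = 0" for x using comb_eq_0 ba by (auto simp: Bd_def)
    then have "(\<Sum>a\<in>A (idx b). fscale (c (b, a)) a) = 0" using ba by (auto simp: R_def fun_eq_iff)
    from fv.independentD[OF A(3) A(1) order.refl this ba(2)] show "c (b, a) = 0" .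
  qed
  have fam: "inj_on e I" "fv.independent (e ` I)"
    by (rule fv.family_independent[OF finI], erule indep)+
  have "fv.span (e ` I) = V"
  proof
    show "fv.span (e ` I) \<subseteq> V"
    proof
      fix F assume "F \<in> fv.span (e ` I)"
      then obtain u where "F = (\<Sum>v\<in>e ` I. fscale (u v) v)"
        using fv.span_finite[of "e ` I"] finI by auto
      then have "F = (\<lambda>x. comb (\<lambda>b. R (u \<circ> e) b x))"
        unfolding sum_e[symmetric] by (simp add: sum.reindex[OF fam(1)])
      moreover have "(\<exists>i. n * i + mdeg b = d \<and> R (u \<circ> e) b \<in> W i) \<or>
          ((\<forall>i. n * i + mdeg b \<noteq> d) \<and> R (u \<circ> e) b = 0)" if "b \<in> B" for b
      proof (cases "b \<in> Bd")
        case True then show ?thesis using R_W by (auto simp: Bd_def)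
      next
        case False then show ?thesis using that idx by (auto simp: Bd_def R_def)
      qed
      ultimately show "F \<in> V" unfolding V_def by blast
    qed
    show "V \<subseteq> fv.span (e ` I)"
    proof
      fix F assume "F \<in> V"
      then obtain r where F: "F = (\<lambda>x. comb (\<lambda>b. r b x))" and r: "\<And>b. b \<in> B \<Longrightarrow>
          (\<exists>i. n * i + mdeg b = d \<and> r b \<in> W i) \<or> ((\<forall>i. n * i + mdeg b \<noteq> d) \<and> r b = 0)"
        unfolding V_def by blast
      have "\<exists>u. r b = (\<Sum>a\<in>A (idx b). fscale (u a) a)" if "b \<in> Bd" for b
      proof -
        have "r b \<in> W (idx b)" using r[of b] that idx by (auto simp: Bd_def)
        then have "r b \<in> fv.span (A (idx b))" using A(4) by blast
        then show ?thesis using fv.span_finite[OF A(1)] by auto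
      qed
      then have "\<forall>b\<in>Bd. \<exists>u. r b = (\<Sum>a\<in>A (idx b). fscale (u a) a)" by (intro ballI)
      from bchoice[OF this] obtain u where u: "\<forall>b\<in>Bd. r b = (\<Sum>a\<in>A (idx b). fscale (u b a) a)" ..
      have "r b = R (\<lambda>(b, a). u b a) b" if "b \<in> B" for b
      proof (cases "b \<in> Bd")
        case True
        then show ?thesis using u by (simp add: R_def)
      next
        case False
        then have "r b = 0" using r[OF that] idx[of _ b] that unfolding Bd_def by blast
        then show ?thesis using False by (simp add: R_def)
      qed
      then have "comb (\<lambda>b. r b x) = comb (\<lambda>b. R (\<lambda>(b, a). u b a) b x)" for x
        unfolding comb_eq_iff by simp
      then have "F = (\<lambda>x. comb (\<lambda>b. R (\<lambda>(b, a). u b a) b x))"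
        unfolding F by (rule ext)
      also have "\<dots> = (\<Sum>i\<in>I. fscale (case i of (b, a) \<Rightarrow> u b a) (e i))" unfolding sum_e ..
      also have "\<dots> \<in> fv.span (e ` I)" by (intro fv.span_sum fv.span_scale fv.span_base) auto
      finally show "F \<in> fv.span (e ` I)" .
    qed
  qed
  then have "fv.span (e ` I) = fv.span V" by (metis fv.span_span)
  from fv.dim_eq_card[OF this fam(2)] have "fv.dim V = card (e ` I)" .
  also have "\<dots> = card I" by (rule card_image[OF fam(1)])
  also have "\<dots> = (\<Sum>b\<in>Bd. fv.dim (W (idx b)))"
    unfolding I_def using finBd A(1,5) by (simp add: card_SigmaI)
  \<comment> \<open>Each contributing \<open>b\<close> determines the single degree pair
    \<open>(idx b, mdeg b)\<close>.\<close>
  also have "\<dots> = (\<Sum>(p, b)\<in>(SIGMA p:{(i, j). n * i + j = d}. {b \<in> B. mdeg b = snd p}). fv.dim (W (fst p)))"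
    by (rule sum.reindex_bij_witness[where i = snd and j = "\<lambda>b. ((idx b, mdeg b), b)"])
      (use n_pos in \<open>auto simp: Bd_def idx_def\<close>)
  also have "\<dots> = (\<Sum>p\<in>{(i, j). n * i + j = d}. \<Sum>b\<in>{b \<in> B. mdeg b = snd p}. fv.dim (W (fst p)))"
    using finite_weighted_pairs[OF n_pos] finite_B by (intro sum.Sigma[symmetric]) auto
  also have "\<dots> = (\<Sum>(i, j)\<in>{(i, j). n * i + j = d}. fv.dim (W i) * card {b \<in> B. mdeg b = j})"
    by (intro sum.cong) (auto simp: mult.commute)
  finally show ?thesis .
qed

section \<open>Modules of differences\<close>

text \<open>Connects the ideals of ring records, in which the modules are defined, with the
  submodules used for all computations.\<close>

lemma ideal_iff_subspace: "ideal I (class_ring :: 'a::comm_ring_1 ring) \<longleftrightarrow> ri.subspace I"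
proof
  assume "ideal I (class_ring :: 'a ring)"
  then interpret ideal I "class_ring :: 'a ring" .
  show "ri.subspace I"
    using zero_closed a_closed I_l_closed by (intro ri.subspaceI) auto
next
  assume I: "ri.subspace I"
  show "ideal I (class_ring :: 'a ring)"
  proof (rule idealI)
    show "ring (class_ring :: 'a ring)" by unfold_locales
    have "ring (class_ring :: 'a ring)" by unfold_locales
    then have group: "Group.group (add_monoid (class_ring :: 'a ring))"
      by (intro abelian_group.a_group ring.is_abelian_group)
    show "subgroup I (add_monoid (class_ring :: 'a ring))"
    proof (rule group.subgroupI[OF group])
      show "I \<noteq> {}" using ri.subspace_0[OF I] by blast
      fix a b assume "a \<in> I" "b \<in> I"
      then show "a \<otimes>\<^bsub>add_monoid (class_ring :: 'a ring)\<^esub> b \<in> I" using ri.subspace_add[OF I] by simp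
      have "inv\<^bsub>add_monoid (class_ring :: 'a ring)\<^esub> a = - a"
        by (rule group.inv_equality[OF group]) simp_all
      then show "inv\<^bsub>add_monoid (class_ring :: 'a ring)\<^esub> a \<in> I"
        using ri.subspace_neg[OF I \<open>a \<in> I\<close>] by (simp only:)
    qed simp
    fix a x assume "a \<in> I"
    then show "x \<otimes>\<^bsub>(class_ring :: 'a ring)\<^esub> a \<in> I" "a \<otimes>\<^bsub>(class_ring :: 'a ring)\<^esub> x \<in> I"
      using ri.subspace_scale[OF I, of a x] by (simp_all add: mult.commute)
  qed
qed

lemma genideal_eq_span: "Idl\<^bsub>(class_ring :: 'a::comm_ring_1 ring)\<^esub> S = ri.span S"
proof
  have "ideal (ri.span S) (class_ring :: 'a ring)" by (simp only: ideal_iff_subspace ri.subspace_span)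
  then show "Idl\<^bsub>(class_ring :: 'a ring)\<^esub> S \<subseteq> ri.span S"
    using ri.span_superset[of S] unfolding genideal_def by blast
  show "ri.span S \<subseteq> Idl\<^bsub>(class_ring :: 'a ring)\<^esub> S"
    unfolding genideal_def ideal_iff_subspace using ri.span_minimal[of S] by blast
qed

lemma in_genideal_singleton: "p \<in> Idl\<^bsub>PR\<^esub> {a} \<longleftrightarrow> a dvd p"
  unfolding genideal_eq_span ri.span_singleton by (auto simp: mult.commute elim!: dvdE)

text \<open>The membership condition of \<open>difference_kernel\<close>, separated from its
  carrier. It looks only at values on faces, so it applies equally to extensional tuples and to
  tuples extended by zero.\<close>

definition compatible :: "mesh \<Rightarrow> nat \<Rightarrow> ((real ^ 2) set \<Rightarrow> poly3) \<Rightarrow> ((real ^ 2) set \<Rightarrow> poly3) \<Rightarrow> bool" where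
  "compatible \<Delta> r L F \<longleftrightarrow> (\<forall>\<tau>\<in>interior_edges \<Delta>. \<forall>\<sigma>\<in>Faces \<Delta>. \<forall>\<sigma>'\<in>Faces \<Delta>.
     \<tau> \<in> components (\<sigma> \<inter> \<sigma>') \<longrightarrow> L \<tau> ^ (r + 1) dvd F \<sigma> - F \<sigma>')"

lemma compatibleI:
  "(\<And>\<tau> \<sigma> \<sigma>'. \<tau> \<in> interior_edges \<Delta> \<Longrightarrow> \<sigma> \<in> Faces \<Delta> \<Longrightarrow> \<sigma>' \<in> Faces \<Delta> \<Longrightarrow> \<tau> \<in> components (\<sigma> \<inter> \<sigma>') \<Longrightarrow>
     L \<tau> ^ (r + 1) dvd F \<sigma> - F \<sigma>') \<Longrightarrow> compatible \<Delta> r L F"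
  unfolding compatible_def by blast

lemma compatibleD:
  "compatible \<Delta> r L F \<Longrightarrow> \<tau> \<in> interior_edges \<Delta> \<Longrightarrow> \<sigma> \<in> Faces \<Delta> \<Longrightarrow> \<sigma>' \<in> Faces \<Delta> \<Longrightarrow>
     \<tau> \<in> components (\<sigma> \<inter> \<sigma>') \<Longrightarrow> L \<tau> ^ (r + 1) dvd F \<sigma> - F \<sigma>'"
  unfolding compatible_def by blast

lemma compatible_cong: "(\<And>\<sigma>. \<sigma> \<in> Faces \<Delta> \<Longrightarrow> F \<sigma> = G \<sigma>) \<Longrightarrow> compatible \<Delta> r L F \<longleftrightarrow> compatible \<Delta> r L G"
  unfolding compatible_def by simp

lemma compatible_0: "compatible \<Delta> r L (\<lambda>_. 0)"
  by (simp add: compatible_def)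

lemma compatible_add:
  assumes "compatible \<Delta> r L F" "compatible \<Delta> r L G"
  shows "compatible \<Delta> r L (\<lambda>\<sigma>. F \<sigma> + G \<sigma>)"
proof (rule compatibleI)
  fix \<tau> \<sigma> \<sigma>' assume "\<tau> \<in> interior_edges \<Delta>" "\<sigma> \<in> Faces \<Delta>" "\<sigma>' \<in> Faces \<Delta>" "\<tau> \<in> components (\<sigma> \<inter> \<sigma>')"
  from dvd_add[OF compatibleD[OF assms(1) this] compatibleD[OF assms(2) this]]
  show "L \<tau> ^ (r + 1) dvd (F \<sigma> + G \<sigma>) - (F \<sigma>' + G \<sigma>')" by (simp add: algebra_simps)
qed

lemma compatible_mult:
  assumes "compatible \<Delta> r L F"
  shows "compatible \<Delta> r L (\<lambda>\<sigma>. p * F \<sigma>)"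
proof (rule compatibleI)
  fix \<tau> \<sigma> \<sigma>' assume "\<tau> \<in> interior_edges \<Delta>" "\<sigma> \<in> Faces \<Delta>" "\<sigma>' \<in> Faces \<Delta>" "\<tau> \<in> components (\<sigma> \<inter> \<sigma>')"
  from dvd_mult[OF compatibleD[OF assms(1) this], of p]
  show "L \<tau> ^ (r + 1) dvd p * F \<sigma> - p * F \<sigma>'" by (simp add: algebra_simps)
qed

lemma compatible_restrict: "compatible \<Delta> r L (restrict F (Faces \<Delta>)) \<longleftrightarrow> compatible \<Delta> r L F"
  by (rule compatible_cong) simp

lemma difference_kernel_simps:
  "carrier (difference_kernel \<Delta> r L) = {F \<in> extensional (Faces \<Delta>). compatible \<Delta> r L F}"
  "F \<oplus>\<^bsub>difference_kernel \<Delta> r L\<^esub> G = (\<lambda>\<sigma>\<in>Faces \<Delta>. F \<sigma> + G \<sigma>)"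
  "\<zero>\<^bsub>difference_kernel \<Delta> r L\<^esub> = (\<lambda>\<sigma>\<in>Faces \<Delta>. 0)"
  "p \<odot>\<^bsub>difference_kernel \<Delta> r L\<^esub> F = (\<lambda>\<sigma>\<in>Faces \<Delta>. p * F \<sigma>)"
  unfolding difference_kernel_def class_ring.func_space_def compatible_def in_genideal_singleton
  by (auto simp: PiE_def)

lemma difference_kernel_smult_closed:
  "F \<in> carrier (difference_kernel \<Delta> r L) \<Longrightarrow> p \<odot>\<^bsub>difference_kernel \<Delta> r L\<^esub> F \<in> carrier (difference_kernel \<Delta> r L)"
  by (simp add: difference_kernel_simps compatible_restrict compatible_mult)

lemma abelian_group_difference_kernel: "abelian_group (difference_kernel \<Delta> r L)"
proof (rule abelian_groupI)
  fix F assume F: "F \<in> carrier (difference_kernel \<Delta> r L)"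
  show "\<exists>G\<in>carrier (difference_kernel \<Delta> r L). G \<oplus>\<^bsub>difference_kernel \<Delta> r L\<^esub> F = \<zero>\<^bsub>difference_kernel \<Delta> r L\<^esub>"
    by (rule bexI[OF _ difference_kernel_smult_closed[OF F, of "-1"]])
      (simp add: difference_kernel_simps fun_eq_iff restrict_def)
  show "\<zero>\<^bsub>difference_kernel \<Delta> r L\<^esub> \<oplus>\<^bsub>difference_kernel \<Delta> r L\<^esub> F = F"
    using F by (auto simp: difference_kernel_simps fun_eq_iff restrict_def extensional_def)
qed (auto simp: difference_kernel_simps fun_eq_iff restrict_def add_ac extensional_def compatible_restrict[unfolded restrict_def] compatible_add compatible_0)

lemma restrict_scalars_simps [simp]:
  "carrier (restrict_scalars \<psi> M) = carrier M"
  "add (restrict_scalars \<psi> M) = add M"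
  "zero (restrict_scalars \<psi> M) = zero M"
  "smult (restrict_scalars \<psi> M) = (\<lambda>a. smult M (\<psi> a))"
  by (simp_all add: restrict_scalars_def)

lemma abelian_group_restrict_scalars: "abelian_group M \<Longrightarrow> abelian_group (restrict_scalars \<psi> M)"
proof -
  assume "abelian_group M"
  then interpret abelian_group M .
  show ?thesis
    by (rule abelian_groupI) (auto simp: a_assoc intro: a_comm a_inv_closed l_neg)
qed

lemma finsum_restrict_scalars:
  assumes "abelian_group M" "finite I" "F \<in> I \<rightarrow> carrier M"
  shows "finsum (restrict_scalars \<psi> M) F I = finsum M F I"
proof -
  interpret M: abelian_group M by fact
  interpret N: abelian_group "restrict_scalars \<psi> M" by (rule abelian_group_restrict_scalars[OF assms(1)])
  show ?thesis
    using assms(2,3)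
  proof (induction I rule: finite_induct)
    case empty show ?case by simp
  next
    case (insert i I)
    then have "F \<in> I \<rightarrow> carrier (restrict_scalars \<psi> M)" "F i \<in> carrier (restrict_scalars \<psi> M)" by auto
    then show ?case
      using insert N.finsum_insert[OF insert.hyps, of F] M.finsum_insert[OF insert.hyps, of F] by simp
  qed
qed

lemma finsum_difference_kernel:
  assumes "finite I" "\<And>i. i \<in> I \<Longrightarrow> F i \<in> carrier (difference_kernel \<Delta> r L)"
  shows "finsum (difference_kernel \<Delta> r L) F I = (\<lambda>\<sigma>\<in>Faces \<Delta>. \<Sum>i\<in>I. F i \<sigma>)"
  using assms
proof (induction I rule: finite_induct)
  interpret abelian_group "difference_kernel \<Delta> r L" by (rule abelian_group_difference_kernel)
  case empty show ?case by (simp add: difference_kernel_simps)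
next
  interpret abelian_group "difference_kernel \<Delta> r L" by (rule abelian_group_difference_kernel)
  case (insert i I)
  then have "F \<in> I \<rightarrow> carrier (difference_kernel \<Delta> r L)" by auto
  with insert show ?case
    by (simp add: finsum_insert) (simp add: difference_kernel_simps restrict_def fun_eq_iff)
qed

definition compatible_forms :: "mesh \<Rightarrow> nat \<Rightarrow> ((real ^ 2) set \<Rightarrow> poly3) \<Rightarrow> nat \<Rightarrow> ((real ^ 2) set \<Rightarrow> poly3) set" where
  "compatible_forms \<Delta> r L d = {F \<in> forms_on (Faces \<Delta>) d. compatible \<Delta> r L F}"

lemma subspace_compatible_forms: "fv.subspace (compatible_forms \<Delta> r L d)"
proof (rule fv.subspaceI)
  show "0 \<in> compatible_forms \<Delta> r L d"
    using compatible_0[of \<Delta> r L] by (simp add: compatible_forms_def forms_on_def zero_fun_def)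
next
  fix F G assume "F \<in> compatible_forms \<Delta> r L d" "G \<in> compatible_forms \<Delta> r L d"
  then show "F + G \<in> compatible_forms \<Delta> r L d"
    using compatible_add[of \<Delta> r L F G] by (simp add: compatible_forms_def forms_on_def plus_fun_def form_add)
next
  fix c F assume "F \<in> compatible_forms \<Delta> r L d"
  then show "fscale c F \<in> compatible_forms \<Delta> r L d"
    using compatible_mult[of \<Delta> r L F "Const c"] by (simp add: compatible_forms_def forms_on_def fscale_def form_Const_mult)
qed

text \<open>Restriction to the faces is a linear bijection from tuples extended by zero to
  extensional tuples, so dimensions can be computed in the function space.\<close>

lemma real_dim_spline_part:
  assumes "finite (Faces \<Delta>)"
  shows "real_dim (difference_kernel \<Delta> r L) (spline_part \<Delta> (difference_kernel \<Delta> r L) d) =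
    fv.dim (compatible_forms \<Delta> r L d)"
proof -
  obtain E where E: "finite E" "E \<subseteq> compatible_forms \<Delta> r L d" "fv.independent E"
    "compatible_forms \<Delta> r L d \<subseteq> fv.span E" "card E = fv.dim (compatible_forms \<Delta> r L d)"
    by (rule forms_on_basis[OF assms, of "compatible_forms \<Delta> r L d" d]) (auto simp: compatible_forms_def)
  define T where "T F = restrict F (Faces \<Delta>)" for F :: "(real ^ 2) set \<Rightarrow> poly3"
  have bij: "bij_betw T (compatible_forms \<Delta> r L d) (spline_part \<Delta> (difference_kernel \<Delta> r L) d)"
    unfolding bij_betw_def
  proof
    show "inj_on T (compatible_forms \<Delta> r L d)"
    proof (rule inj_onI, rule ext)
      fix F G \<sigma> assume FG: "F \<in> compatible_forms \<Delta> r L d" "G \<in> compatible_forms \<Delta> r L d" "T F = T G"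
      show "F \<sigma> = G \<sigma>"
      proof (cases "\<sigma> \<in> Faces \<Delta>")
        case True then show ?thesis using fun_cong[OF FG(3), of \<sigma>] by (simp add: T_def)
      next
        case False then show ?thesis using FG(1,2) by (simp add: compatible_forms_def forms_on_def)
      qed
    qed
    show "T ` compatible_forms \<Delta> r L d = spline_part \<Delta> (difference_kernel \<Delta> r L) d"
    proof
      show "T ` compatible_forms \<Delta> r L d \<subseteq> spline_part \<Delta> (difference_kernel \<Delta> r L) d"
        by (auto simp: T_def compatible_forms_def forms_on_def spline_part_def difference_kernel_simps compatible_restrict)
      show "spline_part \<Delta> (difference_kernel \<Delta> r L) d \<subseteq> T ` compatible_forms \<Delta> r L d"
      proof
        fix F assume F: "F \<in> spline_part \<Delta> (difference_kernel \<Delta> r L) d"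
        define G where "G \<sigma> = (if \<sigma> \<in> Faces \<Delta> then F \<sigma> else 0)" for \<sigma>
        have "compatible \<Delta> r L G \<longleftrightarrow> compatible \<Delta> r L F" by (rule compatible_cong) (simp add: G_def)
        then have "G \<in> compatible_forms \<Delta> r L d"
          using F by (simp add: compatible_forms_def forms_on_def spline_part_def difference_kernel_simps G_def)
        moreover have "F = T G"
          using F by (auto simp: spline_part_def difference_kernel_simps T_def G_def fun_eq_iff extensional_def)
        ultimately show "F \<in> T ` compatible_forms \<Delta> r L d" by blast
      qed
    qed
  qed
  show ?thesis
    unfolding real_dim_def E(5)[symmetric]
    by (rule vectorspace_dim_transport[OF fv.vector_space_axioms subspace_compatible_forms E(1-4), where T = T])
      (use bij in \<open>auto simp: T_def difference_kernel_simps fscale_def fun_eq_iff restrict_def\<close>)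
qed

section \<open>The quotient by the net ideal\<close>

text \<open>For properties closed under addition that are not known to hold at 0, such as membership
  in a set closed under sums.\<close>

lemma sum_induct_nonempty:
  assumes "finite J" "J \<noteq> {}" "\<And>b. b \<in> J \<Longrightarrow> P (t b)" "\<And>x y. P x \<Longrightarrow> P y \<Longrightarrow> P (x + y)"
  shows "P (\<Sum>b\<in>J. t b)"
  using assms(1,2,3) by (induction J rule: finite_ne_induct) (simp_all add: assms(4))

interpretation cv: vector_space "\<lambda>c (p :: 'v mpoly). Const c * p"
  unfolding Const_def by (rule vector_space_mpoly)

declare cv.scale_scale [simp del]

context net_with_basis begin

abbreviation coset :: "poly3 \<Rightarrow> poly3 set" where
  "coset p \<equiv> net_ideal f g h +>\<^bsub>PR\<^esub> p"

lemma net_ideal_eq: "net_ideal f g h = ri.span {f, g, h}"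
  unfolding net_ideal_def by (rule genideal_eq_span)

lemma ideal_net_ideal: "ideal (net_ideal f g h) PR"
  unfolding net_ideal_eq ideal_iff_subspace by (rule ri.subspace_span)

lemma in_coset_iff: "q \<in> coset p \<longleftrightarrow> q - p \<in> ri.span {f, g, h}"
proof
  assume "q \<in> coset p"
  then show "q - p \<in> ri.span {f, g, h}"
    unfolding a_r_coset_def r_coset_def net_ideal_eq by auto
next
  assume "q - p \<in> ri.span {f, g, h}"
  then show "q \<in> coset p"
    unfolding a_r_coset_def r_coset_def net_ideal_eq by (intro UN_I[of "q - p"]) auto
qed

lemma coset_eq_iff: "coset p = coset q \<longleftrightarrow> p - q \<in> ri.span {f, g, h}"
proof
  assume "coset p = coset q"
  then have "p \<in> coset q" using in_coset_iff[of p p] by (simp add: ri.span_zero)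
  then show "p - q \<in> ri.span {f, g, h}" by (simp only: in_coset_iff)
next
  assume pq: "p - q \<in> ri.span {f, g, h}"
  show "coset p = coset q"
  proof (rule Set.set_eqI)
    fix x
    show "x \<in> coset p \<longleftrightarrow> x \<in> coset q"
      unfolding in_coset_iff using ri.span_add[OF _ pq, of "x - p"] ri.span_diff[OF _ pq, of "x - q"] by auto
  qed
qed

lemma net_quotient_simps:
  "carrier (net_quotient f g h) = range coset"
  "coset p \<oplus>\<^bsub>net_quotient f g h\<^esub> coset q = coset (p + q)"
  "\<zero>\<^bsub>net_quotient f g h\<^esub> = coset 0"
  "a \<odot>\<^bsub>net_quotient f g h\<^esub> coset p = coset (a * p)"
proof -
  interpret I: ideal "net_ideal f g h" PR by (rule ideal_net_ideal)
  show "carrier (net_quotient f g h) = range coset"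
    by (auto simp: net_quotient_def regular_module_def FactRing_def A_RCOSETS_def RCOSETS_def a_r_coset_def)
  show "coset p \<oplus>\<^bsub>net_quotient f g h\<^esub> coset q = coset (p + q)"
    using I.a_rcos_sum[of p q] by (simp add: net_quotient_def regular_module_def FactRing_def)
  have "0 \<in> net_ideal f g h" unfolding net_ideal_eq by (rule ri.span_zero)
  then have "coset 0 = net_ideal f g h"
    unfolding a_r_coset_def r_coset_def by auto
  then show "\<zero>\<^bsub>net_quotient f g h\<^esub> = coset 0"
    by (simp add: net_quotient_def regular_module_def FactRing_def)
  show "a \<odot>\<^bsub>net_quotient f g h\<^esub> coset p = coset (a * p)"
    using I.rcoset_mult_add[of a p] by (simp add: net_quotient_def regular_module_def FactRing_def)
qed

lemma B_nonempty: "B \<noteq> {}"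
proof
  assume "B = {}"
  then have "comb r = 0" for r unfolding comb_def by simp
  then show False using comb_surj[of 1] by simp
qed

section \<open>Normal forms modulo the net ideal\<close>

text \<open>Off \<open>B\<close> the chosen coefficients are arbitrary; uniqueness is therefore
  stated for the sum \<open>nf\<close>.\<close>

definition nf_coeff :: "poly3 \<Rightarrow> (3 \<Rightarrow>\<^sub>0 nat) \<Rightarrow> real" where
  "nf_coeff p = (SOME c. p - (\<Sum>b\<in>B. Const (c b) * mon b) \<in> ri.span {f, g, h})"

definition nf :: "poly3 \<Rightarrow> poly3" where
  "nf p = (\<Sum>b\<in>B. Const (nf_coeff p b) * mon b)"

lemma nf_cong: "p - nf p \<in> ri.span {f, g, h}"
  unfolding nf_def nf_coeff_def by (rule someI_ex[OF B_span])

lemma nf_unique: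
  assumes "p - (\<Sum>b\<in>B. Const (c b) * mon b) \<in> ri.span {f, g, h}"
  shows "nf p = (\<Sum>b\<in>B. Const (c b) * mon b)"
proof -
  have "(p - (\<Sum>b\<in>B. Const (c b) * mon b)) - (p - nf p) \<in> ri.span {f, g, h}"
    by (rule ri.span_diff[OF assms nf_cong])
  also have "(p - (\<Sum>b\<in>B. Const (c b) * mon b)) - (p - nf p) = (\<Sum>b\<in>B. Const (nf_coeff p b - c b) * mon b)"
    by (simp add: nf_def Const.hom_minus left_diff_distrib sum_subtractf)
  finally have "nf_coeff p b - c b = 0" if "b \<in> B" for b
    using indep_modD[OF B_indep finite_B order.refl, of "\<lambda>b. nf_coeff p b - c b"] that by blast
  then show ?thesis unfolding nf_def by (intro sum.cong) auto
qed

lemma nf_add: "nf (p + q) = nf p + nf q"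
proof -
  have "(p - nf p) + (q - nf q) \<in> ri.span {f, g, h}" by (intro ri.span_add nf_cong)
  also have "(p - nf p) + (q - nf q) = (p + q) - (\<Sum>b\<in>B. Const (nf_coeff p b + nf_coeff q b) * mon b)"
    by (simp add: nf_def Const.hom_add distrib_right sum.distrib)
  finally have "nf (p + q) = (\<Sum>b\<in>B. Const (nf_coeff p b + nf_coeff q b) * mon b)" by (rule nf_unique)
  also have "\<dots> = nf p + nf q" by (simp add: nf_def Const.hom_add distrib_right sum.distrib)
  finally show ?thesis .
qed

lemma nf_Const_mult: "nf (Const a * p) = Const a * nf p"
proof -
  have *: "Const a * nf p = (\<Sum>b\<in>B. Const (a * nf_coeff p b) * mon b)"
    by (simp add: nf_def Const.hom_mult sum_distrib_left mult.assoc)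
  have "Const a * (p - nf p) \<in> ri.span {f, g, h}" by (intro ri.span_scale nf_cong)
  also have "Const a * (p - nf p) = Const a * p - (\<Sum>b\<in>B. Const (a * nf_coeff p b) * mon b)"
    unfolding right_diff_distrib * ..
  finally show ?thesis unfolding * by (rule nf_unique)
qed

lemma nf_eq: "p - q \<in> ri.span {f, g, h} \<Longrightarrow> nf p = nf q"
proof -
  assume "p - q \<in> ri.span {f, g, h}"
  then have "(p - q) + (q - nf q) \<in> ri.span {f, g, h}" using nf_cong by (rule ri.span_add)
  then have "p - (\<Sum>b\<in>B. Const (nf_coeff q b) * mon b) \<in> ri.span {f, g, h}" by (simp add: nf_def)
  from nf_unique[OF this] show ?thesis by (simp add: nf_def)
qed

lemma nf_mon: "b \<in> B \<Longrightarrow> nf (mon b) = mon b"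
proof -
  assume b: "b \<in> B"
  have *: "(\<Sum>b'\<in>B. Const (if b' = b then 1 else 0) * mon b') = mon b"
  proof -
    have "(\<Sum>b'\<in>B. Const (if b' = b then 1 else 0) * mon b') = (\<Sum>b'\<in>B. if b' = b then mon b else 0)"
      by (intro sum.cong) auto
    then show ?thesis using b finite_B by simp
  qed
  have "mon b - (\<Sum>b'\<in>B. Const (if b' = b then 1 else 0) * mon b') \<in> ri.span {f, g, h}"
    unfolding * by (simp add: ri.span_zero)
  from nf_unique[OF this] show ?thesis unfolding * .
qed

text \<open>A real linear section of the quotient map with values in the span of \<open>B\<close>.
  The representative is arbitrary, but its normal form depends only on the coset.\<close>

definition lift :: "poly3 set \<Rightarrow> poly3" where
  "lift q = nf (SOME p. p \<in> q)"

lemma lift_coset: "lift (coset p) = nf p"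
proof -
  have "(SOME q. q \<in> coset p) \<in> coset p"
    by (rule someI[of _ p]) (simp add: in_coset_iff ri.span_zero)
  then show ?thesis unfolding lift_def in_coset_iff by (rule nf_eq)
qed

lemma net_quotient_induct:
  assumes "q \<in> carrier (net_quotient f g h)"
    and "\<And>b. b \<in> B \<Longrightarrow> P (coset (mon b))"
    and "\<And>p p'. P (coset p) \<Longrightarrow> P (coset p') \<Longrightarrow> P (coset (p + p'))"
    and "\<And>a p. P (coset p) \<Longrightarrow> P (coset (Const a * p))"
  shows "P q"
proof -
  obtain p where p: "q = coset p" using assms(1) by (auto simp: net_quotient_simps)
  have "P (coset (nf p))"
    unfolding nf_def by (rule sum_induct_nonempty[OF finite_B B_nonempty]) (simp_all add: assms)
  moreover have "coset p = coset (nf p)" unfolding coset_eq_iff by (rule nf_cong)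
  ultimately show ?thesis using p by simp
qed

text \<open>The ideal is graded and \<open>B\<close> consists of monomials, so the part of
  \<open>B\<close> in degree \<open>j\<close> is a basis of the quotient in degree
  \<open>j\<close>.\<close>

lemma dim_net_quotient_eq: "dim_net_quotient f g h j = card {b \<in> B. mdeg b = j}"
proof -
  define Bj where "Bj = {b \<in> B. mdeg b = j}"
  have Bj: "finite Bj" "Bj \<subseteq> B" using finite_B by (auto simp: Bj_def)
  have indep: "\<forall>b\<in>Bj. c b = 0" if "(\<Sum>b\<in>Bj. Const (c b) * mon b) \<in> ri.span {f, g, h}" for c
    using indep_modD[OF B_indep Bj that] by blast
  have fam: "inj_on (mon :: _ \<Rightarrow> poly3) Bj" "cv.independent ((mon :: _ \<Rightarrow> poly3) ` Bj)"
    by (rule cv.family_independent[OF Bj(1)], rule indep, simp add: ri.span_zero)+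
  define U where "U = cv.span ((mon :: _ \<Rightarrow> poly3) ` Bj)"
  have U: "x \<in> U \<longleftrightarrow> (\<exists>c. x = (\<Sum>b\<in>Bj. Const (c b) * mon b))" for x
  proof
    assume "x \<in> U"
    then obtain u where "x = (\<Sum>v\<in>mon ` Bj. Const (u v) * v)"
      unfolding U_def using cv.span_finite[of "mon ` Bj"] Bj(1) by auto
    then have "x = (\<Sum>b\<in>Bj. Const (u (mon b)) * mon b)" by (simp add: sum.reindex[OF fam(1)])
    then show "\<exists>c. x = (\<Sum>b\<in>Bj. Const (c b) * mon b)" by (rule exI[where x = "\<lambda>b. u (mon b)"])
  next
    assume "\<exists>c. x = (\<Sum>b\<in>Bj. Const (c b) * mon b)"
    then obtain c where x: "x = (\<Sum>b\<in>Bj. Const (c b) * mon b)" ..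
    show "x \<in> U" unfolding U_def x
      by (intro cv.span_sum cv.span_scale cv.span_base imageI)
  qed
  have sub: "cv.subspace U" unfolding U_def by (rule cv.subspace_span)
  have zero: "x = 0" if x: "x \<in> U" "x \<in> ri.span {f, g, h}" for x
  proof -
    obtain c where c: "x = (\<Sum>b\<in>Bj. Const (c b) * mon b)" using iffD1[OF U x(1)] ..
    have "\<forall>b\<in>Bj. c b = 0" using x(2) unfolding c by (rule indep)
    then show ?thesis unfolding c by simp
  qed
  have "bij_betw coset U {coset p | p. form j p}"
    unfolding bij_betw_def
  proof
    show "inj_on coset U"
    proof (rule inj_onI)
      fix p q assume pq: "p \<in> U" "q \<in> U" "coset p = coset q"
      have "p - q = 0"
        by (rule zero[OF cv.subspace_diff[OF sub pq(1,2)]]) (use pq(3) in \<open>simp only: coset_eq_iff\<close>)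
      then show "p = q" by simp
    qed
    show "coset ` U = {coset p | p. form j p}"
    proof
      have "form j x" if "x \<in> U" for x
        using that form_mon unfolding U Bj_def by (auto intro!: form_sum form_Const_mult)
      then show "coset ` U \<subseteq> {coset p | p. form j p}" by blast
      show "{coset p | p. form j p} \<subseteq> coset ` U"
      proof clarify
        fix p :: poly3 assume p: "form j p"
        \<comment> \<open>Degree \<open>j\<close> parts are taken on both sides: the normal form
          keeps only the members of \<open>Bj\<close>, and the ideal part stays in the ideal because
          f, g, h are forms.\<close>
        obtain \<alpha> \<beta> \<gamma> where "p - nf p = \<alpha> * f + \<beta> * g + \<gamma> * h" using nf_cong[of p] unfolding in_span_triple_iff by blast
        then have "p = nf p + (\<alpha> * f + \<beta> * g + \<gamma> * h)" by (simp add: diff_eq_eq add.commute)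
        from arg_cong[OF this, of "hpart j"]
        have p_eq: "p = hpart j (nf p) + hpart j (\<alpha> * f + \<beta> * g + \<gamma> * h)"
          unfolding hpart_add[of j "nf p"] hpart_form[OF p, of j] if_P[OF refl] .
        have in_ideal: "hpart j (\<alpha> * f + \<beta> * g + \<gamma> * h) \<in> ri.span {f, g, h}"
          unfolding hpart_span_triple[OF forms] using in_span_triple_iff[of _ f g h] ri.span_zero[of "{f, g, h}"]
          by (cases "n \<le> j") (simp_all only: if_True if_False, blast)
        have nf_part: "hpart j (nf p) = (\<Sum>b\<in>Bj. Const (nf_coeff p b) * mon b)"
          unfolding nf_def hpart_sum hpart_Const_mult hpart_form[OF form_mon] Bj_def
          using finite_B by (intro sum.mono_neutral_cong_right) auto
        have "p - hpart j (nf p) = hpart j (nf p) + hpart j (\<alpha> * f + \<beta> * g + \<gamma> * h) - hpart j (nf p)"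
          by (rule arg_cong[OF p_eq])
        also have "\<dots> = hpart j (\<alpha> * f + \<beta> * g + \<gamma> * h)" by simp
        finally have "p - (\<Sum>b\<in>Bj. Const (nf_coeff p b) * mon b) = hpart j (\<alpha> * f + \<beta> * g + \<gamma> * h)"
          unfolding nf_part .
        then have "coset p = coset (\<Sum>b\<in>Bj. Const (nf_coeff p b) * mon b)"
          unfolding coset_eq_iff using in_ideal by simp
        moreover have "(\<Sum>b\<in>Bj. Const (nf_coeff p b) * mon b) \<in> U"
          unfolding U by (rule exI[where x = "nf_coeff p"]) (rule refl)
        ultimately show "coset p \<in> coset ` U" by (rule image_eqI)
      qed
    qed
  qed
  then have "dim_net_quotient f g h j = card ((mon :: _ \<Rightarrow> poly3) ` Bj)"
    unfolding dim_net_quotient_def real_dim_def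
    by (intro vectorspace_dim_transport[OF cv.vector_space_axioms sub _ _ fam(2), where T = coset])
      (use Bj(1) cv.span_superset[of "mon ` Bj"] in \<open>auto simp: U_def net_quotient_simps\<close>)
  also have "\<dots> = card Bj" by (rule card_image[OF fam(1)])
  finally show ?thesis by (simp only: Bj_def)
qed

end

section \<open>Splines on a mesh with edge forms in the net\<close>

locale spline_net = net_with_basis +
  fixes \<Delta> :: mesh and r :: nat
  assumes finite_faces: "finite (Faces \<Delta>)"
    and edge_form_in_net: "\<And>\<tau>. \<tau> \<in> interior_edges \<Delta> \<Longrightarrow> edge_form \<Delta> \<tau> \<in> net f g h"
begin

abbreviation M where "M \<equiv> image_spline_module f g h \<Delta> r"
abbreviation X where "X \<equiv> spline_module \<Delta> r"

lemmas M_simps = difference_kernel_simps[of \<Delta> r "image_form f g h \<Delta>", folded image_spline_module_def]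
lemmas X_simps = difference_kernel_simps[of \<Delta> r "edge_form \<Delta>", folded spline_module_def]

text \<open>Resolves the definite description: a linear form exists because the edge form lies in
  the net, and it is unique because pullback is injective.\<close>

lemma phi_image_form:
  assumes "\<tau> \<in> interior_edges \<Delta>"
  shows "\<phi> (image_form f g h \<Delta> \<tau>) = edge_form \<Delta> \<tau>"
proof -
  obtain a b c where e: "edge_form \<Delta> \<tau> = Const a * f + Const b * g + Const c * h"
    using edge_form_in_net[OF assms] unfolding net_def by blast
  define l :: poly3 where "l = Const a * var 1 + Const b * var 2 + Const c * var 3"
  have "form 1 (var i :: poly3)" for i
    using form_mon[of "Poly_Mapping.single i 1"] by (simp add: var_def)
  then have "form 1 l" unfolding l_def by (intro form_add form_Const_mult)
  moreover have l: "\<phi> l = edge_form \<Delta> \<tau>"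
    unfolding l_def e by (simp only: \<phi>.hom_add \<phi>.hom_mult phi_Const phi_var)
  moreover have "l' = l" if "\<phi> l' = edge_form \<Delta> \<tau>" for l'
    using phi_inj[of "l' - l"] that l by (simp add: \<phi>.hom_minus)
  ultimately have "image_form f g h \<Delta> \<tau> = l"
    unfolding image_form_def by (intro the_equality) blast+
  then show ?thesis using l by simp
qed

lemma phi_image_form_power:
  "\<tau> \<in> interior_edges \<Delta> \<Longrightarrow> edge_form \<Delta> \<tau> ^ (r + 1) = \<phi> (image_form f g h \<Delta> \<tau> ^ (r + 1))"
  by (simp only: \<phi>.hom_power phi_image_form)

text \<open>The power of the edge form is a pullback, and all faces use the same basis, so each
  divisibility condition splits into one condition per coordinate.\<close>

lemma compatible_comb_iff:
  "compatible \<Delta> r (edge_form \<Delta>) (\<lambda>\<sigma>. comb (\<lambda>b. R b \<sigma>)) \<longleftrightarrow>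
    (\<forall>b\<in>B. compatible \<Delta> r (image_form f g h \<Delta>) (R b))"
proof -
  have "edge_form \<Delta> \<tau> ^ (r + 1) dvd comb (\<lambda>b. R b \<sigma>) - comb (\<lambda>b. R b \<sigma>') \<longleftrightarrow>
      (\<forall>b\<in>B. image_form f g h \<Delta> \<tau> ^ (r + 1) dvd R b \<sigma> - R b \<sigma>')" if "\<tau> \<in> interior_edges \<Delta>" for \<tau> \<sigma> \<sigma>'
    unfolding phi_image_form_power[OF that] comb_minus[symmetric] by (rule dvd_comb_iff)
  then show ?thesis unfolding compatible_def by blast
qed

lemma compatible_phi_mult:
  assumes "compatible \<Delta> r (image_form f g h \<Delta>) F"
  shows "compatible \<Delta> r (edge_form \<Delta>) (\<lambda>\<sigma>. \<phi> (F \<sigma>) * s)"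
proof (rule compatibleI)
  fix \<tau> \<sigma> \<sigma>' assume \<tau>: "\<tau> \<in> interior_edges \<Delta>" "\<sigma> \<in> Faces \<Delta>" "\<sigma>' \<in> Faces \<Delta>" "\<tau> \<in> components (\<sigma> \<inter> \<sigma>')"
  obtain q where "F \<sigma> - F \<sigma>' = image_form f g h \<Delta> \<tau> ^ (r + 1) * q"
    using compatibleD[OF assms \<tau>] by (rule dvdE)
  then have "\<phi> (F \<sigma>) - \<phi> (F \<sigma>') = edge_form \<Delta> \<tau> ^ (r + 1) * \<phi> q"
    unfolding phi_image_form_power[OF \<tau>(1)] \<phi>.hom_minus[symmetric] \<phi>.hom_mult[symmetric] by (rule arg_cong)
  then have "\<phi> (F \<sigma>) * s - \<phi> (F \<sigma>') * s = edge_form \<Delta> \<tau> ^ (r + 1) * (\<phi> q * s)"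
    unfolding left_diff_distrib[symmetric] by (simp only: mult.assoc)
  then show "edge_form \<Delta> \<tau> ^ (r + 1) dvd \<phi> (F \<sigma>) * s - \<phi> (F \<sigma>') * s" by (rule dvdI)
qed

text \<open>The balanced map underlying both tensor products: the tensor of \<open>F\<close> and
  \<open>s\<close> corresponds to the pullback of \<open>F\<close> multiplied by
  \<open>s\<close>.\<close>

definition scaled :: "((real ^ 2) set \<Rightarrow> poly3) \<Rightarrow> poly3 \<Rightarrow> (real ^ 2) set \<Rightarrow> poly3" where
  "scaled F s = (\<lambda>\<sigma>\<in>Faces \<Delta>. \<phi> (F \<sigma>) * s)"

lemma scaled_in_X: "F \<in> carrier M \<Longrightarrow> scaled F s \<in> carrier X"
  by (simp add: M_simps X_simps scaled_def compatible_restrict compatible_phi_mult)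

lemma finsum_scaled:
  assumes "R \<in> B \<rightarrow> carrier M"
  shows "finsum X (\<lambda>b. scaled (R b) (mon b)) B = (\<lambda>\<sigma>\<in>Faces \<Delta>. comb (\<lambda>b. R b \<sigma>))"
proof -
  have "scaled (R b) (mon b) \<in> carrier (difference_kernel \<Delta> r (edge_form \<Delta>))" if "b \<in> B" for b
    using scaled_in_X[OF funcset_mem[OF assms that]] by (simp add: spline_module_def)
  then show ?thesis
    unfolding spline_module_def finsum_difference_kernel[OF finite_B, of "\<lambda>b. scaled (R b) (mon b)" \<Delta> r "edge_form \<Delta>"]
    by (subst finsum_difference_kernel[OF finite_B]) (auto simp: scaled_def comb_def)
qed

lemma X_span:
  assumes "F \<in> carrier X"
  shows "\<exists>R\<in>B \<rightarrow> carrier M. F = finsum X (\<lambda>b. scaled (R b) (mon b)) B"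
proof -
  have "\<forall>\<sigma>. \<exists>r. F \<sigma> = comb r" using comb_surj by blast
  from choice[OF this] obtain q where q: "\<forall>\<sigma>. F \<sigma> = comb (q \<sigma>)" ..
  define R where "R b = (\<lambda>\<sigma>\<in>Faces \<Delta>. q \<sigma> b)" for b
  have F: "F = (\<lambda>\<sigma>\<in>Faces \<Delta>. comb (\<lambda>b. R b \<sigma>))"
    using assms q by (auto simp: X_simps R_def fun_eq_iff extensional_def)
  have "compatible \<Delta> r (edge_form \<Delta>) (\<lambda>\<sigma>. comb (\<lambda>b. R b \<sigma>))"
    using assms unfolding compatible_restrict[symmetric, of _ _ _ "\<lambda>\<sigma>. comb (\<lambda>b. R b \<sigma>)"] F[symmetric]
    by (simp add: X_simps)
  then have "\<forall>b\<in>B. compatible \<Delta> r (image_form f g h \<Delta>) (R b)" unfolding compatible_comb_iff .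
  moreover have "R b \<in> extensional (Faces \<Delta>)" for b by (simp add: R_def)
  ultimately have R: "R \<in> B \<rightarrow> carrier M" unfolding M_simps by blast
  show ?thesis by (rule bexI[OF _ R]) (simp only: finsum_scaled[OF R] F[symmetric])
qed

lemma X_indep:
  assumes R: "R \<in> B \<rightarrow> carrier M" and 0: "finsum X (\<lambda>b. scaled (R b) (mon b)) B = \<zero>\<^bsub>X\<^esub>"
  shows "\<forall>b\<in>B. R b = \<zero>\<^bsub>M\<^esub>"
proof
  fix b assume b: "b \<in> B"
  have "R b \<sigma> = 0" if "\<sigma> \<in> Faces \<Delta>" for \<sigma>
  proof (rule comb_eq_0[OF _ b, of "\<lambda>b. R b \<sigma>"])
    show "comb (\<lambda>b. R b \<sigma>) = 0"
      using fun_cong[OF 0, of \<sigma>] that unfolding finsum_scaled[OF R] by (simp add: X_simps)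
  qed
  moreover have "R b \<in> extensional (Faces \<Delta>)" using funcset_mem[OF R b] by (simp add: M_simps)
  ultimately show "R b = \<zero>\<^bsub>M\<^esub>" by (auto simp: M_simps fun_eq_iff extensional_def)
qed

lemma abelian_group_M: "abelian_group M"
  unfolding image_spline_module_def by (rule abelian_group_difference_kernel)

lemma abelian_group_X: "abelian_group X"
  unfolding spline_module_def by (rule abelian_group_difference_kernel)

lemma M_smult_closed: "F \<in> carrier M \<Longrightarrow> a \<odot>\<^bsub>M\<^esub> F \<in> carrier M"
  unfolding image_spline_module_def by (rule difference_kernel_smult_closed)

lemma X_smult_closed: "F \<in> carrier X \<Longrightarrow> a \<odot>\<^bsub>X\<^esub> F \<in> carrier X"
  unfolding spline_module_def by (rule difference_kernel_smult_closed)

lemma scaled_add_left: "scaled (F \<oplus>\<^bsub>M\<^esub> G) s = scaled F s \<oplus>\<^bsub>X\<^esub> scaled G s"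
  by (simp add: scaled_def M_simps X_simps fun_eq_iff restrict_def \<phi>.hom_add distrib_right)

lemma scaled_add_right: "scaled F (s + t) = scaled F s \<oplus>\<^bsub>X\<^esub> scaled F t"
  by (simp add: scaled_def X_simps fun_eq_iff restrict_def distrib_left)

lemma scaled_smult: "scaled (a \<odot>\<^bsub>M\<^esub> F) s = scaled F (\<phi> a * s)"
  by (simp add: scaled_def M_simps fun_eq_iff restrict_def \<phi>.hom_mult mult.left_commute mult.assoc)

lemma smult_scaled: "a \<odot>\<^bsub>X\<^esub> scaled F s = scaled F (a * s)"
  by (simp add: scaled_def X_simps fun_eq_iff restrict_def mult.left_commute)

lemma X_smult_add: "a \<odot>\<^bsub>X\<^esub> (F \<oplus>\<^bsub>X\<^esub> G) = a \<odot>\<^bsub>X\<^esub> F \<oplus>\<^bsub>X\<^esub> a \<odot>\<^bsub>X\<^esub> G"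
  by (simp add: X_simps fun_eq_iff restrict_def distrib_left)

lemma regular_simps [simp]:
  "carrier (regular_module PR) = UNIV" "s \<oplus>\<^bsub>regular_module PR\<^esub> t = s + t" "a \<odot>\<^bsub>regular_module PR\<^esub> s = a * s"
  by (simp_all add: regular_module_def)

lemma spline_module_iso_over_S:
  "module_isomorphic PR X (tensor_right PR \<phi> M (regular_module PR))"
  unfolding tensor_right_def
proof (rule tensor_with_basis.tensor_iso[where \<beta> = scaled and J = B and e = mon])
  show "tensor_with_basis PR M (restrict_scalars \<phi> (regular_module PR)) PR X scaled
     (\<lambda>b (m, n). (m, b \<odot>\<^bsub>regular_module PR\<^esub> n)) B mon"
  proof (rule tensor_with_basis.intro)
    let ?N = "restrict_scalars \<phi> (regular_module PR)"
    fix T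
    assume T: "\<And>b. b \<in> B \<Longrightarrow> mon b \<in> T"
      "\<And>n n'. n \<in> carrier ?N \<Longrightarrow> n' \<in> carrier ?N \<Longrightarrow> n \<in> T \<Longrightarrow> n' \<in> T \<Longrightarrow> n \<oplus>\<^bsub>?N\<^esub> n' \<in> T"
      "\<And>a n. a \<in> carrier PR \<Longrightarrow> n \<in> carrier ?N \<Longrightarrow> n \<in> T \<Longrightarrow> a \<odot>\<^bsub>?N\<^esub> n \<in> T"
    show "carrier ?N \<subseteq> T"
    proof
      fix s
      obtain q where s: "s = comb q" using comb_surj by blast
      show "s \<in> T"
        unfolding s comb_def
        by (rule sum_induct_nonempty[OF finite_B B_nonempty, of "\<lambda>s. s \<in> T"]) (use T in simp_all)
    qed
  next
    show "\<forall>b\<in>B. R b = \<zero>\<^bsub>M\<^esub>" if "R \<in> B \<rightarrow> carrier M" "finsum X (\<lambda>b. scaled (R b) (mon b)) B = \<zero>\<^bsub>X\<^esub>" for R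
      using that by (rule X_indep)
  qed (simp_all add: abelian_group_M abelian_group_X M_smult_closed X_smult_closed X_smult_add scaled_in_X
      scaled_add_left scaled_add_right scaled_smult smult_scaled finite_B X_span)
qed

lemma scaled_lift:
  assumes "R \<in> B \<rightarrow> carrier M"
  shows "finsum (restrict_scalars \<phi> X) (\<lambda>b. scaled (R b) (lift (coset (mon b)))) B =
      finsum X (\<lambda>b. scaled (R b) (mon b)) B"
proof -
  interpret X: abelian_group X by (rule abelian_group_X)
  have in_X: "(\<lambda>b. scaled (R b) (mon b)) \<in> B \<rightarrow> carrier X" using assms scaled_in_X by auto
  have eq: "scaled (R b) (lift (coset (mon b))) = scaled (R b) (mon b)" if "b \<in> B" for b
    using that by (simp add: lift_coset nf_mon)
  then have "(\<lambda>b. scaled (R b) (lift (coset (mon b)))) \<in> B \<rightarrow> carrier X" using in_X by auto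
  then have "finsum (restrict_scalars \<phi> X) (\<lambda>b. scaled (R b) (lift (coset (mon b)))) B =
      finsum X (\<lambda>b. scaled (R b) (lift (coset (mon b)))) B"
    by (rule finsum_restrict_scalars[OF abelian_group_X finite_B])
  also have "\<dots> = finsum X (\<lambda>b. scaled (R b) (mon b)) B"
    by (rule X.finsum_cong'[OF refl in_X eq])
  finally show ?thesis .
qed

text \<open>Composed with the real linear section \<open>lift\<close>, the map \<open>scaled\<close>
  is balanced over the reals, since pullback fixes constants. R acts through the left factor, where
  \<phi> turns its action into the restricted one on splines.\<close>

lemma spline_module_iso_over_R:
  "module_isomorphic PR (restrict_scalars \<phi> X)
     (tensor_left (class_ring :: real ring) Const M (restrict_scalars Const (net_quotient f g h)))"
  unfolding tensor_left_def
proof (rule tensor_with_basis.tensor_iso[where \<beta> = "\<lambda>F q. scaled F (lift q)" and J = B and e = "\<lambda>b. coset (mon b)"])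
  show "tensor_with_basis (class_ring :: real ring) (restrict_scalars Const M) (restrict_scalars Const (net_quotient f g h)) PR
     (restrict_scalars \<phi> X) (\<lambda>F q. scaled F (lift q))
     (\<lambda>b (m, n). (b \<odot>\<^bsub>M\<^esub> m, n)) B (\<lambda>b. coset (mon b))"
  proof (rule tensor_with_basis.intro)
    let ?N = "restrict_scalars Const (net_quotient f g h)"
    fix T
    assume T: "\<And>b. b \<in> B \<Longrightarrow> coset (mon b) \<in> T"
      "\<And>n n'. n \<in> carrier ?N \<Longrightarrow> n' \<in> carrier ?N \<Longrightarrow> n \<in> T \<Longrightarrow> n' \<in> T \<Longrightarrow> n \<oplus>\<^bsub>?N\<^esub> n' \<in> T"
      "\<And>a n. a \<in> carrier (class_ring :: real ring) \<Longrightarrow> n \<in> carrier ?N \<Longrightarrow> n \<in> T \<Longrightarrow> a \<odot>\<^bsub>?N\<^esub> n \<in> T"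
    show "carrier ?N \<subseteq> T"
    proof
      fix q assume "q \<in> carrier ?N"
      then have "q \<in> carrier (net_quotient f g h)" by simp
      then show "q \<in> T"
      proof (rule net_quotient_induct[where P = "\<lambda>q. q \<in> T"])
        show "coset (mon b) \<in> T" if "b \<in> B" for b using that by (rule T(1))
        show "coset (p + p') \<in> T" if "coset p \<in> T" "coset p' \<in> T" for p p'
          using T(2)[OF _ _ that] by (simp add: net_quotient_simps)
        show "coset (Const a * p) \<in> T" if "coset p \<in> T" for a p
          using T(3)[OF _ _ that, of a] by (simp add: net_quotient_simps)
      qed
    qed
  next
    fix R assume R: "R \<in> B \<rightarrow> carrier (restrict_scalars Const M)"
      "finsum (restrict_scalars \<phi> X) (\<lambda>b. scaled (R b) (lift (coset (mon b)))) B = \<zero>\<^bsub>restrict_scalars \<phi> X\<^esub>"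
    then show "\<forall>b\<in>B. R b = \<zero>\<^bsub>restrict_scalars Const M\<^esub>" using X_indep[of R] scaled_lift[of R] by simp
  next
    fix F assume "F \<in> carrier (restrict_scalars \<phi> X)"
    then obtain R where "R \<in> B \<rightarrow> carrier M" "F = finsum X (\<lambda>b. scaled (R b) (mon b)) B"
      using X_span[of F] by auto
    then show "\<exists>R\<in>B \<rightarrow> carrier (restrict_scalars Const M).
        F = finsum (restrict_scalars \<phi> X) (\<lambda>b. scaled (R b) (lift (coset (mon b)))) B"
      by (intro bexI[of _ R]) (simp_all add: scaled_lift)
  next
    fix a F q assume "q \<in> carrier (restrict_scalars Const (net_quotient f g h))"
    then obtain p where "q = coset p" by (auto simp: net_quotient_simps)
    then show "scaled (a \<odot>\<^bsub>restrict_scalars Const M\<^esub> F) (lift q) =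
        scaled F (lift (a \<odot>\<^bsub>restrict_scalars Const (net_quotient f g h)\<^esub> q))"
      by (simp add: net_quotient_simps lift_coset nf_Const_mult scaled_smult)
  next
    fix F q q'
    assume "q \<in> carrier (restrict_scalars Const (net_quotient f g h))"
      "q' \<in> carrier (restrict_scalars Const (net_quotient f g h))"
    then obtain p p' where "q = coset p" "q' = coset p'" by (auto simp: net_quotient_simps)
    then show "scaled F (lift (q \<oplus>\<^bsub>restrict_scalars Const (net_quotient f g h)\<^esub> q')) =
        scaled F (lift q) \<oplus>\<^bsub>restrict_scalars \<phi> X\<^esub> scaled F (lift q')"
      "q \<oplus>\<^bsub>restrict_scalars Const (net_quotient f g h)\<^esub> q' \<in> carrier (restrict_scalars Const (net_quotient f g h))"
      by (simp_all add: net_quotient_simps lift_coset nf_add scaled_add_right)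
  next
    fix a q assume "q \<in> carrier (restrict_scalars Const (net_quotient f g h))"
    then show "a \<odot>\<^bsub>restrict_scalars Const (net_quotient f g h)\<^esub> q \<in> carrier (restrict_scalars Const (net_quotient f g h))"
      by (auto simp: net_quotient_simps)
  qed (simp_all add: abelian_group_restrict_scalars abelian_group_M abelian_group_X M_smult_closed X_smult_closed
      X_smult_add scaled_in_X scaled_add_left scaled_smult smult_scaled finite_B net_quotient_simps)
qed

lemma comb_compatible_forms:
  "compatible_forms \<Delta> r (edge_form \<Delta>) d =
    {\<lambda>x. comb (\<lambda>b. R b x) | R. \<forall>b\<in>B.
      (\<exists>i. n * i + mdeg b = d \<and> R b \<in> compatible_forms \<Delta> r (image_form f g h \<Delta>) i) \<or>
      ((\<forall>i. n * i + mdeg b \<noteq> d) \<and> R b = 0)}" (is "_ = ?V")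
proof
  show "compatible_forms \<Delta> r (edge_form \<Delta>) d \<subseteq> ?V"
  proof
    fix F assume F: "F \<in> compatible_forms \<Delta> r (edge_form \<Delta>) d"
    have "\<forall>\<sigma>. \<exists>q. F \<sigma> = comb q" using comb_surj by blast
    from choice[OF this] obtain q where q: "\<forall>\<sigma>. F \<sigma> = comb (q \<sigma>)" ..
    \<comment> \<open>The value 0 off the faces keeps the coordinates in \<open>forms_on\<close> and
      agrees with \<open>F\<close>, which vanishes there.\<close>
    define R where "R b \<sigma> = (if \<sigma> \<in> Faces \<Delta> then q \<sigma> b else 0)" for b \<sigma>
    have F_eq: "F \<sigma> = comb (\<lambda>b. R b \<sigma>)" for \<sigma>
    proof (cases "\<sigma> \<in> Faces \<Delta>")
      case True then show ?thesis using q by (simp add: R_def)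
    next
      case False then show ?thesis using F by (simp add: R_def compatible_forms_def forms_on_def comb_def)
    qed
    have "compatible \<Delta> r (edge_form \<Delta>) (\<lambda>\<sigma>. comb (\<lambda>b. R b \<sigma>))"
      using F unfolding F_eq[symmetric] by (simp add: compatible_forms_def)
    then have comp: "\<forall>b\<in>B. compatible \<Delta> r (image_form f g h \<Delta>) (R b)" unfolding compatible_comb_iff .
    have form: "form d (comb (\<lambda>b. R b \<sigma>))" for \<sigma>
      using F unfolding F_eq[symmetric] by (simp add: compatible_forms_def forms_on_def)
    have "(\<exists>i. n * i + mdeg b = d \<and> R b \<in> compatible_forms \<Delta> r (image_form f g h \<Delta>) i) \<or>
      ((\<forall>i. n * i + mdeg b \<noteq> d) \<and> R b = 0)" if b: "b \<in> B" for b
    proof (cases "\<exists>i. n * i + mdeg b = d")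
      case True
      then obtain i where i: "n * i + mdeg b = d" ..
      have "form i (R b \<sigma>)" for \<sigma> using form_combD[OF form b, of \<sigma>] True i by simp
      then have "R b \<in> compatible_forms \<Delta> r (image_form f g h \<Delta>) i"
        using comp b by (simp add: compatible_forms_def forms_on_def) (simp add: R_def)
      then show ?thesis using i by blast
    next
      case False
      then have "R b \<sigma> = 0" for \<sigma> using form_combD[OF form b, of \<sigma>] by simp
      then show ?thesis using False by (auto simp: fun_eq_iff)
    qed
    moreover have "F = (\<lambda>\<sigma>. comb (\<lambda>b. R b \<sigma>))" using F_eq by (rule ext)
    ultimately show "F \<in> ?V" by blast
  qed
  show "?V \<subseteq> compatible_forms \<Delta> r (edge_form \<Delta>) d"
  proof
    fix F assume "F \<in> ?V"
    then obtain R where F: "F = (\<lambda>x. comb (\<lambda>b. R b x))" and R: "\<And>b. b \<in> B \<Longrightarrow>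
      (\<exists>i. n * i + mdeg b = d \<and> R b \<in> compatible_forms \<Delta> r (image_form f g h \<Delta>) i) \<or>
      ((\<forall>i. n * i + mdeg b \<noteq> d) \<and> R b = 0)" by blast
    have "compatible \<Delta> r (image_form f g h \<Delta>) (R b)" if "b \<in> B" for b
      using R[OF that] compatible_0 by (auto simp: compatible_forms_def zero_fun_def)
    then have "compatible \<Delta> r (edge_form \<Delta>) F" unfolding F compatible_comb_iff by blast
    moreover have "F \<sigma> = 0" if "\<sigma> \<notin> Faces \<Delta>" for \<sigma>
    proof -
      have "R b \<sigma> = 0" if "b \<in> B" for b
        using R[OF that] \<open>\<sigma> \<notin> Faces \<Delta>\<close> by (auto simp: compatible_forms_def forms_on_def)
      then show ?thesis by (simp add: F comb_def)
    qed
    moreover have "form d (F \<sigma>)" for \<sigma>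
      unfolding F
    proof (rule form_combI)
      fix b assume "b \<in> B"
      then show "R b \<sigma> = 0 \<or> (\<exists>i. n * i + mdeg b = d \<and> form i (R b \<sigma>))"
        using R[of b] by (auto simp: compatible_forms_def forms_on_def)
    qed
    ultimately show "F \<in> compatible_forms \<Delta> r (edge_form \<Delta>) d"
      by (simp add: compatible_forms_def forms_on_def)
  qed
qed

lemma dim_spline_eq:
  "dim_spline \<Delta> r d =
    (\<Sum>(i, j)\<in>{(i, j). n * i + j = d}. dim_image_spline f g h \<Delta> r i * dim_net_quotient f g h j)"
proof -
  have "dim_spline \<Delta> r d = fv.dim (compatible_forms \<Delta> r (edge_form \<Delta>) d)"
    unfolding dim_spline_def spline_module_def by (rule real_dim_spline_part[OF finite_faces])
  also have "\<dots> = (\<Sum>(i, j)\<in>{(i, j). n * i + j = d}.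
      fv.dim (compatible_forms \<Delta> r (image_form f g h \<Delta>) i) * card {b \<in> B. mdeg b = j})"
    unfolding comb_compatible_forms
    by (rule dim_comb[OF finite_faces subspace_compatible_forms]) (auto simp: compatible_forms_def)
  also have "\<dots> = (\<Sum>(i, j)\<in>{(i, j). n * i + j = d}. dim_image_spline f g h \<Delta> r i * dim_net_quotient f g h j)"
    unfolding dim_net_quotient_eq dim_image_spline_def image_spline_module_def
      real_dim_spline_part[OF finite_faces] ..
  finally show ?thesis .
qed

end

section \<open>Hilbert series\<close>

text \<open>Single forms are tuples over a one-point set, which brings S itself into the shape
  required by \<open>dim_comb\<close>.\<close>

lemma dim_forms_unit: "fv.dim (forms_on (UNIV :: unit set) d) = card {m :: 3 \<Rightarrow>\<^sub>0 nat. mdeg m = d}"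
proof -
  let ?m = "{m :: 3 \<Rightarrow>\<^sub>0 nat. mdeg m = d}"
  let ?e = "\<lambda>m (_ :: unit). mon m :: poly3"
  have indep: "\<forall>m\<in>?m. c m = 0" if "(\<Sum>m\<in>?m. fscale (c m) (?e m)) = 0" for c
  proof
    fix m assume m: "m \<in> ?m"
    have "(\<Sum>m\<in>?m. Const (c m) * mon m) = 0"
      using fun_cong[OF that, of "()"] by (simp add: sum_fun_apply fscale_def)
    then have "Poly_Mapping.lookup (\<Sum>m\<in>?m. Const (c m) * mon m) m = 0" by simp
    also have "Poly_Mapping.lookup (\<Sum>m\<in>?m. Const (c m) * mon m) m = (\<Sum>m'\<in>?m. if m' = m then c m else 0)"
      unfolding lookup_sum by (intro sum.cong) (auto simp: lookup_mon)
    also have "\<dots> = c m" using m by (subst sum.delta[OF finite_monomials]) simp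
    finally show "c m = 0" .
  qed
  have fam: "inj_on ?e ?m" "fv.independent (?e ` ?m)"
    by (rule fv.family_independent[OF finite_monomials], erule indep)+
  have "forms_on (UNIV :: unit set) d \<subseteq> fv.span (?e ` ?m)"
  proof -
    have "(\<lambda>(x :: unit, m) y. if y = x then mon m else (0 :: poly3)) ` (UNIV \<times> ?m) = ?e ` ?m"
      by (auto simp: image_def fun_eq_iff)
    then show ?thesis using forms_on_span[of "UNIV :: unit set" d] by simp
  qed
  moreover have "?e ` ?m \<subseteq> forms_on UNIV d" using form_mon by (auto simp: forms_on_def)
  ultimately have "fv.dim (forms_on (UNIV :: unit set) d) = card (?e ` ?m)"
    using fam(2) by (intro fv.dim_unique) auto
  then show ?thesis by (simp add: card_image[OF fam(1)])
qed

lemma subspace_forms_on: "fv.subspace (forms_on D d)"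
  by (rule fv.subspaceI) (auto simp: forms_on_def fscale_def form_add form_Const_mult)

text \<open>Both sides are dimensions of the degree-\<open>d\<close> part of $S$, which is the spline module of a
  single face without interior edges.\<close>

lemma (in net_with_basis) card_monomials:
  "card {m :: 3 \<Rightarrow>\<^sub>0 nat. mdeg m = d} =
    (\<Sum>(i, j)\<in>{(i, j). n * i + j = d}. card {m :: 3 \<Rightarrow>\<^sub>0 nat. mdeg m = i} * card {b \<in> B. mdeg b = j})"
proof -
  have "forms_on (UNIV :: unit set) d = {\<lambda>x. comb (\<lambda>b. R b x) | R. \<forall>b\<in>B.
      (\<exists>i. n * i + mdeg b = d \<and> R b \<in> forms_on UNIV i) \<or> ((\<forall>i. n * i + mdeg b \<noteq> d) \<and> R b = 0)}" (is "_ = ?V")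
  proof
    show "forms_on UNIV d \<subseteq> ?V"
    proof
      fix F :: "unit \<Rightarrow> poly3" assume F: "F \<in> forms_on UNIV d"
      obtain q where q: "F () = comb q" using comb_surj by blast
      have form: "form d (comb q)" using F unfolding q[symmetric] by (simp add: forms_on_def)
      have "(\<exists>i. n * i + mdeg b = d \<and> (\<lambda>_. q b) \<in> forms_on (UNIV :: unit set) i) \<or>
          ((\<forall>i. n * i + mdeg b \<noteq> d) \<and> (\<lambda>_ :: unit. q b) = 0)" if "b \<in> B" for b
        using form_combD[OF form that] by (auto simp: forms_on_def fun_eq_iff split: if_splits)
      moreover have "F = (\<lambda>x. comb (\<lambda>b. (\<lambda>_. q b) x))" using q by (simp add: fun_eq_iff)
      ultimately show "F \<in> ?V" by (intro CollectI exI[of _ "\<lambda>b _. q b"] conjI ballI) 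
    qed
    show "?V \<subseteq> forms_on UNIV d"
    proof
      fix F assume "F \<in> ?V"
      then obtain R where F: "F = (\<lambda>x. comb (\<lambda>b. R b x))" and R: "\<And>b. b \<in> B \<Longrightarrow>
        (\<exists>i. n * i + mdeg b = d \<and> R b \<in> forms_on (UNIV :: unit set) i) \<or> ((\<forall>i. n * i + mdeg b \<noteq> d) \<and> R b = 0)" by blast
      have "form d (F x)" for x
        unfolding F
      proof (rule form_combI)
        fix b assume "b \<in> B"
        then show "R b x = 0 \<or> (\<exists>i. n * i + mdeg b = d \<and> form i (R b x))"
          using R[of b] by (auto simp: forms_on_def)
      qed
      then show "F \<in> forms_on UNIV d" by (simp add: forms_on_def)
    qed
  qed
  then have "fv.dim (forms_on (UNIV :: unit set) d) =
      (\<Sum>(i, j)\<in>{(i, j). n * i + j = d}. fv.dim (forms_on (UNIV :: unit set) i) * card {b \<in> B. mdeg b = j})"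
    by (simp only:) (rule dim_comb[of UNIV], auto intro: subspace_forms_on)
  then show ?thesis unfolding dim_forms_unit .
qed

text \<open>The third exponent is determined by the first two. The double sum has the shape of a
  coefficient of a product of three geometric series.\<close>

lemma card_monomials_3: "card {m :: 3 \<Rightarrow>\<^sub>0 nat. mdeg m = d} = (\<Sum>i=0..d. \<Sum>j=0..d - i. 1)"
proof -
  define T where "T m = (Poly_Mapping.lookup m 1, Poly_Mapping.lookup m 2)" for m :: "3 \<Rightarrow>\<^sub>0 nat"
  define mk :: "nat \<times> nat \<Rightarrow> (3 \<Rightarrow>\<^sub>0 nat)" where
    "mk = (\<lambda>(i, j). Poly_Mapping.single 1 i + Poly_Mapping.single 2 j + Poly_Mapping.single 3 (d - i - j))"
  have deg: "mdeg m = Poly_Mapping.lookup m 1 + Poly_Mapping.lookup m 2 + Poly_Mapping.lookup m 3" for m :: "3 \<Rightarrow>\<^sub>0 nat"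
    by (simp add: mdeg_def sum_3)
  have "bij_betw T {m. mdeg m = d} (SIGMA i:{0..d}. {0..d - i})"
  proof (rule bij_betw_byWitness[where f' = mk])
    show "\<forall>m\<in>{m. mdeg m = d}. mk (T m) = m"
    proof clarify
      fix m :: "3 \<Rightarrow>\<^sub>0 nat" assume "d = mdeg m"
      show "mk (T m) = m"
      proof (rule poly_mapping_eqI)
        fix k :: 3
        show "Poly_Mapping.lookup (mk (T m)) k = Poly_Mapping.lookup m k"
          using exhaust_3[of k] \<open>d = mdeg m\<close> by (auto simp: mk_def T_def deg lookup_add lookup_single when_def)
      qed
    qed
    show "\<forall>p\<in>SIGMA i:{0..d}. {0..d - i}. T (mk p) = p"
      by (auto simp: mk_def T_def lookup_add lookup_single when_def)
    show "T ` {m. mdeg m = d} \<subseteq> (SIGMA i:{0..d}. {0..d - i})"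
      by (auto simp: T_def deg)
    show "mk ` (SIGMA i:{0..d}. {0..d - i}) \<subseteq> {m. mdeg m = d}"
      by (auto simp: mk_def mdeg_add)
  qed
  then have "card {m :: 3 \<Rightarrow>\<^sub>0 nat. mdeg m = d} = card (SIGMA i:{0..d}. {0..d - i})"
    by (rule bij_betw_same_card)
  then show ?thesis by (simp add: card_SigmaI)
qed

lemma hilbert_series_polynomial_ring:
  "hilbert_series (\<lambda>d. card {m :: 3 \<Rightarrow>\<^sub>0 nat. mdeg m = d}) * (1 - fps_X) ^ 3 = 1"
proof -
  define G :: "real fps" where "G = Abs_fps (\<lambda>_. 1)"
  have G: "G * (1 - fps_X) = 1"
    by (rule fps_ext) (simp add: G_def algebra_simps)
  have "hilbert_series (\<lambda>d. card {m :: 3 \<Rightarrow>\<^sub>0 nat. mdeg m = d}) = G * (G * G)"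
    by (rule fps_ext) (simp add: hilbert_series_def card_monomials_3 fps_mult_nth G_def)
  then have "hilbert_series (\<lambda>d. card {m :: 3 \<Rightarrow>\<^sub>0 nat. mdeg m = d}) * (1 - fps_X) ^ 3 =
      (G * (1 - fps_X)) * (G * (1 - fps_X)) * (G * (1 - fps_X))"
    by (simp add: power3_eq_cube mult_ac)
  then show ?thesis using G by simp
qed

text \<open>Substituting the n-th power of the variable moves \<open>w i\<close> to degree n * i;
  positivity of \<open>n\<close> makes the substitution legitimate and \<open>i\<close>
  unique.\<close>

lemma hilbert_series_convolution:
  assumes "0 < n"
    and v: "\<And>d. v d = (\<Sum>(i, j)\<in>{(i, j). n * i + j = d}. w i * q j)"
  shows "hilbert_series v = fps_compose (hilbert_series w) (fps_X ^ n) * hilbert_series q"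
proof (rule fps_ext)
  fix d
  have comp: "fps_compose (hilbert_series w) (fps_X ^ n) $ k = (if n dvd k then of_nat (w (k div n)) else 0)" for k
  proof -
    have "fps_compose (hilbert_series w) (fps_X ^ n) $ k = (\<Sum>i=0..k. if k = n * i then of_nat (w i) else 0)"
      unfolding fps_compose_nth hilbert_series_def
      by (intro sum.cong refl) (simp add: power_mult[symmetric] fps_X_power_nth)
    also have "\<dots> = (\<Sum>i\<in>{i \<in> {0..k}. k = n * i}. of_nat (w i))"
      by (rule sum.inter_filter[symmetric]) simp
    also have "{i \<in> {0..k}. k = n * i} = (if n dvd k then {k div n} else {})"
      using assms(1) by auto
    finally show ?thesis by simp
  qed
  have "(fps_compose (hilbert_series w) (fps_X ^ n) * hilbert_series q) $ d =
      (\<Sum>k=0..d. if n dvd k then of_nat (w (k div n) * q (d - k)) else 0)"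
    unfolding fps_mult_nth comp by (intro sum.cong) (auto simp: hilbert_series_def)
  also have "\<dots> = (\<Sum>k\<in>{k \<in> {0..d}. n dvd k}. of_nat (w (k div n) * q (d - k)))"
    by (rule sum.inter_filter[symmetric]) simp
  also have "\<dots> = (\<Sum>(i, j)\<in>{(i, j). n * i + j = d}. of_nat (w i * q j))"
    by (rule sum.reindex_bij_witness[where i = "\<lambda>(i, j). n * i" and j = "\<lambda>k. (k div n, d - k)"])
      (use assms(1) in auto)
  also have "\<dots> = hilbert_series v $ d" by (simp add: hilbert_series_def v case_prod_unfold)
  finally show "hilbert_series v $ d = (fps_compose (hilbert_series w) (fps_X ^ n) * hilbert_series q) $ d" by simp
qed

lemma (in spline_net) hilbert_series_spline:
  assumes "hilbert_series (dim_image_spline f g h \<Delta> r) = fps_of_poly p / (1 - fps_X) ^ 3"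
  shows "hilbert_series (dim_spline \<Delta> r) = fps_of_poly (pcompose p (monom 1 n)) / (1 - fps_X) ^ 3"
proof -
  define H where "H = hilbert_series (\<lambda>d. card {m :: 3 \<Rightarrow>\<^sub>0 nat. mdeg m = d})"
  define Q where "Q = hilbert_series (dim_net_quotient f g h)"
  have H: "H * (1 - fps_X) ^ 3 = 1" unfolding H_def by (rule hilbert_series_polynomial_ring)
  have div: "F / (1 - fps_X) ^ 3 = F * H" for F :: "real fps"
  proof -
    have "F = (F * H) * (1 - fps_X) ^ 3" using H by (simp add: mult.assoc)
    moreover have "(1 - fps_X :: real fps) ^ 3 \<noteq> 0" using H by auto
    ultimately show ?thesis by (metis nonzero_mult_div_cancel_right)
  qed
  \<comment> \<open>Since \<open>H\<close> at the n-th power of the variable times \<open>Q\<close>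
    is \<open>H\<close> again, the series \<open>Q\<close> of the quotient is eliminated without
    being computed.\<close>
  have HQ: "H = fps_compose H (fps_X ^ n) * Q"
    unfolding H_def Q_def
    by (rule hilbert_series_convolution[OF n_pos]) (unfold dim_net_quotient_eq, rule card_monomials)
  have "hilbert_series (dim_spline \<Delta> r) = fps_compose (fps_of_poly p * H) (fps_X ^ n) * Q"
    using hilbert_series_convolution[OF n_pos dim_spline_eq] unfolding assms div Q_def .
  also have "\<dots> = fps_compose (fps_of_poly p) (fps_X ^ n) * (fps_compose H (fps_X ^ n) * Q)"
    using n_pos by (simp add: fps_compose_mult_distrib mult.assoc)
  also have "\<dots> = fps_compose (fps_of_poly p) (fps_X ^ n) * H" unfolding HQ[symmetric] ..
  also have "fps_compose (fps_of_poly p) (fps_X ^ n) = fps_of_poly (pcompose p (monom 1 n))"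
    using n_pos by (subst fps_of_poly_pcompose) (simp_all add: fps_of_poly_monom)
  finally show ?thesis unfolding div .
qed

theorem theorem3p2:
  fixes f g h :: poly3 and n r :: nat and \<Delta> :: mesh
  assumes "form n f" and "form n g" and "form n h"
    and "lin_indep3 f g h"
    and "no_basepoints f g h"
    and "is_mesh \<Delta>"
    and "\<And>\<tau>. \<tau> \<in> interior_edges \<Delta> \<Longrightarrow> edge_form \<Delta> \<tau> \<in> net f g h"
  shows "module_isomorphic PR
           (spline_module \<Delta> r)
           (tensor_right PR (pullback f g h) (image_spline_module f g h \<Delta> r) (regular_module PR))
       \<and> module_isomorphic PR
           (restrict_scalars (pullback f g h) (spline_module \<Delta> r))
           (tensor_left (class_ring :: real ring) Const
              (image_spline_module f g h \<Delta> r) (restrict_scalars Const (net_quotient f g h)))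
       \<and> (\<forall>d. dim_spline \<Delta> r d =
             (\<Sum>(i, j)\<in>{(i, j). n * i + j = d}.
                dim_image_spline f g h \<Delta> r i * dim_net_quotient f g h j))
       \<and> (\<forall>p :: real poly.
             hilbert_series (dim_image_spline f g h \<Delta> r) = fps_of_poly p / (1 - fps_X) ^ 3 \<longrightarrow>
             hilbert_series (dim_spline \<Delta> r) =
               fps_of_poly (pcompose p (monom 1 n)) / (1 - fps_X) ^ 3)"
proof -
  have basepoint_free: "basepoint_free_net f g h n"
    using assms(1-5) by (intro basepoint_free_net.intro)
  from basepoint_free_net.exists_monomial_basis[OF basepoint_free]
  obtain B where "finite B \<and> indep_mod {f, g, h} B mon \<and>
     (\<forall>p. \<exists>c. p - (\<Sum>b\<in>B. Const (c b) * mon b) \<in> ri.span {f, g, h})" ..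
  then have "net_with_basis f g h n B"
    using basepoint_free by (intro net_with_basis.intro net_with_basis_axioms.intro) iprover+
  moreover have "finite (cells \<Delta>)"
    using assms(6) unfolding is_mesh_def cell_complex_def by iprover
  then have "finite (Faces \<Delta>)" by (simp add: cells_def)
  ultimately interpret spline_net f g h n B \<Delta> r
    using assms(7) by (intro spline_net.intro spline_net_axioms.intro)
  show ?thesis
    by (intro conjI allI impI spline_module_iso_over_S spline_module_iso_over_R dim_spline_eq
        hilbert_series_spline)
qed

end
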